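(* Let $a\in C^2[0,1]$, $b\in C^1[0,1]$, and assume there is $a_0>0$ such that $a(x)>a_0$ for all $x\in[0,1]$. Let $\mathcal R$ be the operator on $L^2[0,1]$ defined by $$g=\mathcal Rf\iff ag'+bg=f,\quad g(0)=0,$$ which is equivalent to the operator $$\mathcal Rf(x)=e^{-C(x)}\int_0^x\frac{e^{C(t)}}{a(t)}f(t)\,dt,$$ where $C$ is an antiderivative of $b/a$. Then $\mathcal R$ is compact. Let $\psi_k$, $k=1,2,3,\dots$, be a complete orthonormal basis of $L^2[0,1]$ consisting of eigenfunctions of $\mathcal R\mathcal R^\top$, with corresponding eigenvalues $\lambda_k$, ordered so that $\lambda_1\ge\lambda_2\ge\dots$. Then there are constants $0<c_1<c_2$ with $c_1k^{-2}\le\lambda_k\le c_2k^{-2}$ for all $k$, and for all $k$ $$\|\psi_k\|_\infty\le\Psi_0,\qquad\|\psi_k'\|_\infty\le\Psi_1k,$$ where the constants $\Psi_0,\Psi_1$ depend only on the functions $a$ and $b$. Consequently, $\sup_k\|\psi_k\|_\infty<\infty$, and for every $\lambda>3$ there is a constant $K$ (which may depend on $\lambda$, but not on $n$ or $p$) such that for all integers $n,p\ge1$ the matrix $\Psi\in\mathbb R^{p\times p}$ with entries $\Psi_{k\ell}=\sum_{j=1}^n\psi_k(j/n)\psi_\ell(j/n)$ satisfies $$\big|u^\top(\Psi-nI_p)u\big|\le K\sum_{k=1}^pk^{\lambda}u_k^2\qquad\text{for all }u\in\mathbb R^p.$$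
   Context: $\mathcal R^\top$ denotes the $L^2[0,1]$-adjoint of $\mathcal R$. The ODE $ag'+bg=f$ with $f\in L^2[0,1]$ is understood for absolutely continuous $g$, with equality almost everywhere. $\|\cdot\|_\infty$ is the sup norm on $[0,1]$ (eigenfunctions are identified with their smooth representatives). *)

theory Defs
  imports "HOL-Analysis.Analysis"
begin

section \<open>Regularity on a set\<close>

text \<open>Derivatives are taken within \<open>S\<close>, hence one-sidedly at the end points of an interval.\<close>

fun Ck_on :: "nat \<Rightarrow> real set \<Rightarrow> (real \<Rightarrow> real) \<Rightarrow> bool" where
  "Ck_on 0 S f = continuous_on S f"
| "Ck_on (Suc k) S f =
    (\<exists>f'. (\<forall>x\<in>S. (f has_real_derivative f' x) (at x within S)) \<and> Ck_on k S f')"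

text \<open>The intervals \<open>[l i, r i]\<close>, \<open>i < n\<close>, are an arbitrary finite family of non-overlapping
  subintervals of \<open>S\<close>.\<close>

definition abs_continuous_on :: "real set \<Rightarrow> (real \<Rightarrow> real) \<Rightarrow> bool" where
  "abs_continuous_on S g \<longleftrightarrow>
    (\<forall>\<epsilon>>0. \<exists>\<delta>>0. \<forall>(n::nat) l r.
      (\<forall>i<n. l i \<le> r i \<and> {l i..r i} \<subseteq> S) \<longrightarrow>
      (\<forall>i<n. \<forall>j<n. i \<noteq> j \<longrightarrow> {l i<..<r i} \<inter> {l j<..<r j} = {}) \<longrightarrow>
      (\<Sum>i<n. r i - l i) < \<delta> \<longrightarrow>
      (\<Sum>i<n. \<bar>g (r i) - g (l i)\<bar>) < \<epsilon>)"

text \<open>Extended-real valued, so that it is \<open>\<infinity>\<close> for unbounded functions.\<close>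

definition sup_norm :: "(real \<Rightarrow> real) \<Rightarrow> ereal" where
  "sup_norm f = (SUP x\<in>{0..1}. ereal \<bar>f x\<bar>)"

section \<open>The real Hilbert space \<open>L\<^sup>2[0,1]\<close>\<close>

text \<open>Elements of \<open>L\<^sup>2[0,1]\<close> are represented by functions; equality in \<open>L\<^sup>2[0,1]\<close> is equality almost
  everywhere on \<open>[0,1]\<close>. Operators map representatives to representatives.\<close>

abbreviation unit_lebesgue :: "real measure" where
  "unit_lebesgue \<equiv> lebesgue_on {0..1}"

definition L2_space :: "(real \<Rightarrow> real) set" where
  "L2_space = {f \<in> borel_measurable unit_lebesgue. integrable unit_lebesgue (\<lambda>x. (f x)\<^sup>2)}"

definition L2_inner :: "(real \<Rightarrow> real) \<Rightarrow> (real \<Rightarrow> real) \<Rightarrow> real" where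
  "L2_inner f g = (LINT x|unit_lebesgue. f x * g x)"

definition L2_norm :: "(real \<Rightarrow> real) \<Rightarrow> real" where
  "L2_norm f = sqrt (L2_inner f f)"

definition L2_eq :: "(real \<Rightarrow> real) \<Rightarrow> (real \<Rightarrow> real) \<Rightarrow> bool" where
  "L2_eq f g \<longleftrightarrow> (AE x in unit_lebesgue. f x = g x)"

definition L2_linear_operator :: "((real \<Rightarrow> real) \<Rightarrow> (real \<Rightarrow> real)) \<Rightarrow> bool" where
  "L2_linear_operator T \<longleftrightarrow>
    (\<forall>f\<in>L2_space. T f \<in> L2_space) \<and>
    (\<forall>f\<in>L2_space. \<forall>g\<in>L2_space. L2_eq f g \<longrightarrow> L2_eq (T f) (T g)) \<and>
    (\<forall>f\<in>L2_space. \<forall>g\<in>L2_space. L2_eq (T (\<lambda>x. f x + g x)) (\<lambda>x. T f x + T g x)) \<and>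
    (\<forall>c. \<forall>f\<in>L2_space. L2_eq (T (\<lambda>x. c * f x)) (\<lambda>x. c * T f x))"

definition L2_compact_operator :: "((real \<Rightarrow> real) \<Rightarrow> (real \<Rightarrow> real)) \<Rightarrow> bool" where
  "L2_compact_operator T \<longleftrightarrow>
    L2_linear_operator T \<and>
    (\<forall>f :: nat \<Rightarrow> real \<Rightarrow> real. (\<forall>n. f n \<in> L2_space) \<longrightarrow> (\<exists>B. \<forall>n. L2_norm (f n) \<le> B) \<longrightarrow>
      (\<exists>r h. strict_mono (r :: nat \<Rightarrow> nat) \<and> h \<in> L2_space \<and>
        (\<lambda>n. L2_norm (\<lambda>x. T (f (r n)) x - h x)) \<longlonglongrightarrow> 0))"

text \<open>The same description as that of \<^const>\<open>adjoint\<close> for Euclidean spaces; the value at \<open>g\<close> is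
  determined up to equality almost everywhere.\<close>

definition L2_adjoint :: "((real \<Rightarrow> real) \<Rightarrow> (real \<Rightarrow> real)) \<Rightarrow> (real \<Rightarrow> real) \<Rightarrow> (real \<Rightarrow> real)" where
  "L2_adjoint T g =
    (SOME h. h \<in> L2_space \<and> (\<forall>f\<in>L2_space. L2_inner (T f) g = L2_inner f h))"

definition L2_eigenfunction ::
  "((real \<Rightarrow> real) \<Rightarrow> (real \<Rightarrow> real)) \<Rightarrow> real \<Rightarrow> (real \<Rightarrow> real) \<Rightarrow> bool" where
  "L2_eigenfunction T \<mu> \<psi> \<longleftrightarrow>
    \<psi> \<in> L2_space \<and> \<not> L2_eq \<psi> (\<lambda>x. 0) \<and> L2_eq (T \<psi>) (\<lambda>x. \<mu> * \<psi> x)"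

text \<open>Sequences are indexed by \<open>k = 1, 2, 3, \<dots>\<close>; the value at \<open>0\<close> is irrelevant.\<close>

definition L2_orthonormal_basis :: "(nat \<Rightarrow> real \<Rightarrow> real) \<Rightarrow> bool" where
  "L2_orthonormal_basis e \<longleftrightarrow>
    (\<forall>k\<ge>1. e k \<in> L2_space) \<and>
    (\<forall>k\<ge>1. \<forall>l\<ge>1. L2_inner (e k) (e l) = (if k = l then 1 else 0)) \<and>
    (\<forall>f\<in>L2_space.
      (\<lambda>N. L2_norm (\<lambda>x. f x - (\<Sum>k=1..N. L2_inner f (e k) * e k x))) \<longlonglongrightarrow> 0)"

section \<open>The solution operator\<close>

definition ode_solution ::
  "(real \<Rightarrow> real) \<Rightarrow> (real \<Rightarrow> real) \<Rightarrow> (real \<Rightarrow> real) \<Rightarrow> (real \<Rightarrow> real) \<Rightarrow> bool" where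
  "ode_solution a b f g \<longleftrightarrow>
    abs_continuous_on {0..1} g \<and>
    (AE x in unit_lebesgue. \<exists>d. (g has_real_derivative d) (at x within {0..1}) \<and>
      a x * d + b x * g x = f x) \<and>
    g 0 = 0"

text \<open>A solution is determined on \<open>[0,1]\<close> only, which is why this is a choice and not a definite
  description.\<close>

definition R_op :: "(real \<Rightarrow> real) \<Rightarrow> (real \<Rightarrow> real) \<Rightarrow> (real \<Rightarrow> real) \<Rightarrow> (real \<Rightarrow> real)" where
  "R_op a b f = (SOME g. ode_solution a b f g)"

text \<open>\<open>\<psi>\<close> is a complete orthonormal basis of eigenfunctions of \<open>R R\<^sup>T\<close>, and \<open>ev\<close> lists the
  corresponding eigenvalues in decreasing order.\<close>

definition ordered_eigenbasis ::
  "(real \<Rightarrow> real) \<Rightarrow> (real \<Rightarrow> real) \<Rightarrow> (nat \<Rightarrow> real \<Rightarrow> real) \<Rightarrow> (nat \<Rightarrow> real) \<Rightarrow> bool" where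
  "ordered_eigenbasis a b \<psi> ev \<longleftrightarrow>
    L2_orthonormal_basis \<psi> \<and>
    (\<forall>k\<ge>1. L2_eigenfunction (\<lambda>f. R_op a b (L2_adjoint (R_op a b) f)) (ev k) (\<psi> k)) \<and>
    (\<forall>k\<ge>1. ev (Suc k) \<le> ev k)"

section \<open>Representatives and the matrix of discrete inner products\<close>

text \<open>A continuous representative is unique on \<open>[0,1]\<close>; \<open>C\<^sup>1\<close> is what \<open>\<parallel>\<psi>'\<parallel>\<^sub>\<infinity>\<close> needs.\<close>

definition smooth_representative :: "(real \<Rightarrow> real) \<Rightarrow> (real \<Rightarrow> real) \<Rightarrow> bool" where
  "smooth_representative \<psi> \<phi> \<longleftrightarrow> Ck_on 1 {0..1} \<phi> \<and> L2_eq \<phi> \<psi>"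

definition deriv01 :: "(real \<Rightarrow> real) \<Rightarrow> (real \<Rightarrow> real)" where
  "deriv01 \<phi> x = vector_derivative \<phi> (at x within {0..1})"

definition gram_matrix :: "(nat \<Rightarrow> real \<Rightarrow> real) \<Rightarrow> nat \<Rightarrow> nat \<Rightarrow> nat \<Rightarrow> real" where
  "gram_matrix \<phi> n k l = (\<Sum>j=1..n. \<phi> k (real j / real n) * \<phi> l (real j / real n))"

text \<open>\<open>u\<^sup>T A u\<close> for a \<open>p \<times> p\<close> matrix and a vector with indices \<open>1, \<dots>, p\<close>.\<close>

definition quad_form :: "nat \<Rightarrow> (nat \<Rightarrow> nat \<Rightarrow> real) \<Rightarrow> (nat \<Rightarrow> real) \<Rightarrow> real" where
  "quad_form p A u = (\<Sum>k=1..p. \<Sum>l=1..p. u k * A k l * u l)"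

end

theory Submission
  imports Defs "HOL-Complex_Analysis.Great_Picard"
begin

text \<open>
  On \<open>[0,1]\<close> one has \<open>R f = e\<^sup>-\<^sup>C \<integral>\<^sub>0\<^sup>x e\<^sup>C f / a\<close> and \<open>R\<^sup>T g = e\<^sup>C / a \<integral>\<^sub>x\<^sup>1 e\<^sup>-\<^sup>C g\<close>, because an absolutely
  continuous function is the integral of its derivative and an indefinite integral is differentiable
  almost everywhere. Neither spectral theory nor the asymptotics of a Sturm-Liouville problem is
  needed. Orthogonality of the \<open>R\<^sup>T \<psi>\<^sub>k\<close> and Parseval's identity, tested against bumps with disjoint
  supports, give \<open>\<lambda>\<^sub>k \<ge> c k\<^sup>-\<^sup>2\<close>. With \<open>\<omega> = \<lambda>\<^sup>-\<^sup>1\<^sup>/\<^sup>2\<close> the eigenvalue equation is the first order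
  system \<open>y' = \<omega> P s\<close>, \<open>s' = - \<omega> Q y\<close>, \<open>y(0) = s(1) = 0\<close> with \<open>y = e\<^sup>C \<psi>\<close>, \<open>P = e\<^sup>2\<^sup>C / a\<^sup>2\<close> and
  \<open>Q = e\<^sup>-\<^sup>2\<^sup>C\<close>. The derivative of the energy \<open>Q y\<^sup>2 + P s\<^sup>2\<close> does not contain \<open>\<omega>\<close>, so Gronwall's inequality
  bounds the energy, hence \<open>\<psi>\<close>, uniformly, and \<open>\<psi>'\<close> by a multiple of \<open>1 + \<omega>\<close>. The bound on \<open>y'\<close>
  in turn makes \<open>\<psi>\<close> nearly determined by its means over a partition, and counting dimensions gives
  \<open>\<lambda>\<^sub>k \<le> c k\<^sup>-\<^sup>2\<close>. Finally, \<open>u\<^sup>T \<Psi> u - n u\<^sup>T u\<close> is the error of a Riemann sum for the square of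
  \<open>\<Sum> u\<^sub>k \<psi>\<^sub>k\<close>, which the Lipschitz constant \<open>C (\<Sum> k \<bar>u\<^sub>k\<bar>)\<^sup>2\<close> of that square controls.
\<close>

text \<open>The constants may depend on a and b alone, so each one is obtained before
  \<open>\<psi>\<close> and \<open>ev\<close> appear. An eigenbasis does not come with positive
  eigenvalues: \<omega> makes sense only after the lower bound, whose proof must therefore never
  divide by an eigenvalue. The regularity estimates, and with them the upper bound, come afterwards.

  The system dictates the weights of the energy. The derivatives of Q y^2 and P s^2 contain 2
  \<omega> P Q s y with opposite signs, and only Q' y^2 + P' s^2 is left. Now Q y^2 = \<psi>^2 has
  integral 1, and by the boundary values so has P s^2. Comparing the energy at a point with its mean
  2 then gives a bound that is uniform in \<omega>.

  The measure theoretic obstacle is that the data are only square integrable, that absolute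
  continuity is given by \<epsilon> and \<delta>, and that \<open>R_op\<close> and
  \<open>L2_adjoint\<close> are choices. Both halves of Lebesgue's fundamental theorem are used to
  replace these choices by explicit integrals.\<close>

lemma continuous_on_Icc_bound:
  fixes w :: "real \<Rightarrow> real"
  assumes "continuous_on {s..t} w"
  obtains B where "B > 0" "\<And>x. x \<in> {s..t} \<Longrightarrow> \<bar>w x\<bar> \<le> B"
  using compact_imp_bounded[OF compact_continuous_image[OF assms compact_Icc]]
  unfolding bounded_pos real_norm_def by blast

section \<open>Absolutely continuous functions\<close>

text \<open>The index type is arbitrary, whereas \<open>abs_continuous_on\<close> numbers the
  intervals by an initial segment of the naturals; the tagged intervals of a division can then index
  themselves.\<close>

definition nonoverlapping_intervals ::
    "real set \<Rightarrow> 'i set \<Rightarrow> ('i \<Rightarrow> real) \<Rightarrow> ('i \<Rightarrow> real) \<Rightarrow> bool" where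
  "nonoverlapping_intervals S I l r \<longleftrightarrow> finite I \<and> (\<forall>i\<in>I. l i \<le> r i \<and> {l i..r i} \<subseteq> S) \<and>
    (\<forall>i\<in>I. \<forall>j\<in>I. i \<noteq> j \<longrightarrow> {l i<..<r i} \<inter> {l j<..<r j} = {})"

lemma abs_continuous_onD:
  fixes g :: "real \<Rightarrow> real"
  assumes "abs_continuous_on S g" "\<epsilon> > 0"
  obtains \<delta> where "\<delta> > 0"
    "\<And>(I :: 'i set) l r. \<lbrakk>nonoverlapping_intervals S I l r; (\<Sum>i\<in>I. r i - l i) < \<delta>\<rbrakk>
        \<Longrightarrow> (\<Sum>i\<in>I. \<bar>g (r i) - g (l i)\<bar>) < \<epsilon>"
proof -
  obtain \<delta> where "\<delta> > 0" and \<delta>: "\<forall>(n::nat) l r.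
      (\<forall>i<n. l i \<le> r i \<and> {l i..r i} \<subseteq> S) \<longrightarrow>
      (\<forall>i<n. \<forall>j<n. i \<noteq> j \<longrightarrow> {l i<..<r i} \<inter> {l j<..<r j} = {}) \<longrightarrow>
      (\<Sum>i<n. r i - l i) < \<delta> \<longrightarrow>
      (\<Sum>i<n. \<bar>g (r i) - g (l i)\<bar>) < \<epsilon>"
    using assms(1)[unfolded abs_continuous_on_def, THEN spec, THEN mp, OF assms(2)]
    by (elim exE conjE) (rule that)
  show thesis
  proof
    show "\<delta> > 0" by fact
    fix I :: "'i set" and l r
    assume "nonoverlapping_intervals S I l r" and small: "(\<Sum>i\<in>I. r i - l i) < \<delta>"
    then have I: "finite I" "\<And>i. i \<in> I \<Longrightarrow> l i \<le> r i \<and> {l i..r i} \<subseteq> S"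
        "\<And>i j. \<lbrakk>i \<in> I; j \<in> I; i \<noteq> j\<rbrakk> \<Longrightarrow> {l i<..<r i} \<inter> {l j<..<r j} = {}"
      by (simp_all add: nonoverlapping_intervals_def)
    obtain h where h: "bij_betw h {..<card I} I"
      using ex_bij_betw_nat_finite[OF I(1)] by (auto simp: atLeast0LessThan)
    have hI: "h i \<in> I" if "i < card I" for i
      using h that by (auto simp: bij_betw_def)
    have hinj: "h i \<noteq> h j" if "i < card I" "j < card I" "i \<noteq> j" for i j
      using h that by (auto simp: bij_betw_def inj_on_def)
    have "(\<Sum>i<card I. \<bar>g (r (h i)) - g (l (h i))\<bar>) < \<epsilon>"
    proof (rule \<delta>[rule_format, of "card I" "l \<circ> h" "r \<circ> h", unfolded o_def])
      show "(\<Sum>i<card I. r (h i) - l (h i)) < \<delta>"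
        using small sum.reindex_bij_betw[OF h, of "\<lambda>i. r i - l i"] by simp
      show "{l (h i)<..<r (h i)} \<inter> {l (h j)<..<r (h j)} = {}"
        if "i < card I" "j < card I" "i \<noteq> j" for i j
        using I(3) hI hinj that by presburger
    qed (use I(2) hI in auto)
    then show "(\<Sum>i\<in>I. \<bar>g (r i) - g (l i)\<bar>) < \<epsilon>"
      using sum.reindex_bij_betw[OF h, of "\<lambda>i. \<bar>g (r i) - g (l i)\<bar>"] by simp
  qed
qed

lemma abs_continuous_onI:
  fixes g :: "real \<Rightarrow> real"
  assumes "\<And>\<epsilon>. \<epsilon> > 0 \<Longrightarrow> \<exists>\<delta>>0. \<forall>(I :: nat set) l r. nonoverlapping_intervals S I l r \<longrightarrow>
      (\<Sum>i\<in>I. r i - l i) < \<delta> \<longrightarrow> (\<Sum>i\<in>I. \<bar>g (r i) - g (l i)\<bar>) < \<epsilon>"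
  shows "abs_continuous_on S g"
  unfolding abs_continuous_on_def
proof (intro allI impI)
  fix \<epsilon> :: real assume "\<epsilon> > 0"
  obtain \<delta> where "\<delta> > 0" and \<delta>: "\<forall>(I :: nat set) l r. nonoverlapping_intervals S I l r \<longrightarrow>
      (\<Sum>i\<in>I. r i - l i) < \<delta> \<longrightarrow> (\<Sum>i\<in>I. \<bar>g (r i) - g (l i)\<bar>) < \<epsilon>"
    using assms[OF \<open>\<epsilon> > 0\<close>] by (elim exE conjE) (rule that)
  show "\<exists>\<delta>>0. \<forall>(n::nat) l r.
      (\<forall>i<n. l i \<le> r i \<and> {l i..r i} \<subseteq> S) \<longrightarrow>
      (\<forall>i<n. \<forall>j<n. i \<noteq> j \<longrightarrow> {l i<..<r i} \<inter> {l j<..<r j} = {}) \<longrightarrow>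
      (\<Sum>i<n. r i - l i) < \<delta> \<longrightarrow>
      (\<Sum>i<n. \<bar>g (r i) - g (l i)\<bar>) < \<epsilon>"
  proof (intro exI conjI allI impI)
    show "\<delta> > 0" by fact
    fix n :: nat and l r
    assume "\<forall>i<n. l i \<le> r i \<and> {l i..r i} \<subseteq> S"
      "\<forall>i<n. \<forall>j<n. i \<noteq> j \<longrightarrow> {l i<..<r i} \<inter> {l j<..<r j} = {}"
    then have "nonoverlapping_intervals S {..<n} l r"
      by (simp add: nonoverlapping_intervals_def)
    then show "(\<Sum>i<n. \<bar>g (r i) - g (l i)\<bar>) < \<epsilon>" if "(\<Sum>i<n. r i - l i) < \<delta>"
      using \<delta> that by blast
  qed
qed

text \<open>The points where the difference quotients do not converge are covered, in the sense of Vitali, by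
  intervals with a large error; by Henstock's lemma disjoint ones among them have small total length.\<close>

theorem indefinite_integral_has_derivative_AE:
  fixes f :: "real \<Rightarrow> real"
  assumes f: "f integrable_on {a..b}"
  shows "negligible {x\<in>{a..b}.
    \<not> ((\<lambda>u. integral {a..u} f) has_real_derivative f x) (at x within {a..b})}"
proof -
  define F where "F u = integral {a..u} f" for u
  \<comment> \<open>The difference quotient at x is more than 1 / (k + 1) away from f x at
    arbitrarily small scales. The union over k contains every point where f x is not the
    derivative.\<close>
  define bad where "bad k = {x\<in>{a..b}. \<forall>d>0. \<exists>y\<in>{a..b}. y \<noteq> x \<and> \<bar>y - x\<bar> < d \<and>
      \<bar>F y - F x - (y - x) * f x\<bar> > \<bar>y - x\<bar> / real (Suc k)}" for k
  have Fdiff: "integral {s..t} f = F t - F s" if "a \<le> s" "s \<le> t" "t \<le> b" for s t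
  proof -
    have "F s + integral {s..t} f = F t"
      unfolding F_def
      by (rule Henstock_Kurzweil_Integration.integral_combine)
         (use that integrable_subinterval_real[OF f] in auto)
    then show ?thesis by simp
  qed
  have "negligible (bad k)" for k
    unfolding negligible_outer_le
  proof (intro allI impI)
    fix e :: real assume "e > 0"
    then have e: "e / real (Suc k) > 0" by simp
    have f': "f integrable_on cbox a b" using f by simp
    \<comment> \<open>The error of an interval from \<open>K\<close> below exceeds its length
      divided by k + 1, so a total error below e / (k + 1) forces a total length below e.\<close>
    obtain \<gamma> where \<gamma>: "gauge \<gamma>" and
      hen: "\<And>p. \<lbrakk>p tagged_partial_division_of (cbox a b); \<gamma> fine p\<rbrakk> \<Longrightarrow>
             sum (\<lambda>(x,k). norm(measure lborel k *\<^sub>R f x - integral k f)) p < e / real (Suc k)"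
      by (rule Henstock_lemma[OF f' e]) (rule that)
    \<comment> \<open>A pair (x, y) encodes the interval between its tag x and a point y on either
      side of x. Centre and radius appear because the covering theorem speaks of balls.\<close>
    define iv where "iv = (\<lambda>(x,y). {min x y..max x y :: real})"
    define ct where "ct = (\<lambda>(x,y). (x + y) / 2 :: real)"
    define rd where "rd = (\<lambda>(x,y). \<bar>y - x\<bar> / 2 :: real)"
    define K where "K = {(x,y). x \<in> {a..b} \<and> y \<in> {a..b} \<and> y \<noteq> x \<and> iv (x,y) \<subseteq> \<gamma> x \<and>
      \<bar>F y - F x - (y - x) * f x\<bar> > \<bar>y - x\<bar> / real (Suc k)}"
    have iv_cball: "cball (ct i) (rd i) = iv i" for i
    proof -
      obtain x y where i: "i = (x,y)" by (cases i)
      have "(x + y) / 2 - \<bar>y - x\<bar> / 2 = min x y" "(x + y) / 2 + \<bar>y - x\<bar> / 2 = max x y"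
        by (auto simp: min_def max_def abs_if add_divide_distrib diff_divide_distrib)
      then show ?thesis
        by (simp add: i iv_def ct_def rd_def cball_eq_atLeastAtMost)
    qed
    have "\<exists>i. i \<in> K \<and> x \<in> cball (ct i) (rd i) \<and> rd i < d" if "x \<in> bad k" "0 < d" for x d
    proof -
      obtain d' where d': "d' > 0" "ball x d' \<subseteq> \<gamma> x"
        using \<gamma> unfolding gauge_def by (meson open_contains_ball)
      have "\<forall>d>0. \<exists>y\<in>{a..b}. y \<noteq> x \<and> \<bar>y - x\<bar> < d \<and>
          \<bar>F y - F x - (y - x) * f x\<bar> > \<bar>y - x\<bar> / real (Suc k)"
        using \<open>x \<in> bad k\<close> unfolding bad_def by blast
      moreover have "min d d' > 0" using d'(1) \<open>0 < d\<close> by simp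
      ultimately obtain y where y: "y\<in>{a..b}" "y \<noteq> x" "\<bar>y - x\<bar> < min d d'"
        "\<bar>F y - F x - (y - x) * f x\<bar> > \<bar>y - x\<bar> / real (Suc k)"
        by meson
      have "iv (x,y) \<subseteq> ball x d'"
        using y(3) by (auto simp: iv_def dist_real_def)
      then have "(x,y) \<in> K"
        using y that(1) d' by (auto simp: K_def bad_def)
      moreover have "x \<in> cball (ct (x,y)) (rd (x,y))"
        unfolding iv_cball by (auto simp: iv_def)
      moreover have "rd (x,y) < d"
        using y by (auto simp: rd_def)
      ultimately show ?thesis by blast
    qed
    moreover have "0 < rd i" if "i \<in> K" for i
      using that by (auto simp: K_def rd_def)
    ultimately obtain C where C: "countable C" "C \<subseteq> K"
      "pairwise (\<lambda>i j. disjnt (iv i) (iv j)) C"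
      "negligible (bad k - (\<Union>i\<in>C. iv i))"
      using Vitali_covering_theorem_cballs[of K rd "bad k" ct] unfolding iv_cball by metis
    have ivm: "iv i \<in> lmeasurable" for i
      by (cases i) (auto simp: iv_def)
    \<comment> \<open>Henstock's lemma concerns finitely many intervals; the estimate passes to the
      countable family through its finite subfamilies.\<close>
    have bound: "measure lebesgue (\<Union>i\<in>D. iv i) \<le> e" if D: "D \<subseteq> C" "finite D" for D
    proof -
      define p where "p = (\<lambda>i. (fst i, iv i)) ` D"
      have DK: "D \<subseteq> K" using D C by auto
      have disj: "iv i \<inter> iv j = {}" if "i \<in> D" "j \<in> D" "i \<noteq> j" for i j
        using C(3) D(1) that unfolding pairwise_def disjnt_def by blast
      have ne: "iv i \<noteq> {}" for i
        by (cases i) (auto simp: iv_def)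
      have inj: "inj_on (\<lambda>i. (fst i, iv i)) D"
        using disj ne by (fastforce simp: inj_on_def)
      have "p tagged_partial_division_of (cbox a b)"
        unfolding tagged_partial_division_of_def
      proof (intro conjI allI impI)
        show "finite p" using D by (simp add: p_def)
        fix x L assume "(x,L) \<in> p"
        then obtain y where y: "(x,y) \<in> D" "L = iv (x,y)"
          unfolding p_def by force
        then have xy: "x \<in> {a..b}" "y \<in> {a..b}" using DK by (auto simp: K_def)
        show "x \<in> L" using y by (auto simp: iv_def)
        show "L \<subseteq> cbox a b" using y xy by (auto simp: iv_def)
        show "\<exists>a b. L = cbox a b" using y by (auto simp: iv_def)
      next
        fix x L x' L' assume *: "(x,L) \<in> p \<and> (x',L') \<in> p \<and> (x,L) \<noteq> (x',L')"
        then obtain i j where "i \<in> D" "j \<in> D" "x = fst i" "L = iv i" "x' = fst j" "L' = iv j"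
          unfolding p_def by blast
        moreover from this have "i \<noteq> j" using * by blast
        ultimately show "interior L \<inter> interior L' = {}"
          using disj[of i j] interior_subset by blast
      qed
      moreover have "iv i \<subseteq> \<gamma> (fst i)" if "i \<in> D" for i
        using DK that unfolding K_def by force
      then have "\<gamma> fine p"
        unfolding p_def fine_def by blast
      ultimately have "sum (\<lambda>(x,k). norm(measure lborel k *\<^sub>R f x - integral k f)) p < e / real (Suc k)"
        by (rule hen)
      also have "sum (\<lambda>(x,k). norm(measure lborel k *\<^sub>R f x - integral k f)) p
          = (\<Sum>i\<in>D. norm (measure lborel (iv i) *\<^sub>R f (fst i) - integral (iv i) f))"
        unfolding p_def by (subst sum.reindex[OF inj]) auto
      finally have *: "(\<Sum>i\<in>D. norm (measure lborel (iv i) *\<^sub>R f (fst i) - integral (iv i) f)) < e / real (Suc k)" .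
      have "measure lebesgue (iv i) / real (Suc k) \<le> norm (measure lborel (iv i) *\<^sub>R f (fst i) - integral (iv i) f)"
        if "i \<in> D" for i
      proof -
        obtain x y where i: "i = (x,y)" by (cases i)
        then have xy: "x \<in> {a..b}" "y \<in> {a..b}"
            "\<bar>F y - F x - (y - x) * f x\<bar> > \<bar>y - x\<bar> / real (Suc k)"
          using DK that by (auto simp: K_def)
        have m: "measure lebesgue (iv i) = \<bar>y - x\<bar>" "measure lborel (iv i) = \<bar>y - x\<bar>"
          by (auto simp: i iv_def)
        have "\<bar>\<bar>y - x\<bar> * f x - integral (iv i) f\<bar> = \<bar>F y - F x - (y - x) * f x\<bar>"
        proof (cases "x \<le> y")
          case True
          then have "integral (iv i) f = F y - F x"
            using Fdiff xy by (auto simp: i iv_def min_def max_def)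
          then show ?thesis using True by (simp add: abs_minus_commute algebra_simps)
        next
          case False
          then have "integral (iv i) f = F x - F y"
            using Fdiff xy by (auto simp: i iv_def min_def max_def)
          then show ?thesis using False by (simp add: algebra_simps)
        qed
        then show ?thesis using xy(3) unfolding m by (simp add: i)
      qed
      then have "(\<Sum>i\<in>D. measure lebesgue (iv i) / real (Suc k)) < e / real (Suc k)"
        by (intro le_less_trans[OF sum_mono *])
      then have "(\<Sum>i\<in>D. measure lebesgue (iv i)) < e"
        by (simp add: sum_divide_distrib[symmetric] divide_less_cancel)
      moreover have "measure lebesgue (\<Union>i\<in>D. iv i) \<le> (\<Sum>i\<in>D. measure lebesgue (iv i))"
        by (rule measure_UNION_le) (use D ivm in \<open>auto simp: fmeasurableD\<close>)
      ultimately show ?thesis by simp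
    qed
    have lm: "(\<Union>i\<in>C. iv i) \<in> lmeasurable" "measure lebesgue (\<Union>i\<in>C. iv i) \<le> e"
      using fmeasurable_UN_bound[of C iv lebesgue e] measure_UN_bound[of C iv lebesgue e] C(1) ivm bound by auto
    \<comment> \<open>The Vitali family covers the bad points up to a null set, which is added
      back.\<close>
    define T where "T = (\<Union>i\<in>C. iv i) \<union> (bad k - (\<Union>i\<in>C. iv i))"
    have "T \<in> lmeasurable"
      unfolding T_def by (rule fmeasurable.Un[OF lm(1) negligible_imp_measurable[OF C(4)]])
    moreover have "measure lebesgue T = measure lebesgue (\<Union>i\<in>C. iv i)"
      by (rule measure_negligible_symdiff[OF lm(1)])
         (rule negligible_subset[OF C(4)], auto simp: T_def)
    moreover have "bad k \<subseteq> T" by (auto simp: T_def)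
    ultimately show "\<exists>T. bad k \<subseteq> T \<and> T \<in> lmeasurable \<and> measure lebesgue T \<le> e"
      using lm(2) by metis
  qed
  then have "negligible (\<Union>k. bad k)"
    by (rule negligible_Union_nat)
  moreover have "(F has_real_derivative f x) (at x within {a..b})"
    if "x \<in> {a..b}" "x \<notin> (\<Union>k. bad k)" for x
    unfolding has_field_derivative_def has_derivative_within_alt
  proof (intro conjI allI impI)
    show "bounded_linear ((*) (f x))" by (rule bounded_linear_mult_right)
    fix e :: real assume "e > 0"
    then obtain k where k: "1 / real (Suc k) < e"
      by (metis inverse_eq_divide reals_Archimedean)
    from that obtain d where d: "d > 0" "\<forall>y\<in>{a..b}. y \<noteq> x \<and> \<bar>y - x\<bar> < d \<longrightarrow>
      \<bar>F y - F x - (y - x) * f x\<bar> \<le> \<bar>y - x\<bar> / real (Suc k)"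
      unfolding bad_def by (force simp: not_less)
    have "norm (F y - F x - f x * (y - x)) \<le> e * norm (y - x)"
      if "y \<in> {a..b}" "norm (y - x) < d" for y
    proof (cases "y = x")
      case False
      then have "\<bar>F y - F x - (y - x) * f x\<bar> \<le> \<bar>y - x\<bar> * (1 / real (Suc k))"
        using d that by auto
      also have "\<dots> \<le> \<bar>y - x\<bar> * e"
        using k by (intro mult_left_mono) auto
      finally show ?thesis by (simp add: mult.commute)
    qed auto
    then show "\<exists>d>0. \<forall>y\<in>{a..b}. norm (y - x) < d \<longrightarrow>
        norm (F y - F x - f x * (y - x)) \<le> e * norm (y - x)"
      using d(1) by blast
  qed
  then have "{x\<in>{a..b}. \<not> (F has_real_derivative f x) (at x within {a..b})} \<subseteq> (\<Union>k. bad k)"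
    by blast
  ultimately show ?thesis
    unfolding F_def by (rule negligible_subset)
qed

section \<open>Elementary properties of absolute continuity\<close>

lemma abs_continuous_on_imp_continuous_on:
  assumes g: "abs_continuous_on {a..b} g"
  shows "continuous_on {a..b} g"
  unfolding continuous_on_iff
proof (intro ballI allI impI)
  fix x and e :: real assume "x \<in> {a..b}" "e > 0"
  obtain d where "d > 0" and d:
    "\<And>(I :: unit set) l r. \<lbrakk>nonoverlapping_intervals {a..b} I l r; (\<Sum>i\<in>I. r i - l i) < d\<rbrakk>
        \<Longrightarrow> (\<Sum>i\<in>I. \<bar>g (r i) - g (l i)\<bar>) < e"
    by (rule abs_continuous_onD[where 'i = unit, OF g \<open>e > 0\<close>]) (rule that)
  have "dist (g y) (g x) < e" if y: "y \<in> {a..b}" "dist y x < d" for y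
  proof -
    have "\<bar>g (max x y) - g (min x y)\<bar> < e"
      using d[of "{()}" "\<lambda>_. min x y" "\<lambda>_. max x y"] y \<open>x \<in> {a..b}\<close>
      by (simp add: nonoverlapping_intervals_def dist_real_def)
    then show ?thesis
      by (cases "x \<le> y") (auto simp: dist_real_def min_def max_def abs_minus_commute)
  qed
  then show "\<exists>d>0. \<forall>y\<in>{a..b}. dist y x < d \<longrightarrow> dist (g y) (g x) < e"
    using \<open>d > 0\<close> by blast
qed

lemma abs_continuous_on_cong:
  assumes "\<And>x. x \<in> S \<Longrightarrow> f x = g x"
  shows "abs_continuous_on S f \<longleftrightarrow> abs_continuous_on S g"
proof -
  have *: "abs_continuous_on S g" if fg: "\<And>x. x \<in> S \<Longrightarrow> f x = g x" and f: "abs_continuous_on S f" for f g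
  proof (rule abs_continuous_onI)
    fix \<epsilon> :: real assume "\<epsilon> > 0"
    obtain \<delta> where "\<delta> > 0" and \<delta>: "\<And>(I :: nat set) l r. \<lbrakk>nonoverlapping_intervals S I l r; (\<Sum>i\<in>I. r i - l i) < \<delta>\<rbrakk>
        \<Longrightarrow> (\<Sum>i\<in>I. \<bar>f (r i) - f (l i)\<bar>) < \<epsilon>"
      by (rule abs_continuous_onD[where 'i = nat, OF f \<open>\<epsilon> > 0\<close>]) (rule that)
    have "(\<Sum>i\<in>I. \<bar>g (r i) - g (l i)\<bar>) < \<epsilon>"
      if I: "nonoverlapping_intervals S I l r" "(\<Sum>i\<in>I. r i - l i) < \<delta>" for I :: "nat set" and l r
    proof -
      have "f (r i) = g (r i)" "f (l i) = g (l i)" if "i \<in> I" for i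
      proof -
        have "l i \<le> r i" "{l i..r i} \<subseteq> S" using I(1) that by (auto simp: nonoverlapping_intervals_def)
        then have "l i \<in> S" "r i \<in> S" by auto
        then show "f (r i) = g (r i)" "f (l i) = g (l i)" using fg by auto
      qed
      then show ?thesis using \<delta>[OF I] by simp
    qed
    then show "\<exists>\<delta>>0. \<forall>(I :: nat set) l r. nonoverlapping_intervals S I l r \<longrightarrow>
        (\<Sum>i\<in>I. r i - l i) < \<delta> \<longrightarrow> (\<Sum>i\<in>I. \<bar>g (r i) - g (l i)\<bar>) < \<epsilon>"
      using \<open>\<delta> > 0\<close> by blast
  qed
  show ?thesis
    using *[of f g] *[of g f] assms by metis
qed

lemma abs_continuous_on_subset:
  assumes f: "abs_continuous_on S f" and "T \<subseteq> S"
  shows "abs_continuous_on T f"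
proof (rule abs_continuous_onI)
  fix \<epsilon> :: real assume "\<epsilon> > 0"
  obtain \<delta> where "\<delta> > 0" and \<delta>: "\<And>(I :: nat set) l r. \<lbrakk>nonoverlapping_intervals S I l r; (\<Sum>i\<in>I. r i - l i) < \<delta>\<rbrakk>
      \<Longrightarrow> (\<Sum>i\<in>I. \<bar>f (r i) - f (l i)\<bar>) < \<epsilon>"
    by (rule abs_continuous_onD[where 'i = nat, OF f \<open>\<epsilon> > 0\<close>]) (rule that)
  moreover have "nonoverlapping_intervals S I l r" if "nonoverlapping_intervals T I l r" for I :: "nat set" and l r
    using that \<open>T \<subseteq> S\<close> unfolding nonoverlapping_intervals_def by fast
  ultimately show "\<exists>\<delta>>0. \<forall>(I :: nat set) l r. nonoverlapping_intervals T I l r \<longrightarrow>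
      (\<Sum>i\<in>I. r i - l i) < \<delta> \<longrightarrow> (\<Sum>i\<in>I. \<bar>f (r i) - f (l i)\<bar>) < \<epsilon>"
    by blast
qed

lemma abs_continuous_on_mult:
  assumes f: "abs_continuous_on {a..b} f" and g: "abs_continuous_on {a..b} g"
  shows "abs_continuous_on {a..b} (\<lambda>x. f x * g x)"
proof -
  obtain A where A: "\<And>x. x \<in> {a..b} \<Longrightarrow> \<bar>f x\<bar> \<le> A"
    using continuous_on_Icc_bound[OF abs_continuous_on_imp_continuous_on[OF f]] by blast
  obtain B where B: "\<And>x. x \<in> {a..b} \<Longrightarrow> \<bar>g x\<bar> \<le> B"
    using continuous_on_Icc_bound[OF abs_continuous_on_imp_continuous_on[OF g]] by blast
  define M where "M = max 1 (max A B)"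
  have M: "M > 0" "\<And>x. x \<in> {a..b} \<Longrightarrow> \<bar>f x\<bar> \<le> M" "\<And>x. x \<in> {a..b} \<Longrightarrow> \<bar>g x\<bar> \<le> M"
    using A B unfolding M_def by fastforce+
  show ?thesis
  proof (rule abs_continuous_onI)
    fix \<epsilon> :: real assume "\<epsilon> > 0"
    then have e: "\<epsilon> / (2 * M) > 0" using M by simp
    obtain d1 where d1: "d1 > 0" "\<And>(I :: nat set) l r. \<lbrakk>nonoverlapping_intervals {a..b} I l r; (\<Sum>i\<in>I. r i - l i) < d1\<rbrakk>
        \<Longrightarrow> (\<Sum>i\<in>I. \<bar>f (r i) - f (l i)\<bar>) < \<epsilon> / (2 * M)"
      by (rule abs_continuous_onD[where 'i = nat, OF f e]) (rule that)
    obtain d2 where d2: "d2 > 0" "\<And>(I :: nat set) l r. \<lbrakk>nonoverlapping_intervals {a..b} I l r; (\<Sum>i\<in>I. r i - l i) < d2\<rbrakk>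
        \<Longrightarrow> (\<Sum>i\<in>I. \<bar>g (r i) - g (l i)\<bar>) < \<epsilon> / (2 * M)"
      by (rule abs_continuous_onD[where 'i = nat, OF g e]) (rule that)
    show "\<exists>\<delta>>0. \<forall>(I :: nat set) l r. nonoverlapping_intervals {a..b} I l r \<longrightarrow>
      (\<Sum>i\<in>I. r i - l i) < \<delta> \<longrightarrow> (\<Sum>i\<in>I. \<bar>f (r i) * g (r i) - f (l i) * g (l i)\<bar>) < \<epsilon>"
    proof (intro exI conjI allI impI)
      show "min d1 d2 > 0" using d1 d2 by simp
      fix I :: "nat set" and l r :: "nat \<Rightarrow> real"
      assume I0: "nonoverlapping_intervals {a..b} I l r" and I3: "(\<Sum>i\<in>I. r i - l i) < min d1 d2"
      then have I: "\<forall>i\<in>I. l i \<le> r i \<and> {l i..r i} \<subseteq> {a..b}"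
          "\<forall>i\<in>I. \<forall>j\<in>I. i \<noteq> j \<longrightarrow> {l i<..<r i} \<inter> {l j<..<r j} = {}" "finite I"
        by (auto simp: nonoverlapping_intervals_def)
      have fs: "(\<Sum>i\<in>I. \<bar>f (r i) - f (l i)\<bar>) < \<epsilon> / (2 * M)"
        using d1(2) I0 I3 by simp
      have gs: "(\<Sum>i\<in>I. \<bar>g (r i) - g (l i)\<bar>) < \<epsilon> / (2 * M)"
        using d2(2) I0 I3 by simp
      have "\<bar>f (r i) * g (r i) - f (l i) * g (l i)\<bar> \<le> M * \<bar>f (r i) - f (l i)\<bar> + M * \<bar>g (r i) - g (l i)\<bar>"
        if "i \<in> I" for i
      proof -
        have lr: "r i \<in> {a..b}" "l i \<in> {a..b}" using I(1) that by auto
        have "f (r i) * g (r i) - f (l i) * g (l i) = g (r i) * (f (r i) - f (l i)) + f (l i) * (g (r i) - g (l i))"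
          by algebra
        then have "\<bar>f (r i) * g (r i) - f (l i) * g (l i)\<bar>
            \<le> \<bar>g (r i)\<bar> * \<bar>f (r i) - f (l i)\<bar> + \<bar>f (l i)\<bar> * \<bar>g (r i) - g (l i)\<bar>"
          by (metis abs_mult abs_triangle_ineq)
        also have "\<dots> \<le> M * \<bar>f (r i) - f (l i)\<bar> + M * \<bar>g (r i) - g (l i)\<bar>"
          by (intro add_mono mult_right_mono) (use M lr in auto)
        finally show ?thesis .
      qed
      then have "(\<Sum>i\<in>I. \<bar>f (r i) * g (r i) - f (l i) * g (l i)\<bar>)
          \<le> (\<Sum>i\<in>I. M * \<bar>f (r i) - f (l i)\<bar> + M * \<bar>g (r i) - g (l i)\<bar>)"
        by (intro sum_mono) auto
      also have "\<dots> = M * (\<Sum>i\<in>I. \<bar>f (r i) - f (l i)\<bar>) + M * (\<Sum>i\<in>I. \<bar>g (r i) - g (l i)\<bar>)"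
        by (simp add: sum.distrib sum_distrib_left)
      also have "\<dots> < M * (\<epsilon> / (2 * M)) + M * (\<epsilon> / (2 * M))"
        using fs gs M by (intro add_strict_mono mult_strict_left_mono) auto
      also have "\<dots> = \<epsilon>" using M by (simp add: field_simps)
      finally show "(\<Sum>i\<in>I. \<bar>f (r i) * g (r i) - f (l i) * g (l i)\<bar>) < \<epsilon>" .
    qed
  qed
qed

lemma abs_continuous_on_C1:
  fixes g :: "real \<Rightarrow> real"
  assumes d: "\<And>x. x \<in> {a..b} \<Longrightarrow> (g has_real_derivative g' x) (at x within {a..b})"
    and c: "continuous_on {a..b} g'"
  shows "abs_continuous_on {a..b} g"
proof -
  obtain B where B: "B > 0" "\<And>x. x \<in> {a..b} \<Longrightarrow> \<bar>g' x\<bar> \<le> B"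
    using continuous_on_Icc_bound[OF c] by blast
  have lip: "\<bar>g x - g y\<bar> \<le> B * \<bar>x - y\<bar>" if "x \<in> {a..b}" "y \<in> {a..b}" for x y
    using field_differentiable_bound[of "{a..b}" g g' B x y] that d B(2) by simp
  show ?thesis
  proof (rule abs_continuous_onI)
    fix \<epsilon> :: real assume "\<epsilon> > 0"
    show "\<exists>\<delta>>0. \<forall>(I :: nat set) l r. nonoverlapping_intervals {a..b} I l r \<longrightarrow>
      (\<Sum>i\<in>I. r i - l i) < \<delta> \<longrightarrow> (\<Sum>i\<in>I. \<bar>g (r i) - g (l i)\<bar>) < \<epsilon>"
    proof (intro exI conjI allI impI)
      show "\<epsilon> / B > 0" using \<open>\<epsilon> > 0\<close> B by simp
      fix I :: "nat set" and l r :: "nat \<Rightarrow> real"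
      assume I0: "nonoverlapping_intervals {a..b} I l r" and I3: "(\<Sum>i\<in>I. r i - l i) < \<epsilon> / B"
      then have I: "\<forall>i\<in>I. l i \<le> r i \<and> {l i..r i} \<subseteq> {a..b}"
          "\<forall>i\<in>I. \<forall>j\<in>I. i \<noteq> j \<longrightarrow> {l i<..<r i} \<inter> {l j<..<r j} = {}" "finite I"
        by (auto simp: nonoverlapping_intervals_def)
      have "\<bar>g (r i) - g (l i)\<bar> \<le> B * (r i - l i)" if "i \<in> I" for i
      proof -
        have "l i \<le> r i" "l i \<in> {a..b}" "r i \<in> {a..b}" using I(1) that by auto
        then show ?thesis using lip[of "r i" "l i"] by simp
      qed
      then have "(\<Sum>i\<in>I. \<bar>g (r i) - g (l i)\<bar>) \<le> (\<Sum>i\<in>I. B * (r i - l i))"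
        by (intro sum_mono) auto
      also have "\<dots> = B * (\<Sum>i\<in>I. r i - l i)" by (simp add: sum_distrib_left)
      also have "\<dots> < \<epsilon>" using I3 B by (simp add: field_simps)
      finally show "(\<Sum>i\<in>I. \<bar>g (r i) - g (l i)\<bar>) < \<epsilon>" .
    qed
  qed
qed

text \<open>Square integrability replaces the absolute continuity of the Lebesgue integral by
  \<open>2 \<bar>f\<bar> \<le> s f\<^sup>2 + 1 / s\<close>.\<close>

lemma abs_integral_le_integral_square:
  fixes f :: "real \<Rightarrow> real"
  assumes f: "f integrable_on {l..r}" and f2: "(\<lambda>x. (f x)\<^sup>2) integrable_on {l..r}"
    and "s > 0" "l \<le> r"
  shows "\<bar>integral {l..r} f\<bar> \<le> s / 2 * integral {l..r} (\<lambda>x. (f x)\<^sup>2) + (r - l) / (2 * s)"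
proof -
  have "norm (integral {l..r} f) \<le> integral {l..r} (\<lambda>x. s / 2 * (f x)\<^sup>2 + 1 / (2 * s))"
  proof (rule integral_norm_bound_integral)
    show "f integrable_on {l..r}" by fact
    show "(\<lambda>x. s / 2 * (f x)\<^sup>2 + 1 / (2 * s)) integrable_on {l..r}"
      by (intro integrable_add integrable_on_mult_right f2 integrable_const_ivl)
    fix x
    have "0 \<le> (s * \<bar>f x\<bar> - 1)\<^sup>2" by simp
    also have "\<dots> = s\<^sup>2 * (f x)\<^sup>2 - 2 * s * \<bar>f x\<bar> + 1"
      by (simp add: power2_diff power_mult_distrib)
    finally have "2 * s * \<bar>f x\<bar> \<le> s\<^sup>2 * (f x)\<^sup>2 + 1" by simp
    then show "norm (f x) \<le> s / 2 * (f x)\<^sup>2 + 1 / (2 * s)"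
      using \<open>s > 0\<close> by (simp add: field_simps power2_eq_square)
  qed
  also have "\<dots> = integral {l..r} (\<lambda>x. s / 2 * (f x)\<^sup>2) + integral {l..r} (\<lambda>x. 1 / (2 * s))"
    by (rule Henstock_Kurzweil_Integration.integral_add)
       (intro integrable_on_mult_right f2 integrable_const_ivl)+
  finally show ?thesis using \<open>l \<le> r\<close> by simp
qed

text \<open>Summed over the family, the first terms of the preceding estimate total at most s J / 2
  with J the integral of f^2, and the second ones less than \<delta> / (2 s). The choices s =
  \<epsilon> / (J + 1) and \<delta> = s \<epsilon> make each at most \<epsilon> / 2.\<close>

lemma abs_continuous_on_integral:
  fixes f :: "real \<Rightarrow> real"
  assumes f: "f absolutely_integrable_on {a..b}" and f2: "(\<lambda>x. (f x)\<^sup>2) integrable_on {a..b}"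
  shows "abs_continuous_on {a..b} (\<lambda>x. integral {a..x} f)"
proof (rule abs_continuous_onI)
  fix \<epsilon> :: real assume "\<epsilon> > 0"
  define J where "J = integral {a..b} (\<lambda>x. (f x)\<^sup>2)"
  have "J \<ge> 0" unfolding J_def by (rule integral_nonneg[OF f2]) auto
  define s where "s = \<epsilon> / (J + 1)"
  have s: "s > 0" using \<open>\<epsilon> > 0\<close> \<open>J \<ge> 0\<close> by (simp add: s_def)
  have sJ: "s * J \<le> \<epsilon>" using \<open>\<epsilon> > 0\<close> \<open>J \<ge> 0\<close> by (simp add: s_def field_simps)
  have fi: "f integrable_on {a..b}" "(\<lambda>x. \<bar>f x\<bar>) integrable_on {a..b}"
    using f by (auto simp: absolutely_integrable_on_def)
  show "\<exists>\<delta>>0. \<forall>(I :: nat set) l r. nonoverlapping_intervals {a..b} I l r \<longrightarrow>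
      (\<Sum>i\<in>I. r i - l i) < \<delta> \<longrightarrow> (\<Sum>i\<in>I. \<bar>integral {a..r i} f - integral {a..l i} f\<bar>) < \<epsilon>"
  proof (intro exI conjI allI impI)
    show "s * \<epsilon> > 0" using s \<open>\<epsilon> > 0\<close> by simp
    fix I :: "nat set" and l r :: "nat \<Rightarrow> real"
    assume I0: "nonoverlapping_intervals {a..b} I l r" and I3: "(\<Sum>i\<in>I. r i - l i) < s * \<epsilon>"
    then have I: "\<forall>i\<in>I. l i \<le> r i \<and> {l i..r i} \<subseteq> {a..b}"
        "\<forall>i\<in>I. \<forall>j\<in>I. i \<noteq> j \<longrightarrow> {l i<..<r i} \<inter> {l j<..<r j} = {}" "finite I"
      by (auto simp: nonoverlapping_intervals_def)
    \<comment> \<open>Open intervals, because non-overlapping closed ones may share end points: at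
      each x at most one \<open>q i\<close> is then nonzero.\<close>
    define q where "q i = (\<lambda>x. if x \<in> {l i<..<r i} then (f x)\<^sup>2 else 0)" for i
    have q: "q i integrable_on {a..b}" "integral {a..b} (q i) = integral {l i..r i} (\<lambda>x. (f x)\<^sup>2)"
      if "i \<in> I" for i
    proof -
      have sub: "{l i..r i} \<subseteq> {a..b}" "{l i<..<r i} \<inter> {a..b} = {l i<..<r i}"
        using I(1) that by fastforce+
      have "(\<lambda>x. (f x)\<^sup>2) integrable_on {l i<..<r i}"
        using integrable_subinterval_real[OF f2 sub(1)] by (simp add: integrable_on_open_interval_real)
      then show "q i integrable_on {a..b}"
        unfolding q_def integrable_restrict_Int by (simp add: sub(2))
      show "integral {a..b} (q i) = integral {l i..r i} (\<lambda>x. (f x)\<^sup>2)"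
        unfolding q_def integral_restrict_Int by (simp add: sub(2) integral_open_interval_real)
    qed
    have "\<bar>integral {a..r i} f - integral {a..l i} f\<bar> \<le> s / 2 * integral {a..b} (q i) + (r i - l i) / (2 * s)"
      if "i \<in> I" for i
    proof -
      have sub: "{l i..r i} \<subseteq> {a..b}" "l i \<le> r i" "a \<le> l i" "r i \<le> b"
        using I(1) that by auto
      have "integral {a..l i} f + integral {l i..r i} f = integral {a..r i} f"
        by (rule Henstock_Kurzweil_Integration.integral_combine)
           (use sub integrable_subinterval_real[OF fi(1)] in auto)
      then have "\<bar>integral {a..r i} f - integral {a..l i} f\<bar> = \<bar>integral {l i..r i} f\<bar>" by simp
      also have "\<dots> \<le> s / 2 * integral {l i..r i} (\<lambda>x. (f x)\<^sup>2) + (r i - l i) / (2 * s)"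
        using integrable_subinterval_real[OF fi(1) sub(1)] integrable_subinterval_real[OF f2 sub(1)] s sub(2)
        by (rule abs_integral_le_integral_square)
      also have "\<dots> = s / 2 * integral {a..b} (q i) + (r i - l i) / (2 * s)"
        using q(2)[OF that] by simp
      finally show ?thesis .
    qed
    then have "(\<Sum>i\<in>I. \<bar>integral {a..r i} f - integral {a..l i} f\<bar>)
        \<le> (\<Sum>i\<in>I. s / 2 * integral {a..b} (q i) + (r i - l i) / (2 * s))"
      by (intro sum_mono) auto
    also have "\<dots> = s / 2 * (\<Sum>i\<in>I. integral {a..b} (q i)) + (\<Sum>i\<in>I. r i - l i) / (2 * s)"
      by (simp add: sum.distrib sum_distrib_left sum_divide_distrib)
    also have "(\<Sum>i\<in>I. integral {a..b} (q i)) = integral {a..b} (\<lambda>x. \<Sum>i\<in>I. q i x)"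
      by (rule integral_sum[symmetric]) (use q I(3) in auto)
    also have "\<dots> \<le> J"
      unfolding J_def
    proof (rule integral_le)
      show "(\<lambda>x. \<Sum>i\<in>I. q i x) integrable_on {a..b}"
        by (rule integrable_sum) (use q I(3) in auto)
      show "(\<lambda>x. (f x)\<^sup>2) integrable_on {a..b}" by fact
      fix x assume "x \<in> {a..b}"
      show "(\<Sum>i\<in>I. q i x) \<le> (f x)\<^sup>2"
      proof (cases "\<exists>j\<in>I. x \<in> {l j<..<r j}")
        case True
        then obtain j where j: "j \<in> I" "x \<in> {l j<..<r j}" by blast
        have "q i x = (if i = j then (f x)\<^sup>2 else 0)" if "i \<in> I" for i
          using I(2) j that unfolding q_def by (metis disjoint_iff)
        then have "(\<Sum>i\<in>I. q i x) = (\<Sum>i\<in>I. if i = j then (f x)\<^sup>2 else 0)" by simp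
        then show ?thesis using j I(3) by simp
      next
        case False
        then have "(\<Sum>i\<in>I. q i x) = 0" by (auto simp: q_def intro!: sum.neutral)
        then show ?thesis by simp
      qed
    qed
    finally have "(\<Sum>i\<in>I. \<bar>integral {a..r i} f - integral {a..l i} f\<bar>)
        \<le> s / 2 * J + (\<Sum>i\<in>I. r i - l i) / (2 * s)" using s by simp
    also have "\<dots> < s / 2 * J + s * \<epsilon> / (2 * s)"
      using I3 s by (simp add: field_simps)
    also have "\<dots> \<le> \<epsilon>" using s sJ by simp
    finally show "(\<Sum>i\<in>I. \<bar>integral {a..r i} f - integral {a..l i} f\<bar>) < \<epsilon>" .
  qed
qed

text \<open>The gauge confines the intervals tagged in \<open>N\<close> to an open set of small measure, on which absolute
  continuity bounds the increments of \<open>g\<close>.\<close>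

theorem abs_continuous_fundamental_theorem_of_calculus:
  fixes g h :: "real \<Rightarrow> real"
  assumes ac: "abs_continuous_on {a..b} g" and "a \<le> b" and N: "negligible N"
    and d: "\<And>x. x \<in> {a..b} - N \<Longrightarrow> (g has_real_derivative h x) (at x within {a..b})"
  shows "(h has_integral g b - g a) {a..b}"
proof -
  \<comment> \<open>With the value 0 on N, an interval tagged there contributes only an increment of
    g; the integral does not notice the change on a null set.\<close>
  define k where "k x = (if x \<in> N then 0 else h x)" for x
  have "(k has_integral g b - g a) (cbox a b)"
    unfolding has_integral
  proof (intro allI impI)
    fix e :: real assume "e > 0"
    then have e: "e / 2 > 0" by simp
    obtain \<delta> where \<delta>: "\<delta> > 0" "\<And>(I :: (real \<times> real set) set) l r.
        \<lbrakk>nonoverlapping_intervals {a..b} I l r; (\<Sum>i\<in>I. r i - l i) < \<delta>\<rbrakk>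
        \<Longrightarrow> (\<Sum>i\<in>I. \<bar>g (r i) - g (l i)\<bar>) < e / 2"
      by (rule abs_continuous_onD[where 'i = "real \<times> real set", OF ac e]) (rule that)
    have Nm: "N \<in> lmeasurable" "measure lebesgue N = 0"
      using N by (auto simp: negligible_iff_measure)
    obtain U where U: "open U" "N \<subseteq> U" "U - N \<in> lmeasurable" "emeasure lebesgue (U - N) < ennreal \<delta>"
      using sets_lebesgue_outer_open[OF fmeasurableD[OF Nm(1)] \<delta>(1)] by blast
    have "measure lebesgue (U - N) < \<delta>"
      using U(3,4) \<delta>(1) by (simp add: emeasure_eq_measure2 ennreal_less_iff)
    moreover have "N \<union> (U - N) = U" using U(2) by blast
    ultimately have Um: "U \<in> lmeasurable" "measure lebesgue U < \<delta>"
      using fmeasurable.Un[OF Nm(1) U(3)] measure_Un_le[of N lebesgue "U - N"] Nm U(3)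
      by (auto dest: fmeasurableD)
    \<comment> \<open>The intervals tagged outside N have total length at most b - a; the added 1
      covers a = b.\<close>
    define e' where "e' = e / (2 * (b - a + 1))"
    have e': "e' > 0" "e' * (b - a) \<le> e / 2"
      using \<open>e > 0\<close> \<open>a \<le> b\<close> by (auto simp: e'_def field_simps)
    have "\<exists>\<rho>>0. \<forall>y\<in>{a..b}. \<bar>y - x\<bar> < \<rho> \<longrightarrow> \<bar>g y - g x - h x * (y - x)\<bar> \<le> e' * \<bar>y - x\<bar>"
      if "x \<in> {a..b} - N" for x
      using d[OF that] e'(1) unfolding has_field_derivative_def has_derivative_within_alt real_norm_def
      by blast
    then obtain \<rho> where \<rho>: "\<And>x. x \<in> {a..b} - N \<Longrightarrow> \<rho> x > 0"
      "\<And>x y. x \<in> {a..b} - N \<Longrightarrow> y \<in> {a..b} \<Longrightarrow> \<bar>y - x\<bar> < \<rho> x \<Longrightarrow>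
          \<bar>g y - g x - h x * (y - x)\<bar> \<le> e' * \<bar>y - x\<bar>"
      by metis
    define \<gamma> where "\<gamma> x = (if x \<in> N then U else if x \<in> {a..b} then ball x (\<rho> x) else UNIV)" for x
    have gauge: "gauge \<gamma>"
      unfolding gauge_def \<gamma>_def using U \<rho>(1) by auto
    have small: "norm ((\<Sum>(x, K)\<in>p. measure lborel K *\<^sub>R k x) - (g b - g a)) < e"
      if p: "p tagged_division_of (cbox a b)" and fine: "\<gamma> fine p" for p
    proof -
      have fp: "finite p" using p by blast
      have pK: "\<exists>l r. K = {l..r} \<and> l \<le> r \<and> a \<le> l \<and> r \<le> b \<and> l \<le> x \<and> x \<le> r \<and> K \<subseteq> \<gamma> x"
        if xK: "(x, K) \<in> p" for x K
      proof -
        obtain l r where "K = cbox l r" using tagged_division_ofD(4)[OF p xK] by blast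
        moreover have "x \<in> K" "K \<subseteq> cbox a b"
          using tagged_division_ofD(2,3)[OF p xK] by auto
        moreover have "K \<subseteq> \<gamma> x" using fine xK by (auto simp: fine_def)
        ultimately show ?thesis by auto
      qed
      \<comment> \<open>The increments of g telescope over the division, so the Riemann sum can be
        compared with g b - g a interval by interval.\<close>
      have tele: "(\<Sum>(x, K)\<in>p. g (Sup K) - g (Inf K)) = g b - g a"
        using additive_tagged_division_1[OF \<open>a \<le> b\<close>, of p g] p by simp
      define \<Delta> where "\<Delta> = (\<lambda>(x, K). measure lborel K *\<^sub>R k x - (g (Sup K) - g (Inf K)))"
      define p1 where "p1 = {(x, K) \<in> p. x \<in> N}"
      define p2 where "p2 = {(x, K) \<in> p. x \<notin> N}"
      have pp: "p = p1 \<union> p2" "p1 \<inter> p2 = {}" "finite p1" "finite p2" "p1 \<subseteq> p" "p2 \<subseteq> p"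
        using fp by (auto simp: p1_def p2_def intro: rev_finite_subset)
      have "(\<Sum>(x, K)\<in>p. measure lborel K *\<^sub>R k x) - (g b - g a) = sum \<Delta> p"
        unfolding tele[symmetric] \<Delta>_def by (simp add: sum_subtractf[symmetric] case_prod_unfold)
      also have "\<dots> = sum \<Delta> p1 + sum \<Delta> p2"
        unfolding pp(1) using pp by (intro sum.union_disjoint) auto
      finally have split: "norm ((\<Sum>(x, K)\<in>p. measure lborel K *\<^sub>R k x) - (g b - g a))
          \<le> (\<Sum>i\<in>p1. \<bar>\<Delta> i\<bar>) + (\<Sum>i\<in>p2. \<bar>\<Delta> i\<bar>)"
        unfolding real_norm_def
        by (simp only:) (rule order_trans[OF abs_triangle_ineq add_mono[OF sum_abs sum_abs]])
      have "(\<Sum>i\<in>p1. \<bar>g (Sup (snd i)) - g (Inf (snd i))\<bar>) < e / 2"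
      proof (rule \<delta>(2))
        have disj: "{Inf (snd i)<..<Sup (snd i)} \<inter> {Inf (snd j)<..<Sup (snd j)} = {}"
          if "i \<in> p1" "j \<in> p1" "i \<noteq> j" for i j
        proof -
          obtain x K y L where ij: "i = (x, K)" "(x, K) \<in> p" "j = (y, L)" "(y, L) \<in> p"
            using \<open>i \<in> p1\<close> \<open>j \<in> p1\<close> unfolding p1_def by blast
          obtain l r where K: "K = {l..r}" "l \<le> r" using pK[OF ij(2)] by blast
          obtain s t where L: "L = {s..t}" "s \<le> t" using pK[OF ij(4)] by blast
          have "interior K \<inter> interior L = {}"
            using tagged_division_ofD(5)[OF p ij(2,4)] ij \<open>i \<noteq> j\<close> by auto
          then show ?thesis
            using K L by (simp add: ij interior_atLeastAtMost_real)
        qed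
        have "Inf (snd i) \<le> Sup (snd i) \<and> {Inf (snd i)..Sup (snd i)} \<subseteq> {a..b}" if "i \<in> p1" for i
        proof -
          obtain x K where i: "i = (x, K)" "(x, K) \<in> p" using \<open>i \<in> p1\<close> unfolding p1_def by blast
          obtain l r where "K = {l..r}" "l \<le> r" "a \<le> l" "r \<le> b" using pK[OF i(2)] by blast
          then show ?thesis by (simp add: i)
        qed
        then show "nonoverlapping_intervals {a..b} p1 (\<lambda>i. Inf (snd i)) (\<lambda>i. Sup (snd i))"
          unfolding nonoverlapping_intervals_def using disj pp(3) by blast
        define O' where "O' i = {Inf (snd i)<..<Sup (snd i)}" for i :: "real \<times> real set"
        have len: "measure lebesgue (O' i) = Sup (snd i) - Inf (snd i)" "O' i \<subseteq> U" if "i \<in> p1" for i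
        proof -
          obtain x K where i: "i = (x, K)" "(x, K) \<in> p" "x \<in> N" using \<open>i \<in> p1\<close> unfolding p1_def by blast
          obtain l r where K: "K = {l..r}" "l \<le> r" "K \<subseteq> \<gamma> x" using pK[OF i(2)] by blast
          show "measure lebesgue (O' i) = Sup (snd i) - Inf (snd i)" using K by (simp add: i O'_def)
          show "O' i \<subseteq> U" using K i by (auto simp: O'_def \<gamma>_def)
        qed
        have dj: "disjoint_family_on O' p1"
          unfolding disjoint_family_on_def O'_def using disj by blast
        have O'm: "O' i \<in> lmeasurable" for i by (simp add: O'_def)
        have "(\<Sum>i\<in>p1. Sup (snd i) - Inf (snd i)) = (\<Sum>i\<in>p1. measure lebesgue (O' i))"
          using len by simp
        also have "\<dots> = measure lebesgue (\<Union>i\<in>p1. O' i)"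
        proof (rule measure_finite_Union[symmetric, OF \<open>finite p1\<close> _ dj])
          show "O' ` p1 \<subseteq> sets lebesgue" using O'm by (auto intro: fmeasurableD)
          show "emeasure lebesgue (O' i) \<noteq> \<infinity>" for i using fmeasurableD2[OF O'm] by simp
        qed
        also have "\<dots> \<le> measure lebesgue U"
          using len(2) Um(1) \<open>finite p1\<close> O'm
          by (intro measure_mono_fmeasurable) (auto intro!: sets.finite_UN simp: fmeasurableD)
        also have "\<dots> < \<delta>" by (rule Um(2))
        finally show "(\<Sum>i\<in>p1. Sup (snd i) - Inf (snd i)) < \<delta>" .
      qed
      moreover have "(\<Sum>i\<in>p1. \<bar>\<Delta> i\<bar>) = (\<Sum>i\<in>p1. \<bar>g (Sup (snd i)) - g (Inf (snd i))\<bar>)"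
        by (rule sum.cong) (auto simp: p1_def \<Delta>_def k_def abs_minus_commute)
      moreover have "(\<Sum>i\<in>p2. \<bar>\<Delta> i\<bar>) \<le> e / 2"
      proof -
        have "\<bar>\<Delta> i\<bar> \<le> e' * measure lborel (snd i)" if "i \<in> p2" for i
        proof -
          obtain x K where i: "i = (x, K)" "(x, K) \<in> p" "x \<notin> N" using \<open>i \<in> p2\<close> unfolding p2_def by blast
          obtain l r where K: "K = {l..r}" "l \<le> r" "a \<le> l" "r \<le> b" "l \<le> x" "x \<le> r" "K \<subseteq> \<gamma> x"
            using pK[OF i(2)] by blast
          have x: "x \<in> {a..b} - N" using K i by auto
          have "l \<in> \<gamma> x" "r \<in> \<gamma> x" using K by auto
          then have "\<bar>l - x\<bar> < \<rho> x" "\<bar>r - x\<bar> < \<rho> x"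
            using x by (auto simp: \<gamma>_def dist_real_def abs_minus_commute)
          then have "\<bar>g l - g x - h x * (l - x)\<bar> \<le> e' * \<bar>l - x\<bar>" "\<bar>g r - g x - h x * (r - x)\<bar> \<le> e' * \<bar>r - x\<bar>"
            using K by (intro \<rho>(2)[OF x]; simp)+
          then have "\<bar>g l - g x - h x * (l - x)\<bar> \<le> e' * (x - l)" "\<bar>g r - g x - h x * (r - x)\<bar> \<le> e' * (r - x)"
            using K by simp_all
          \<comment> \<open>The tag lies between the end points, so the errors to its left and right
            are measured by x - l and r - x, which add up to the length of the interval.\<close>
          then have "\<bar>(g l - g x - h x * (l - x)) - (g r - g x - h x * (r - x))\<bar> \<le> e' * (x - l) + e' * (r - x)"
            by (intro order_trans[OF abs_triangle_ineq4 add_mono])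
          moreover have "\<Delta> i = (g l - g x - h x * (l - x)) - (g r - g x - h x * (r - x))"
            using K i by (simp add: \<Delta>_def k_def algebra_simps)
          ultimately have "\<bar>\<Delta> i\<bar> \<le> e' * (x - l) + e' * (r - x)" by simp
          also have "\<dots> = e' * measure lborel (snd i)" using K i by (simp add: algebra_simps)
          finally show ?thesis .
        qed
        then have "(\<Sum>i\<in>p2. \<bar>\<Delta> i\<bar>) \<le> (\<Sum>i\<in>p2. e' * measure lborel (snd i))"
          by (rule sum_mono)
        also have "\<dots> \<le> (\<Sum>i\<in>p. e' * measure lborel (snd i))"
          using pp e' fp by (intro sum_mono2) auto
        also have "\<dots> = e' * (\<Sum>(x, K)\<in>p. measure lborel K)"
          by (simp add: sum_distrib_left case_prod_unfold)
        also have "\<dots> = e' * (b - a)"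
          using additive_content_tagged_division[OF p] \<open>a \<le> b\<close> by simp
        finally show ?thesis using e' by linarith
      qed
      ultimately show ?thesis using split by linarith
    qed
    show "\<exists>\<gamma>. gauge \<gamma> \<and> (\<forall>p. p tagged_division_of cbox a b \<and> \<gamma> fine p \<longrightarrow>
        norm ((\<Sum>(x, K)\<in>p. measure lborel K *\<^sub>R k x) - (g b - g a)) < e)"
      by (intro exI[of _ \<gamma>] conjI allI impI gauge) (elim conjE, rule small)
  qed
  then show ?thesis
    using has_integral_spike[OF N, of "{a..b}" h k] by (simp add: k_def)
qed

section \<open>The Hilbert space \<open>L\<^sup>2[0,1]\<close>\<close>

lemma L2_measurable: "f \<in> L2_space \<Longrightarrow> f \<in> borel_measurable unit_lebesgue"
  by (simp add: L2_space_def)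

lemma L2_mult_integrable:
  assumes "f \<in> L2_space" "g \<in> L2_space"
  shows "integrable unit_lebesgue (\<lambda>x. f x * g x)"
proof (rule Bochner_Integration.integrable_bound)
  show "integrable unit_lebesgue (\<lambda>x. (f x)\<^sup>2 + (g x)\<^sup>2)"
    using assms by (simp add: L2_space_def)
  show "(\<lambda>x. f x * g x) \<in> borel_measurable unit_lebesgue"
    using assms by (auto simp: L2_space_def)
  have "\<bar>f x * g x\<bar> \<le> \<bar>(f x)\<^sup>2 + (g x)\<^sup>2\<bar>" for x
  proof -
    have "2 * (\<bar>f x\<bar> * \<bar>g x\<bar>) \<le> (f x)\<^sup>2 + (g x)\<^sup>2"
      using sum_squares_bound[of "\<bar>f x\<bar>" "\<bar>g x\<bar>"] by simp
    moreover have "0 \<le> \<bar>f x\<bar> * \<bar>g x\<bar>" by simp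
    ultimately have "\<bar>f x\<bar> * \<bar>g x\<bar> \<le> (f x)\<^sup>2 + (g x)\<^sup>2" by linarith
    then show ?thesis by (simp add: abs_mult)
  qed
  then show "AE x in unit_lebesgue. norm (f x * g x) \<le> norm ((f x)\<^sup>2 + (g x)\<^sup>2)"
    by simp
qed

lemma L2_add: "f \<in> L2_space \<Longrightarrow> g \<in> L2_space \<Longrightarrow> (\<lambda>x. f x + g x) \<in> L2_space"
proof -
  assume fg: "f \<in> L2_space" "g \<in> L2_space"
  have "integrable unit_lebesgue (\<lambda>x. (f x)\<^sup>2 + (g x)\<^sup>2 + 2 * (f x * g x))"
    using fg L2_mult_integrable[OF fg] by (simp add: L2_space_def)
  moreover have "(\<lambda>x. f x + g x) \<in> borel_measurable unit_lebesgue"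
    using fg by (intro borel_measurable_add L2_measurable)
  ultimately show ?thesis
    by (simp add: L2_space_def power2_sum mult.assoc)
qed

lemma L2_continuous_mult:
  assumes w: "continuous_on {0..1} w" and f: "f \<in> L2_space"
  shows "(\<lambda>x. w x * f x) \<in> L2_space"
proof -
  have m: "w \<in> borel_measurable unit_lebesgue"
    by (rule continuous_imp_measurable_on_sets_lebesgue[OF w]) simp
  obtain B where Bpos: "B > 0" and B: "\<And>x. x \<in> {0..1} \<Longrightarrow> \<bar>w x\<bar> \<le> B"
    using continuous_on_Icc_bound[OF w] by blast
  have "integrable unit_lebesgue (\<lambda>x. (w x * f x)\<^sup>2)"
  proof (rule Bochner_Integration.integrable_bound)
    show "integrable unit_lebesgue (\<lambda>x. B\<^sup>2 * (f x)\<^sup>2)"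
      using f by (simp add: L2_space_def)
    show "(\<lambda>x. (w x * f x)\<^sup>2) \<in> borel_measurable unit_lebesgue"
      using m L2_measurable[OF f] by measurable
    have "\<bar>w x * f x\<bar>\<^sup>2 \<le> B\<^sup>2 * (f x)\<^sup>2" if "x \<in> {0..1}" for x
      using power_mono[OF B[OF that], of 2]
      by (auto simp: power_mult_distrib intro: mult_right_mono)
    then show "AE x in unit_lebesgue. norm ((w x * f x)\<^sup>2) \<le> norm (B\<^sup>2 * (f x)\<^sup>2)"
      by (auto intro!: AE_I2)
  qed
  then show ?thesis
    using m L2_measurable[OF f] by (auto simp: L2_space_def)
qed

lemma L2_cmult: "f \<in> L2_space \<Longrightarrow> (\<lambda>x. c * f x) \<in> L2_space"
  by (rule L2_continuous_mult) auto

lemma L2_continuous: "continuous_on {0..1} w \<Longrightarrow> w \<in> L2_space"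
proof -
  assume w: "continuous_on {0..1} w"
  have "(\<lambda>x::real. 1::real) \<in> L2_space"
    by (simp add: L2_space_def)
  from L2_continuous_mult[OF w this] show ?thesis by simp
qed

lemma L2_diff: "f \<in> L2_space \<Longrightarrow> g \<in> L2_space \<Longrightarrow> (\<lambda>x. f x - g x) \<in> L2_space"
  using L2_add[of f "\<lambda>x. (-1) * g x"] L2_cmult[of g "-1"] by simp

lemma L2_sum: "(\<And>j. j \<in> J \<Longrightarrow> v j \<in> L2_space) \<Longrightarrow> (\<lambda>x. \<Sum>j\<in>J. v j x) \<in> L2_space"
  by (induction J rule: infinite_finite_induct) (auto intro: L2_add L2_continuous)

lemma L2_space_integrable_on:
  assumes "f \<in> L2_space"
  shows "f absolutely_integrable_on {0..1}" "(\<lambda>x. (f x)\<^sup>2) integrable_on {0..1}"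
proof -
  have "integrable unit_lebesgue (\<lambda>x. f x * 1)"
    by (rule L2_mult_integrable[OF assms L2_continuous]) auto
  then show "f absolutely_integrable_on {0..1}"
    by (simp add: integrable_restrict_space set_integrable_def)
  show "(\<lambda>x. (f x)\<^sup>2) integrable_on {0..1}"
    using assms by (intro integrable_on_lebesgue_on) (auto simp: L2_space_def)
qed

lemma L2_inner_eq_integral:
  assumes "f \<in> L2_space" "g \<in> L2_space"
  shows "L2_inner f g = integral {0..1} (\<lambda>x. f x * g x)"
  unfolding L2_inner_def by (rule lebesgue_integral_eq_integral[OF L2_mult_integrable[OF assms]]) simp

lemma L2_mult_integrable_on:
  assumes "f \<in> L2_space" "g \<in> L2_space"
  shows "(\<lambda>x. f x * g x) integrable_on {0..1}"
  by (rule integrable_on_lebesgue_on[OF L2_mult_integrable[OF assms]]) simp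

lemma L2_inner_commute: "L2_inner f g = L2_inner g f"
  by (simp add: L2_inner_def mult.commute)

lemma L2_inner_add_left:
  assumes "f \<in> L2_space" "g \<in> L2_space" "h \<in> L2_space"
  shows "L2_inner (\<lambda>x. f x + g x) h = L2_inner f h + L2_inner g h"
  unfolding L2_inner_def
  by (subst Bochner_Integration.integral_add[symmetric])
     (auto simp: distrib_right L2_mult_integrable assms)

lemma L2_inner_cmult_left: "L2_inner (\<lambda>x. c * f x) g = c * L2_inner f g"
  by (simp add: L2_inner_def mult.assoc)

lemma L2_inner_diff_left:
  assumes "f \<in> L2_space" "g \<in> L2_space" "h \<in> L2_space"
  shows "L2_inner (\<lambda>x. f x - g x) h = L2_inner f h - L2_inner g h"
  using L2_inner_add_left[of f "\<lambda>x. (-1) * g x" h] L2_inner_cmult_left[of "-1" g h] assms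
    L2_cmult[of g "-1"] by simp

lemma L2_inner_diff_right:
  assumes "f \<in> L2_space" "g \<in> L2_space" "h \<in> L2_space"
  shows "L2_inner h (\<lambda>x. f x - g x) = L2_inner h f - L2_inner h g"
  using L2_inner_diff_left[OF assms] by (simp add: L2_inner_commute)

lemma L2_inner_sum_left:
  assumes "\<And>j. j \<in> J \<Longrightarrow> v j \<in> L2_space" "h \<in> L2_space"
  shows "L2_inner (\<lambda>x. \<Sum>j\<in>J. c j * v j x) h = (\<Sum>j\<in>J. c j * L2_inner (v j) h)"
  using assms(1)
proof (induction J rule: infinite_finite_induct)
  case (insert j J)
  then have "L2_inner (\<lambda>x. c j * v j x + (\<Sum>j\<in>J. c j * v j x)) h
      = L2_inner (\<lambda>x. c j * v j x) h + L2_inner (\<lambda>x. \<Sum>j\<in>J. c j * v j x) h"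
    by (intro L2_inner_add_left L2_sum L2_cmult assms(2)) auto
  with insert show ?case by (simp add: L2_inner_cmult_left)
qed (simp_all add: L2_inner_def)

lemma L2_inner_cong_AE:
  assumes "f \<in> L2_space" "f' \<in> L2_space" "g \<in> L2_space" "g' \<in> L2_space"
    and "L2_eq f f'" "L2_eq g g'"
  shows "L2_inner f g = L2_inner f' g'"
  unfolding L2_inner_def
proof (rule integral_cong_AE)
  show "AE x in unit_lebesgue. f x * g x = f' x * g' x"
    using assms(5,6) unfolding L2_eq_def by eventually_elim simp
qed (use assms(1-4) in \<open>auto simp: L2_space_def\<close>)

lemma L2_inner_self_nonneg: "0 \<le> L2_inner f f"
  by (simp add: L2_inner_def)

lemma L2_inner_self_eq_0:
  assumes "f \<in> L2_space"
  shows "L2_inner f f = 0 \<longleftrightarrow> L2_eq f (\<lambda>x. 0)"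
  unfolding L2_inner_def L2_eq_def
  by (subst integral_nonneg_eq_0_iff_AE) (auto simp: L2_mult_integrable assms)

lemma L2_eq_refl: "L2_eq f f"
  by (simp add: L2_eq_def)

lemma L2_eq_sym: "L2_eq f g \<Longrightarrow> L2_eq g f"
  unfolding L2_eq_def by (auto elim: eventually_mono)

lemma L2_eq_trans: "L2_eq f g \<Longrightarrow> L2_eq g h \<Longrightarrow> L2_eq f h"
  unfolding L2_eq_def by (auto elim: eventually_elim2)

lemma L2_eq_on: "(\<And>x. x \<in> {0..1} \<Longrightarrow> f x = g x) \<Longrightarrow> L2_eq f g"
  unfolding L2_eq_def by (auto intro!: AE_I2)

lemma L2_space_cong:
  assumes "\<And>x. x \<in> {0..1} \<Longrightarrow> f x = g x"
  shows "f \<in> L2_space \<longleftrightarrow> g \<in> L2_space"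
proof -
  have "f \<in> borel_measurable unit_lebesgue \<longleftrightarrow> g \<in> borel_measurable unit_lebesgue"
    by (rule measurable_cong) (use assms in auto)
  moreover have "integrable unit_lebesgue (\<lambda>x. (f x)\<^sup>2) \<longleftrightarrow> integrable unit_lebesgue (\<lambda>x. (g x)\<^sup>2)"
    by (rule Bochner_Integration.integrable_cong) (use assms in auto)
  ultimately show ?thesis by (simp add: L2_space_def)
qed

text \<open>Coefficients and lengths are left free so that one expansion serves Bessel's inequality,
  Parseval's identity and, with f = 0, the norm of a linear combination.\<close>

lemma L2_inner_diff_orthogonal:
  assumes fin: "finite J" and v: "\<And>j. j \<in> J \<Longrightarrow> v j \<in> L2_space"
    and orth: "\<And>i j. i \<in> J \<Longrightarrow> j \<in> J \<Longrightarrow> L2_inner (v i) (v j) = (if i = j then \<mu> i else 0)"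
    and f: "f \<in> L2_space"
  shows "L2_inner (\<lambda>x. f x - (\<Sum>j\<in>J. c j * v j x)) (\<lambda>x. f x - (\<Sum>j\<in>J. c j * v j x))
    = L2_inner f f - 2 * (\<Sum>j\<in>J. c j * L2_inner f (v j)) + (\<Sum>j\<in>J. (c j)\<^sup>2 * \<mu> j)"
proof -
  define S where "S = (\<lambda>x. \<Sum>j\<in>J. c j * v j x)"
  have S: "S \<in> L2_space" unfolding S_def by (intro L2_sum L2_cmult v)
  have fS: "L2_inner S f = (\<Sum>j\<in>J. c j * L2_inner f (v j))"
    unfolding S_def by (subst L2_inner_sum_left) (use v f in \<open>auto simp: L2_inner_commute\<close>)
  have "L2_inner S (v j) = c j * \<mu> j" if "j \<in> J" for j
  proof -
    have "L2_inner S (v j) = (\<Sum>i\<in>J. c i * (if i = j then \<mu> i else 0))"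
      unfolding S_def by (subst L2_inner_sum_left) (use v orth that in auto)
    then show ?thesis using fin that by (simp add: if_distrib cong: if_cong)
  qed
  then have Sv: "c j * L2_inner (v j) S = (c j)\<^sup>2 * \<mu> j" if "j \<in> J" for j
    using that L2_inner_commute[of S "v j"] by (simp add: power2_eq_square)
  have "L2_inner S S = (\<Sum>j\<in>J. c j * L2_inner (v j) S)"
    using L2_inner_sum_left[of J v S c] v S by (simp add: S_def)
  then have SS: "L2_inner S S = (\<Sum>j\<in>J. (c j)\<^sup>2 * \<mu> j)"
    by (simp add: Sv)
  have "L2_inner (\<lambda>x. f x - S x) (\<lambda>x. f x - S x) = L2_inner f f - 2 * L2_inner S f + L2_inner S S"
    using L2_inner_diff_left[OF f S L2_diff[OF f S]] L2_inner_diff_right[OF f S f]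
      L2_inner_diff_right[OF f S S] L2_inner_commute[of f S] by linarith
  then show ?thesis unfolding fS SS unfolding S_def .
qed

text \<open>The vectors are not normalized: for \<open>R\<^sup>T \<psi>\<^sub>k\<close> the squared lengths \<open>\<mu>\<^sub>k\<close> are the eigenvalues, whose
  positivity only follows from this inequality.\<close>

lemma L2_Bessel:
  assumes fin: "finite J" and v: "\<And>j. j \<in> J \<Longrightarrow> v j \<in> L2_space"
    and orth: "\<And>i j. i \<in> J \<Longrightarrow> j \<in> J \<Longrightarrow> L2_inner (v i) (v j) = (if i = j then \<mu> i else 0)"
    and M: "M > 0" "\<And>j. j \<in> J \<Longrightarrow> \<mu> j \<le> M" and f: "f \<in> L2_space"
  shows "(\<Sum>j\<in>J. (L2_inner f (v j))\<^sup>2) \<le> M * L2_inner f f"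
proof -
  define S where "S = (\<Sum>j\<in>J. (L2_inner f (v j))\<^sup>2)"
  \<comment> \<open>Division by the common bound M instead of \<open>\<mu> j\<close>, which might be
    0.\<close>
  define c where "c j = L2_inner f (v j) / M" for j
  have "0 \<le> L2_inner f f - 2 * (\<Sum>j\<in>J. c j * L2_inner f (v j)) + (\<Sum>j\<in>J. (c j)\<^sup>2 * \<mu> j)"
    by (subst L2_inner_diff_orthogonal[OF fin v orth f, where c = c, symmetric])
       (auto simp: L2_inner_self_nonneg)
  also have "(\<Sum>j\<in>J. (c j)\<^sup>2 * \<mu> j) \<le> (\<Sum>j\<in>J. (c j)\<^sup>2 * M)"
    using M(2) by (intro sum_mono mult_left_mono) auto
  also have "(\<Sum>j\<in>J. (c j)\<^sup>2 * M) = S / M"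
    using M(1) by (simp add: S_def c_def sum_divide_distrib power_divide power2_eq_square)
  also have "(\<Sum>j\<in>J. c j * L2_inner f (v j)) = S / M"
    by (simp add: S_def c_def sum_divide_distrib power2_eq_square)
  finally have "S / M \<le> L2_inner f f" by simp
  then show ?thesis using M(1) by (simp add: S_def field_simps)
qed

lemma L2_Parseval:
  assumes e: "L2_orthonormal_basis e" and f: "f \<in> L2_space"
  shows "(\<lambda>N. \<Sum>k=1..N. (L2_inner f (e k))\<^sup>2) \<longlonglongrightarrow> L2_inner f f"
proof -
  have *: "(L2_norm (\<lambda>x. f x - (\<Sum>k=1..N. L2_inner f (e k) * e k x)))\<^sup>2
      = L2_inner f f - (\<Sum>k=1..N. (L2_inner f (e k))\<^sup>2)" for N
  proof -
    have "L2_inner (\<lambda>x. f x - (\<Sum>k=1..N. L2_inner f (e k) * e k x)) (\<lambda>x. f x - (\<Sum>k=1..N. L2_inner f (e k) * e k x))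
        = L2_inner f f - 2 * (\<Sum>k=1..N. L2_inner f (e k) * L2_inner f (e k))
          + (\<Sum>k=1..N. (L2_inner f (e k))\<^sup>2 * 1)"
      using e f by (intro L2_inner_diff_orthogonal) (auto simp: L2_orthonormal_basis_def)
    then show ?thesis
      unfolding L2_norm_def real_sqrt_pow2[OF L2_inner_self_nonneg]
      by (simp flip: power2_eq_square)
  qed
  have "(\<lambda>N. L2_norm (\<lambda>x. f x - (\<Sum>k=1..N. L2_inner f (e k) * e k x))) \<longlonglongrightarrow> 0"
    using e f by (simp add: L2_orthonormal_basis_def)
  then have "(\<lambda>N. L2_inner f f - (\<Sum>k=1..N. (L2_inner f (e k))\<^sup>2)) \<longlonglongrightarrow> 0\<^sup>2"
    unfolding *[symmetric] by (rule tendsto_power)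
  then have "(\<lambda>N. L2_inner f f - (L2_inner f f - (\<Sum>k=1..N. (L2_inner f (e k))\<^sup>2))) \<longlonglongrightarrow> L2_inner f f - 0\<^sup>2"
    by (intro tendsto_diff tendsto_const)
  then show ?thesis by simp
qed

section \<open>Null sets and integrals over subintervals\<close>

lemma has_real_derivative_cong_on:
  assumes "(f has_real_derivative d) (at x within S)" "x \<in> S" "\<And>y. y \<in> S \<Longrightarrow> g y = f y"
  shows "(g has_real_derivative d) (at x within S)"
  using has_derivative_transform[of x S g f] assms unfolding has_field_derivative_def by blast

text \<open>Bridge between the measure theoretic formulation of the problem and the negligible sets
  of the gauge integral.\<close>

lemma AE_unit_lebesgue_iff: "(AE x in unit_lebesgue. P x) \<longleftrightarrow> negligible {x\<in>{0..1}. \<not> P x}"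
proof -
  have "(AE x in unit_lebesgue. P x) \<longleftrightarrow> (AE x in lebesgue. x \<in> {0..1} \<longrightarrow> P x)"
    by (rule AE_restrict_space_iff) simp
  also have "\<dots> \<longleftrightarrow> (\<exists>N\<in>null_sets lebesgue. {x\<in>{0..1}. \<not> P x} \<subseteq> N)"
    by (simp add: eventually_ae_filter)
  also have "\<dots> \<longleftrightarrow> negligible {x\<in>{0..1}. \<not> P x}"
    using negligible_subset negligible_iff_null_sets by blast
  finally show ?thesis .
qed

lemma L2_integrable_on_subinterval:
  assumes f: "f \<in> L2_space" and "{s..t} \<subseteq> {0..1}"
  shows "f integrable_on {s..t}" "(\<lambda>x. (f x)\<^sup>2) integrable_on {s..t}"
  using integrable_subinterval_real[OF _ assms(2)] L2_space_integrable_on[OF f]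
  by (auto simp: absolutely_integrable_on_def)

lemma L2_LINT_eq_integral:
  assumes f: "f \<in> L2_space" and "{s..t} \<subseteq> {0..1}"
  shows "(LINT x|lebesgue_on {s..t}. f x) = integral {s..t} f"
proof (rule lebesgue_integral_eq_integral)
  have "f absolutely_integrable_on {s..t}"
    using L2_space_integrable_on(1)[OF f] assms(2) by (rule absolutely_integrable_on_subinterval)
  then show "integrable (lebesgue_on {s..t}) f"
    by (simp add: integrable_restrict_space set_integrable_def)
qed simp

lemma L2_indefinite_integral:
  assumes "f \<in> L2_space"
  shows "abs_continuous_on {0..1} (\<lambda>x. integral {0..x} f)"
    and "AE x in unit_lebesgue. ((\<lambda>x. integral {0..x} f) has_real_derivative f x) (at x within {0..1})"
proof -
  show "abs_continuous_on {0..1} (\<lambda>x. integral {0..x} f)"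
    using L2_space_integrable_on[OF assms] by (rule abs_continuous_on_integral)
  show "AE x in unit_lebesgue. ((\<lambda>x. integral {0..x} f) has_real_derivative f x) (at x within {0..1})"
    unfolding AE_unit_lebesgue_iff
    by (rule indefinite_integral_has_derivative_AE) (use assms in \<open>simp add: L2_integrable_on_subinterval\<close>)
qed

lemma L2_eq_integral:
  assumes "L2_eq f g" "{s..t} \<subseteq> {0..1}"
  shows "integral {s..t} f = integral {s..t} g"
proof (rule integral_spike)
  show "negligible {x\<in>{0..1}. \<not> f x = g x}"
    using assms(1) unfolding L2_eq_def AE_unit_lebesgue_iff .
qed (use assms(2) in auto)

lemma integral_zero_outside:
  fixes h :: "real \<Rightarrow> real"
  assumes "{l..r} \<subseteq> {s..t}" "\<And>x. x \<in> {s..t} - {l..r} \<Longrightarrow> h x = 0"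
  shows "integral {s..t} h = integral {l..r} h"
proof -
  have "integral {s..t} h = integral {s..t} (\<lambda>x. if x \<in> {l..r} then h x else 0)"
    by (rule integral_cong) (use assms(2) in auto)
  also have "\<dots> = integral ({l..r} \<inter> {s..t}) h" by (rule integral_restrict_Int)
  also have "{l..r} \<inter> {s..t} = {l..r}" using assms(1) by auto
  finally show ?thesis .
qed

lemma L2_inner_self_le:
  assumes q: "q \<in> L2_space" and "l \<le> r" "{l..r} \<subseteq> {0..1}"
    and "\<And>x. x \<in> {0..1} - {l..r} \<Longrightarrow> q x = 0" "\<And>x. x \<in> {l..r} \<Longrightarrow> \<bar>q x\<bar> \<le> K"
  shows "L2_inner q q \<le> K\<^sup>2 * (r - l)"
proof -
  have "L2_inner q q = integral {0..1} (\<lambda>x. (q x)\<^sup>2)"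
    unfolding L2_inner_eq_integral[OF q q] power2_eq_square ..
  also have "\<dots> = integral {l..r} (\<lambda>x. (q x)\<^sup>2)"
    by (rule integral_zero_outside) (use assms in auto)
  also have "\<dots> \<le> integral {l..r} (\<lambda>x. K\<^sup>2)"
  proof (rule integral_le)
    show "(\<lambda>x. (q x)\<^sup>2) integrable_on {l..r}"
      by (rule L2_integrable_on_subinterval(2)[OF q assms(3)])
    fix x assume "x \<in> {l..r}"
    from power_mono[OF assms(5)[OF this], of 2] show "(q x)\<^sup>2 \<le> K\<^sup>2" by simp
  qed auto
  also have "\<dots> = K\<^sup>2 * (r - l)" using \<open>l \<le> r\<close> by simp
  finally show ?thesis .
qed

lemma L2_inner_self_ge:
  assumes q: "q \<in> L2_space" and "l \<le> r" "{l..r} \<subseteq> {0..1}" "0 \<le> K"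
    and "\<And>x. x \<in> {l..r} \<Longrightarrow> K \<le> \<bar>q x\<bar>"
  shows "K\<^sup>2 * (r - l) \<le> L2_inner q q"
proof -
  have "K\<^sup>2 * (r - l) = integral {l..r} (\<lambda>x. K\<^sup>2)" using \<open>l \<le> r\<close> by simp
  also have "\<dots> \<le> integral {l..r} (\<lambda>x. (q x)\<^sup>2)"
  proof (rule integral_le)
    show "(\<lambda>x. (q x)\<^sup>2) integrable_on {l..r}"
      by (rule L2_integrable_on_subinterval(2)[OF q assms(3)])
    fix x assume "x \<in> {l..r}"
    from power_mono[OF assms(5)[OF this] \<open>0 \<le> K\<close>, of 2] show "K\<^sup>2 \<le> (q x)\<^sup>2" by simp
  qed auto
  also have "\<dots> \<le> integral {0..1} (\<lambda>x. (q x)\<^sup>2)"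
    by (rule integral_subset_le)
       (use assms(3) L2_integrable_on_subinterval(2)[OF q] in auto)
  also have "\<dots> = L2_inner q q"
    unfolding L2_inner_eq_integral[OF q q] power2_eq_square ..
  finally show ?thesis .
qed

section \<open>The solution operator and its adjoint\<close>

text \<open>\<open>C\<close> is an arbitrary antiderivative since the formula for the solution is
  claimed for all of them; the spectral part uses a single one.\<close>

locale first_order_ode =
  fixes a b C :: "real \<Rightarrow> real"
  assumes a_cont: "continuous_on {0..1} a"
    and b_cont: "continuous_on {0..1} b"
    and a_pos: "\<And>x. x \<in> {0..1} \<Longrightarrow> a x > 0"
    and C_deriv: "\<And>x. x \<in> {0..1} \<Longrightarrow> (C has_real_derivative b x / a x) (at x within {0..1})"
begin

definition sol :: "(real \<Rightarrow> real) \<Rightarrow> real \<Rightarrow> real" where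
  "sol f x = exp (- C x) * integral {0..x} (\<lambda>t. exp (C t) / a t * f t)"

text \<open>The kernel e^(C t - C x) / a t of \<open>sol\<close>, supported on t \<le> x, is
  integrated over x instead of t.\<close>

definition adj :: "(real \<Rightarrow> real) \<Rightarrow> real \<Rightarrow> real" where
  "adj g t = exp (C t) / a t * integral {t..1} (\<lambda>x. exp (- C x) * g x)"

lemma C_cont: "continuous_on {0..1} C"
  using C_deriv by (meson DERIV_continuous continuous_on_eq_continuous_within)

lemma a_nonzero: "x \<in> {0..1} \<Longrightarrow> a x \<noteq> 0"
  using a_pos by force

lemma expC_cont: "continuous_on {0..1} (\<lambda>t. exp (C t))" "continuous_on {0..1} (\<lambda>t. exp (- C t))"
    "continuous_on {0..1} (\<lambda>t. exp (C t) / a t)"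
  using C_cont a_cont a_nonzero by (auto intro!: continuous_intros)

lemma ba_cont: "continuous_on {0..1} (\<lambda>x. b x / a x)"
  using a_cont b_cont a_nonzero by (auto intro!: continuous_intros)

lemma expC_deriv:
  assumes "x \<in> {0..1}"
  shows "((\<lambda>x. exp (C x)) has_real_derivative exp (C x) * (b x / a x)) (at x within {0..1})"
    and "((\<lambda>x. exp (- C x)) has_real_derivative exp (- C x) * - (b x / a x)) (at x within {0..1})"
  by (rule derivative_eq_intros C_deriv assms refl | simp)+

lemma abs_continuous_expC:
  "abs_continuous_on {0..1} (\<lambda>x. exp (C x))" "abs_continuous_on {0..1} (\<lambda>x. exp (- C x))"
proof -
  show "abs_continuous_on {0..1} (\<lambda>x. exp (C x))"
    by (rule abs_continuous_on_C1[OF expC_deriv(1)], assumption, intro continuous_on_mult expC_cont ba_cont)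
  show "abs_continuous_on {0..1} (\<lambda>x. exp (- C x))"
    by (rule abs_continuous_on_C1[OF expC_deriv(2)], assumption, intro continuous_on_mult continuous_on_minus expC_cont ba_cont)
qed

lemma weighted_L2:
  assumes "f \<in> L2_space"
  shows "(\<lambda>t. exp (C t) / a t * f t) \<in> L2_space" "(\<lambda>t. exp (- C t) * f t) \<in> L2_space"
  by (intro L2_continuous_mult expC_cont assms)+

lemma sol_eq:
  assumes "f \<in> L2_space" "x \<in> {0..1}"
  shows "exp (- C x) * (LINT t|lebesgue_on {0..x}. exp (C t) / a t * f t) = sol f x"
  unfolding sol_def by (subst L2_LINT_eq_integral[OF weighted_L2(1)[OF assms(1)]]) (use assms in auto)

text \<open>The integrating factor e^C gives (e^C g)' = e^C f / a almost everywhere. Absolute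
  continuity is what allows this to be integrated: adding a Cantor function to e^C g would not
  disturb the equation almost everywhere.\<close>

lemma ode_solution_imp_sol:
  assumes f: "f \<in> L2_space" and g: "ode_solution a b f g" and x: "x \<in> {0..1}"
  shows "g x = sol f x"
proof -
  have gac: "abs_continuous_on {0..1} g" and g0: "g 0 = 0"
    using g by (auto simp: ode_solution_def)
  define N where "N = {x\<in>{0..1}. \<not> (\<exists>d. (g has_real_derivative d) (at x within {0..1}) \<and> a x * d + b x * g x = f x)}"
  have N: "negligible N"
    using g unfolding N_def ode_solution_def AE_unit_lebesgue_iff by blast
  have "((\<lambda>t. exp (C t) / a t * f t) has_integral exp (C x) * g x - exp (C 0) * g 0) {0..x}"
  proof (rule abs_continuous_fundamental_theorem_of_calculus[OF _ _ N])
    show "abs_continuous_on {0..x} (\<lambda>x. exp (C x) * g x)"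
      using abs_continuous_on_mult[OF abs_continuous_expC(1) gac] x by (auto elim: abs_continuous_on_subset)
    show "0 \<le> x" using x by simp
    fix t assume t: "t \<in> {0..x} - N"
    then have t01: "t \<in> {0..1}" using x by auto
    then obtain d where d: "(g has_real_derivative d) (at t within {0..1})" "a t * d + b t * g t = f t"
      using t unfolding N_def by blast
    have "((\<lambda>x. exp (C x) * g x) has_real_derivative exp (C t) / a t * f t) (at t within {0..1})"
    proof (rule DERIV_cong)
      show "((\<lambda>x. exp (C x) * g x) has_real_derivative exp (C t) * (b t / a t) * g t + d * exp (C t)) (at t within {0..1})"
        by (rule DERIV_mult[OF expC_deriv(1)[OF t01] d(1)])
      show "exp (C t) * (b t / a t) * g t + d * exp (C t) = exp (C t) / a t * f t"
        using a_nonzero[OF t01] by (simp add: d(2)[symmetric] field_simps)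
    qed
    then show "((\<lambda>x. exp (C x) * g x) has_real_derivative exp (C t) / a t * f t) (at t within {0..x})"
      by (rule DERIV_subset) (use x in auto)
  qed
  then have "integral {0..x} (\<lambda>t. exp (C t) / a t * f t) = exp (C x) * g x"
    by (simp add: g0 integral_unique)
  then show ?thesis
    by (simp add: sol_def exp_minus)
qed

lemma sol_abs_continuous:
  assumes "f \<in> L2_space"
  shows "abs_continuous_on {0..1} (sol f)"
  unfolding sol_def
  by (rule abs_continuous_on_mult[OF abs_continuous_expC(2) L2_indefinite_integral(1)[OF weighted_L2(1)[OF assms]]])

lemma ode_solution_sol:
  assumes f: "f \<in> L2_space" and g: "\<And>x. x \<in> {0..1} \<Longrightarrow> g x = sol f x"
  shows "ode_solution a b f g"
  unfolding ode_solution_def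
proof (intro conjI)
  show "abs_continuous_on {0..1} g"
    using sol_abs_continuous[OF f] abs_continuous_on_cong[of "{0..1}" g "sol f"] g by simp
  show "g 0 = 0" using g[of 0] by (simp add: sol_def)
  define F where "F x = integral {0..x} (\<lambda>t. exp (C t) / a t * f t)" for x
  have "AE x in unit_lebesgue. (F has_real_derivative exp (C x) / a x * f x) (at x within {0..1})"
    using L2_indefinite_integral(2)[OF weighted_L2(1)[OF f]] unfolding F_def .
  then show "AE x in unit_lebesgue. \<exists>d. (g has_real_derivative d) (at x within {0..1}) \<and> a x * d + b x * g x = f x"
  proof (rule lebesgue_on_mono)
    fix x :: real assume F: "(F has_real_derivative exp (C x) / a x * f x) (at x within {0..1})" and x: "x \<in> {0..1}"
    have "(g has_real_derivative exp (- C x) * - (b x / a x) * F x + exp (C x) / a x * f x * exp (- C x)) (at x within {0..1})"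
      by (rule has_real_derivative_cong_on[OF DERIV_mult[OF expC_deriv(2)[OF x] F] x])
         (simp add: g sol_def F_def)
    moreover have "a x * (exp (- C x) * - (b x / a x) * F x + exp (C x) / a x * f x * exp (- C x)) + b x * g x = f x"
    proof -
      have "g x = exp (- C x) * F x" using g[OF x] by (simp only: sol_def F_def)
      then show ?thesis using a_nonzero[OF x] by (simp add: exp_minus field_simps)
    qed
    ultimately show "\<exists>d. (g has_real_derivative d) (at x within {0..1}) \<and> a x * d + b x * g x = f x"
      by blast
  qed
qed

text \<open>The choice in \<open>R_op\<close> is legitimate because a solution exists, and harmless
  because all solutions agree on the interval.\<close>

lemma R_op_eq_sol:
  assumes "f \<in> L2_space" "x \<in> {0..1}"
  shows "R_op a b f x = sol f x"
proof -
  have "ode_solution a b f (sol f)"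
    by (rule ode_solution_sol[OF assms(1)]) simp
  then have "ode_solution a b f (R_op a b f)"
    unfolding R_op_def by (rule someI[where P = "ode_solution a b f"])
  then show ?thesis
    by (rule ode_solution_imp_sol[OF assms(1) _ assms(2)])
qed

lemma sol_cont: "f \<in> L2_space \<Longrightarrow> continuous_on {0..1} (sol f)"
  by (intro abs_continuous_on_imp_continuous_on sol_abs_continuous)

lemma sol_L2: "f \<in> L2_space \<Longrightarrow> sol f \<in> L2_space"
  by (rule L2_continuous[OF sol_cont])

lemma integral_tail:
  assumes "f \<in> L2_space" "x \<in> {0..1}"
  shows "integral {x..1} f = integral {0..1} f - integral {0..x} f"
  using Henstock_Kurzweil_Integration.integral_combine[of 0 x 1 f] assms L2_integrable_on_subinterval[OF assms(1), of 0 1]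
  by simp

lemma adj_cont:
  assumes "g \<in> L2_space"
  shows "continuous_on {0..1} (adj g)"
proof -
  note g = weighted_L2(2)[OF assms]
  have "continuous_on {0..1} (\<lambda>x. integral {0..x} (\<lambda>x. exp (- C x) * g x))"
    by (intro abs_continuous_on_imp_continuous_on L2_indefinite_integral g)
  then have "continuous_on {0..1} (\<lambda>t. exp (C t) / a t *
      (integral {0..1} (\<lambda>x. exp (- C x) * g x) - integral {0..t} (\<lambda>x. exp (- C x) * g x)))"
    by (intro continuous_on_mult expC_cont(3) continuous_on_diff continuous_on_const)
  then show ?thesis
    by (rule continuous_on_eq) (simp only: adj_def integral_tail[OF g])
qed

lemma adj_L2: "g \<in> L2_space \<Longrightarrow> adj g \<in> L2_space"
  by (rule L2_continuous[OF adj_cont])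

text \<open>Integration by parts for the absolutely continuous functions
  \<open>\<integral>\<^sub>0\<^sup>x e\<^sup>C f / a\<close> and \<open>\<integral>\<^sub>x\<^sup>1 e\<^sup>-\<^sup>C g\<close>; it replaces Fubini's theorem.\<close>

lemma L2_inner_sol:
  assumes f: "f \<in> L2_space" and g: "g \<in> L2_space"
  shows "L2_inner (sol f) g = L2_inner f (adj g)"
proof -
  define u where "u t = exp (C t) / a t * f t" for t
  define v where "v t = exp (- C t) * g t" for t
  have u: "u \<in> L2_space" and v: "v \<in> L2_space"
    unfolding u_def v_def using weighted_L2 f g by auto
  define U where "U x = integral {0..x} u" for x
  \<comment> \<open>The integral of v from x to 1, written as a difference so that the results on
    indefinite integrals from 0 apply.\<close>
  define V where "V x = integral {0..1} v - integral {0..x} v" for x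
  have sol: "sol f x * g x = U x * v x" for x
    by (simp only: sol_def U_def u_def[abs_def] v_def ac_simps)
  have adj: "f x * adj g x = V x * u x" if "x \<in> {0..1}" for x
  proof -
    have "adj g x = exp (C x) / a x * V x"
      unfolding adj_def V_def integral_tail[OF v that, symmetric] by (simp only: v_def[abs_def])
    then show ?thesis by (simp add: u_def)
  qed
  define N where "N = {x\<in>{0..1}. \<not> ((U has_real_derivative u x) (at x within {0..1}) \<and>
      (V has_real_derivative - v x) (at x within {0..1}))}"
  have "AE x in unit_lebesgue. (U has_real_derivative u x) (at x within {0..1}) \<and>
      (V has_real_derivative - v x) (at x within {0..1})"
    using L2_indefinite_integral(2)[OF u] L2_indefinite_integral(2)[OF v]
  proof eventually_elim
    case (elim x)
    have "(V has_real_derivative 0 - v x) (at x within {0..1})"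
      unfolding V_def by (intro DERIV_diff DERIV_const elim(2))
    then show ?case using elim(1) by (simp add: U_def[abs_def])
  qed
  then have N: "negligible N"
    unfolding N_def AE_unit_lebesgue_iff .
  have Uac: "abs_continuous_on {0..1} U"
    unfolding U_def[abs_def] by (rule L2_indefinite_integral(1)[OF u])
  have Vac: "abs_continuous_on {0..1} V"
  proof -
    have "abs_continuous_on {0..1} (\<lambda>x. integral {0..x} v)"
      by (rule L2_indefinite_integral(1)[OF v])
    then show ?thesis
      unfolding V_def[abs_def] abs_continuous_on_def by (simp add: abs_minus_commute)
  qed
  have "((\<lambda>x. V x * u x - U x * v x) has_integral U 1 * V 1 - U 0 * V 0) {0..1}"
  proof (rule abs_continuous_fundamental_theorem_of_calculus[OF abs_continuous_on_mult[OF Uac Vac] _ N])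
    fix x :: real assume "x \<in> {0..1} - N"
    then have "(U has_real_derivative u x) (at x within {0..1})" "(V has_real_derivative - v x) (at x within {0..1})"
      by (auto simp: N_def)
    from DERIV_mult[OF this] show "((\<lambda>x. U x * V x) has_real_derivative V x * u x - U x * v x) (at x within {0..1})"
      by (simp add: mult.commute)
  qed simp
  \<comment> \<open>No boundary terms: U vanishes at 0 and V at 1.\<close>
  then have "integral {0..1} (\<lambda>x. V x * u x - U x * v x) = 0"
    by (simp add: U_def V_def integral_unique)
  moreover have "integral {0..1} (\<lambda>x. V x * u x - U x * v x)
      = integral {0..1} (\<lambda>x. V x * u x) - integral {0..1} (\<lambda>x. U x * v x)"
    by (intro Henstock_Kurzweil_Integration.integral_diff L2_mult_integrable_on u v
        L2_continuous[OF abs_continuous_on_imp_continuous_on[OF Uac]]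
        L2_continuous[OF abs_continuous_on_imp_continuous_on[OF Vac]])
  moreover have "L2_inner (sol f) g = integral {0..1} (\<lambda>x. U x * v x)"
    using L2_inner_eq_integral[OF sol_L2[OF f] g] sol by simp
  moreover have "L2_inner f (adj g) = integral {0..1} (\<lambda>x. V x * u x)"
    unfolding L2_inner_eq_integral[OF f adj_L2[OF g]] by (rule integral_cong[OF adj])
  ultimately show ?thesis by simp
qed

text \<open>The difference of two candidates for the adjoint is orthogonal to every function, itself
  included, so the choice in \<open>L2_adjoint\<close> is determined up to a null set.\<close>

lemma L2_adjoint_R_op:
  assumes g: "g \<in> L2_space"
  shows "L2_adjoint (R_op a b) g \<in> L2_space" "L2_eq (L2_adjoint (R_op a b) g) (adj g)"
proof -
  define h where "h = L2_adjoint (R_op a b) g"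
  have R: "L2_inner (R_op a b f) g = L2_inner (sol f) g" if "f \<in> L2_space" for f
    unfolding L2_inner_def
    by (rule Bochner_Integration.integral_cong) (use R_op_eq_sol[OF that] in auto)
  have "\<exists>h. h \<in> L2_space \<and> (\<forall>f\<in>L2_space. L2_inner (R_op a b f) g = L2_inner f h)"
    using adj_L2[OF g] L2_inner_sol[OF _ g] R by auto
  then have h: "h \<in> L2_space \<and> (\<forall>f\<in>L2_space. L2_inner (R_op a b f) g = L2_inner f h)"
    unfolding h_def L2_adjoint_def by (rule someI_ex)
  define d where "d x = h x - adj g x" for x
  have d: "d \<in> L2_space"
    unfolding d_def using h adj_L2[OF g] by (intro L2_diff) auto
  have "L2_inner d d = L2_inner d h - L2_inner d (adj g)"
    using L2_inner_diff_right[of h "adj g" d] h adj_L2[OF g] d by (simp add: d_def[abs_def])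
  also have "\<dots> = 0"
    using h d R[OF d] L2_inner_sol[OF d g] by simp
  finally have "L2_eq d (\<lambda>x. 0)"
    using L2_inner_self_eq_0[OF d] by simp
  then have "L2_eq h (adj g)"
    unfolding L2_eq_def d_def by (auto elim: eventually_mono)
  with h show "L2_adjoint (R_op a b) g \<in> L2_space" "L2_eq (L2_adjoint (R_op a b) g) (adj g)"
    by (auto simp: h_def)
qed

lemma sol_cong_AE:
  assumes "L2_eq f g" "x \<in> {0..1}"
  shows "sol f x = sol g x"
proof -
  have "L2_eq (\<lambda>t. exp (C t) / a t * f t) (\<lambda>t. exp (C t) / a t * g t)"
    using assms(1) unfolding L2_eq_def by (auto elim: eventually_mono)
  then show ?thesis
    unfolding sol_def using L2_eq_integral[of _ _ 0 x] assms(2) by simp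
qed

text \<open>\<open>sol\<close> does not see changes on null sets, so both arbitrary choices
  disappear from the eigenvalue equation.\<close>

lemma L2_eigenfunction_RRT:
  assumes "L2_eigenfunction (\<lambda>f. R_op a b (L2_adjoint (R_op a b) f)) \<mu> \<psi>"
  shows "\<psi> \<in> L2_space" "L2_eq (sol (adj \<psi>)) (\<lambda>x. \<mu> * \<psi> x)"
proof -
  show \<psi>: "\<psi> \<in> L2_space" using assms by (simp add: L2_eigenfunction_def)
  have "R_op a b (L2_adjoint (R_op a b) \<psi>) x = sol (adj \<psi>) x" if "x \<in> {0..1}" for x
    using R_op_eq_sol[OF L2_adjoint_R_op(1)[OF \<psi>] that] sol_cong_AE[OF L2_adjoint_R_op(2)[OF \<psi>] that] by simp
  then have "L2_eq (sol (adj \<psi>)) (R_op a b (L2_adjoint (R_op a b) \<psi>))"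
    by (intro L2_eq_on) simp
  then show "L2_eq (sol (adj \<psi>)) (\<lambda>x. \<mu> * \<psi> x)"
    using assms L2_eq_trans by (auto simp: L2_eigenfunction_def)
qed

section \<open>Linearity and compactness of the solution operator\<close>

lemma L2_linear_operator_R_op: "L2_linear_operator (R_op a b)"
  unfolding L2_linear_operator_def
proof (intro conjI ballI impI allI)
  have R: "L2_eq (R_op a b f) (sol f)" if "f \<in> L2_space" for f
    by (rule L2_eq_on) (rule R_op_eq_sol[OF that])
  fix f assume f: "f \<in> L2_space"
  show "R_op a b f \<in> L2_space"
    using sol_L2[OF f] L2_space_cong[of "R_op a b f" "sol f"] R_op_eq_sol[OF f] by simp
  note wf = L2_integrable_on_subinterval(1)[OF weighted_L2(1)[OF f]]
  show "L2_eq (R_op a b (\<lambda>x. c * f x)) (\<lambda>x. c * R_op a b f x)" for c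
  proof (rule L2_eq_on)
    fix x :: real assume x: "x \<in> {0..1}"
    have "sol (\<lambda>x. c * f x) x = c * sol f x"
    proof -
      have "sol (\<lambda>x. c * f x) x = exp (- C x) * integral {0..x} (\<lambda>t. c * (exp (C t) / a t * f t))"
        by (simp add: sol_def mult_ac)
      also have "\<dots> = c * sol f x"
        unfolding sol_def integral_mult_right by (rule mult.left_commute)
      finally show ?thesis .
    qed
    then show "R_op a b (\<lambda>x. c * f x) x = c * R_op a b f x"
      using R_op_eq_sol[OF f x] R_op_eq_sol[OF L2_cmult[OF f] x] by simp
  qed
  fix g assume g: "g \<in> L2_space"
  note wg = L2_integrable_on_subinterval(1)[OF weighted_L2(1)[OF g]]
  show "L2_eq (R_op a b f) (R_op a b g)" if "L2_eq f g"
    by (rule L2_eq_on) (use sol_cong_AE[OF that] R_op_eq_sol f g in simp)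
  show "L2_eq (R_op a b (\<lambda>x. f x + g x)) (\<lambda>x. R_op a b f x + R_op a b g x)"
  proof (rule L2_eq_on)
    fix x :: real assume x: "x \<in> {0..1}"
    have "integral {0..x} (\<lambda>t. exp (C t) / a t * f t + exp (C t) / a t * g t)
        = integral {0..x} (\<lambda>t. exp (C t) / a t * f t) + integral {0..x} (\<lambda>t. exp (C t) / a t * g t)"
      by (rule Henstock_Kurzweil_Integration.integral_add) (use wf wg x in auto)
    then have "sol (\<lambda>x. f x + g x) x = sol f x + sol g x"
      by (simp add: sol_def distrib_left)
    then show "R_op a b (\<lambda>x. f x + g x) x = R_op a b f x + R_op a b g x"
      using R_op_eq_sol[OF f x] R_op_eq_sol[OF g x] R_op_eq_sol[OF L2_add[OF f g] x] by simp
  qed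
qed

text \<open>The indefinite integrals of a bounded sequence are uniformly bounded and equicontinuous,
  so Arzela-Ascoli applies. Uniform convergence survives the factor e^(-C) and implies convergence
  in the norm.\<close>

lemma L2_compact_operator_R_op: "L2_compact_operator (R_op a b)"
  unfolding L2_compact_operator_def
proof (intro conjI allI impI)
  show "L2_linear_operator (R_op a b)" by (rule L2_linear_operator_R_op)
  fix f :: "nat \<Rightarrow> real \<Rightarrow> real"
  assume f: "\<forall>n. f n \<in> L2_space" and "\<exists>B. \<forall>n. L2_norm (f n) \<le> B"
  then obtain B where B: "\<And>n. L2_norm (f n) \<le> B" by blast
  define w where "w t = exp (C t) / a t" for t
  define u where "u n t = w t * f n t" for n t
  define U where "U n x = integral {0..x} (u n)" for n x
  have w: "continuous_on {0..1} w" unfolding w_def by (rule expC_cont)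
  have u: "u n \<in> L2_space" for n
    unfolding u_def using f by (intro L2_continuous_mult[OF w]) auto
  obtain W where Wpos: "W > 0" and W: "\<And>x. x \<in> {0..1} \<Longrightarrow> \<bar>w x\<bar> \<le> W"
    using continuous_on_Icc_bound[OF w] by blast
  define D where "D = W\<^sup>2 * B\<^sup>2"
  have u_bound: "integral {0..1} (\<lambda>x. (u n x)\<^sup>2) \<le> D" for n
  proof -
    have "integral {0..1} (\<lambda>x. (u n x)\<^sup>2) \<le> integral {0..1} (\<lambda>x. W\<^sup>2 * (f n x)\<^sup>2)"
    proof (rule integral_le)
      show "(\<lambda>x. (u n x)\<^sup>2) integrable_on {0..1}" by (rule L2_space_integrable_on(2)[OF u])
      show "(\<lambda>x. W\<^sup>2 * (f n x)\<^sup>2) integrable_on {0..1}"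
        using f by (intro integrable_on_mult_right L2_space_integrable_on(2)) auto
      fix x :: real assume "x \<in> {0..1}"
      then have "\<bar>w x\<bar>\<^sup>2 \<le> W\<^sup>2" by (intro power_mono W) auto
      then show "(u n x)\<^sup>2 \<le> W\<^sup>2 * (f n x)\<^sup>2"
        by (simp add: u_def power_mult_distrib mult_right_mono)
    qed
    also have "\<dots> = W\<^sup>2 * L2_inner (f n) (f n)"
      using f by (simp add: L2_inner_eq_integral power2_eq_square)
    also have "L2_inner (f n) (f n) \<le> B\<^sup>2"
    proof -
      have "(L2_norm (f n))\<^sup>2 \<le> B\<^sup>2"
        by (intro power_mono B) (simp add: L2_norm_def L2_inner_self_nonneg)
      then show ?thesis by (simp add: L2_norm_def L2_inner_self_nonneg)
    qed
    finally show ?thesis by (simp add: D_def mult_left_mono)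
  qed
  have "D \<ge> 0" by (simp add: D_def)
  \<comment> \<open>Choosing r small first and then t - s small yields one modulus of continuity for
    all n.\<close>
  have Udiff: "\<bar>U n t - U n s\<bar> \<le> r / 2 * D + (t - s) / (2 * r)"
    if "0 \<le> s" "s \<le> t" "t \<le> 1" "r > 0" for n r s t
  proof -
    have sub: "{s..t} \<subseteq> {0..1}" using that by auto
    have "U n s + integral {s..t} (u n) = U n t"
      unfolding U_def
      by (rule Henstock_Kurzweil_Integration.integral_combine) (use that L2_integrable_on_subinterval[OF u] in auto)
    then have "\<bar>U n t - U n s\<bar> = \<bar>integral {s..t} (u n)\<bar>" by simp
    also have "\<dots> \<le> r / 2 * integral {s..t} (\<lambda>x. (u n x)\<^sup>2) + (t - s) / (2 * r)"
      by (rule abs_integral_le_integral_square[OF L2_integrable_on_subinterval[OF u sub] that(4,2)])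
    also have "integral {s..t} (\<lambda>x. (u n x)\<^sup>2) \<le> integral {0..1} (\<lambda>x. (u n x)\<^sup>2)"
      by (rule integral_subset_le) (use sub L2_integrable_on_subinterval(2)[OF u] in auto)
    also have "\<dots> \<le> D" by (rule u_bound)
    finally show ?thesis using that by (simp add: mult_left_mono)
  qed
  obtain G and r :: "nat \<Rightarrow> nat" where G: "continuous_on {0..1} G" "strict_mono r"
    "\<And>e. 0 < e \<Longrightarrow> \<exists>N. \<forall>n x. n \<ge> N \<and> x \<in> {0..1} \<longrightarrow> norm (U (r n) x - G x) < e"
  proof (rule Arzela_Ascoli[of "{0..1::real}" U "1 / 2 * D + 1 / 2"])
    show "norm (U n x) \<le> 1 / 2 * D + 1 / 2" if "x \<in> {0..1}" for n x
      using Udiff[of 0 x 1 n] that by (simp add: U_def)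
    fix x e :: real assume x: "x \<in> {0..1}" and "0 < e"
    define s where "s = e / (D + 1)"
    have s: "s > 0" "s * D \<le> e" using \<open>0 < e\<close> \<open>D \<ge> 0\<close> by (auto simp: s_def field_simps)
    have "norm (U n x - U n y) < e" if "y \<in> {0..1}" "norm (x - y) < s * e" for n y
    proof -
      have "\<bar>U n (max x y) - U n (min x y)\<bar> \<le> s / 2 * D + (max x y - min x y) / (2 * s)"
        by (rule Udiff) (use x that s in auto)
      also have "max x y - min x y = \<bar>x - y\<bar>" by auto
      also have "s / 2 * D + \<bar>x - y\<bar> / (2 * s) < e / 2 + e / 2"
        using that s by (intro add_le_less_mono) (auto simp: field_simps)
      finally show ?thesis by (cases "x \<le> y") (auto simp: max_def min_def abs_minus_commute)
    qed
    then show "\<exists>d>0. \<forall>n y. y \<in> {0..1} \<and> norm (x - y) < d \<longrightarrow> norm (U n x - U n y) < e"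
      using s \<open>0 < e\<close> by (intro exI[of _ "s * e"]) auto
  next
    fix G r
    assume *: "continuous_on {0..1} G" "strict_mono (r :: nat \<Rightarrow> nat)"
      "\<And>e. 0 < e \<Longrightarrow> \<exists>N. \<forall>n x. n \<ge> N \<and> x \<in> {0..1} \<longrightarrow> norm (U (r n) x - G x) < e"
    show thesis by (rule that[OF *(1,2)]) (rule *(3))
  qed simp
  define h where "h x = exp (- C x) * G x" for x
  have h: "h \<in> L2_space"
    unfolding h_def by (intro L2_continuous continuous_on_mult expC_cont G)
  obtain V where Vpos: "V > 0" and V: "\<And>x. x \<in> {0..1} \<Longrightarrow> \<bar>exp (- C x)\<bar> \<le> V"
    using continuous_on_Icc_bound[OF expC_cont(2)] by blast
  have "(\<lambda>n. L2_norm (\<lambda>x. R_op a b (f (r n)) x - h x)) \<longlonglongrightarrow> 0"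
    unfolding LIMSEQ_iff
  proof (intro allI impI)
    fix e :: real assume "e > 0"
    define e' where "e' = e / (2 * V)"
    have "e' > 0" using \<open>e > 0\<close> Vpos by (simp add: e'_def)
    then obtain N where N: "\<And>n x. n \<ge> N \<Longrightarrow> x \<in> {0..1} \<Longrightarrow> \<bar>U (r n) x - G x\<bar> < e'"
      using G(3)[of e'] by auto
    have "L2_norm (\<lambda>x. R_op a b (f (r n)) x - h x) \<le> e / 2" if n: "n \<ge> N" for n
    proof -
      define d where "d x = R_op a b (f (r n)) x - h x" for x
      have R: "R_op a b (f (r n)) x = sol (f (r n)) x" if "x \<in> {0..1}" for x
        using R_op_eq_sol f that by blast
      have d: "d \<in> L2_space"
      proof -
        have "(\<lambda>x. sol (f (r n)) x - h x) \<in> L2_space" using f h by (intro L2_diff sol_L2) auto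
        then show ?thesis using L2_space_cong[of d "\<lambda>x. sol (f (r n)) x - h x"] R by (simp add: d_def)
      qed
      have "\<bar>d x\<bar> \<le> e / 2" if x: "x \<in> {0..1}" for x
      proof -
        have "d x = exp (- C x) * (U (r n) x - G x)"
          by (simp add: d_def R[OF x] h_def sol_def U_def u_def[abs_def] w_def right_diff_distrib)
        then have "\<bar>d x\<bar> = \<bar>exp (- C x)\<bar> * \<bar>U (r n) x - G x\<bar>" by (simp add: abs_mult)
        also have "\<dots> \<le> V * e'" using V[OF x] N[OF n x] Vpos by (intro mult_mono) auto
        finally show ?thesis using Vpos by (simp add: e'_def)
      qed
      then have "L2_inner d d \<le> (e / 2)\<^sup>2 * (1 - 0)"
        by (intro L2_inner_self_le d) auto
      then have "L2_inner d d \<le> (e / 2)\<^sup>2" by simp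
      then have "L2_norm d \<le> e / 2"
        unfolding L2_norm_def using \<open>e > 0\<close> by (intro real_le_lsqrt) auto
      then show ?thesis by (simp add: d_def[abs_def])
    qed
    then have "norm (L2_norm (\<lambda>x. R_op a b (f (r n)) x - h x) - 0) < e" if "n \<ge> N" for n
      using that \<open>e > 0\<close> by (simp add: L2_norm_def L2_inner_self_nonneg) force
    then show "\<exists>no. \<forall>n\<ge>no. norm (L2_norm (\<lambda>x. R_op a b (f (r n)) x - h x) - 0) < e"
      by blast
  qed
  then show "\<exists>r h. strict_mono (r :: nat \<Rightarrow> nat) \<and> h \<in> L2_space \<and>
        (\<lambda>n. L2_norm (\<lambda>x. R_op a b (f (r n)) x - h x)) \<longlonglongrightarrow> 0"
    using G(2) h by blast
qed

end

section \<open>Lower bounds for the eigenvalues\<close>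

text \<open>Squaring the positive part of s (1 - s) removes the kinks at 0 and 1, so a bump has a
  continuous derivative and its rescalings lie in the range of the solution operator up to the
  factor e^C.\<close>

definition bump :: "real \<Rightarrow> real" where
  "bump s = (max 0 (s * (1 - s)))\<^sup>2"

definition bump' :: "real \<Rightarrow> real" where
  "bump' s = 2 * max 0 (s * (1 - s)) * (1 - 2 * s)"

text \<open>The first order remainder is at most (y - s)^2, also when y and s lie on different sides
  of 0.\<close>

lemma square_pos_part_deriv:
  "((\<lambda>s::real. (max 0 s)\<^sup>2) has_real_derivative 2 * max 0 s) (at s)"
  unfolding has_field_derivative_def has_derivative_within_alt
proof (intro conjI allI impI)
  show "bounded_linear ((*) (2 * max 0 s))" by (rule bounded_linear_mult_right)
  fix e :: real assume "e > 0"
  have quad: "\<bar>(max 0 y)\<^sup>2 - (max 0 s)\<^sup>2 - 2 * max 0 s * (y - s)\<bar> \<le> (y - s)\<^sup>2" for y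
  proof (cases "s \<le> 0")
    case s: True
    show ?thesis
    proof (cases "y \<le> 0")
      case False
      then have "y\<^sup>2 \<le> (y - s)\<^sup>2" using s by (intro power_mono) auto
      then show ?thesis using s False by simp
    qed (use s in simp)
  next
    case s: False
    show ?thesis
    proof (cases "y \<le> 0")
      case True
      have "0 \<le> s * (- y)" "0 \<le> s\<^sup>2" "0 \<le> y\<^sup>2" using s True by (auto simp: mult_nonneg_nonpos)
      then have "\<bar>s\<^sup>2 - 2 * (s * y)\<bar> \<le> (y - s)\<^sup>2"
        using mult.commute[of s y] unfolding power2_diff by linarith
      moreover have "- s\<^sup>2 - 2 * s * (y - s) = s\<^sup>2 - 2 * (s * y)"
        by (simp add: algebra_simps power2_eq_square)
      ultimately show ?thesis using s True by simp
    next
      case False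
      then have "(max 0 y)\<^sup>2 - (max 0 s)\<^sup>2 - 2 * max 0 s * (y - s) = (y - s)\<^sup>2"
        using s by (simp add: algebra_simps power2_eq_square)
      then show ?thesis by simp
    qed
  qed
  have "norm ((max 0 y)\<^sup>2 - (max 0 s)\<^sup>2 - 2 * max 0 s * (y - s)) \<le> e * norm (y - s)"
    if "norm (y - s) < e" for y
  proof -
    have "(y - s)\<^sup>2 = \<bar>y - s\<bar> * \<bar>y - s\<bar>" by (simp add: power2_eq_square)
    also have "\<dots> \<le> e * \<bar>y - s\<bar>" using that by (intro mult_right_mono) auto
    finally show ?thesis using quad[of y] by simp
  qed
  then show "\<exists>d>0. \<forall>y\<in>UNIV. norm (y - s) < d \<longrightarrow>
      norm ((max 0 y)\<^sup>2 - (max 0 s)\<^sup>2 - 2 * max 0 s * (y - s)) \<le> e * norm (y - s)"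
    using \<open>e > 0\<close> by blast
qed

lemma bump_deriv: "(bump has_real_derivative bump' s) (at s)"
proof -
  have "((\<lambda>s. s * (1 - s)) has_real_derivative 1 - 2 * s) (at s)"
    by (auto intro!: derivative_eq_intros)
  from DERIV_chain2[OF square_pos_part_deriv this]
  show ?thesis by (simp add: bump_def[abs_def] bump'_def)
qed

lemma bump'_cont: "continuous_on S bump'"
  unfolding bump'_def by (intro continuous_intros)

lemma quarter_bound: "s * (1 - s) \<le> 1 / (4::real)"
proof -
  have "0 \<le> (2 * s - 1)\<^sup>2" by simp
  then show ?thesis by (simp add: power2_eq_square algebra_simps)
qed

lemma bump_zero: "s \<notin> {0<..<1} \<Longrightarrow> bump s = 0" "s \<notin> {0<..<1} \<Longrightarrow> bump' s = 0"
proof -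
  assume "s \<notin> {0<..<1}"
  then have "s * (1 - s) \<le> 0"
    by (auto simp: mult_le_0_iff)
  then show "bump s = 0" "bump' s = 0" by (simp_all add: bump_def bump'_def)
qed

lemma bump_le: "\<bar>bump s\<bar> \<le> 1 / 16"
  using power_mono[of "max 0 (s * (1 - s))" "1 / 4" 2] quarter_bound[of s]
  by (simp add: bump_def power2_eq_square)

lemma bump'_le: "\<bar>bump' s\<bar> \<le> 1 / 2"
proof (cases "s \<in> {0<..<1}")
  case True
  have "\<bar>bump' s\<bar> = 2 * max 0 (s * (1 - s)) * \<bar>1 - 2 * s\<bar>"
    by (simp add: bump'_def abs_mult)
  also have "\<dots> \<le> 2 * (1 / 4) * 1"
    using quarter_bound[of s] True by (intro mult_mono) auto
  finally show ?thesis by simp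
qed (simp add: bump_zero)

text \<open>3/16 is the value of s (1 - s) at 1/4 and 3/4.\<close>

lemma bump_ge:
  assumes "s \<in> {1/4..3/4}"
  shows "(3 / 16)\<^sup>2 \<le> bump s"
proof -
  have "0 \<le> (s - 1 / 4) * (3 / 4 - s)" using assms by (intro mult_nonneg_nonneg) auto
  moreover have "(s - 1 / 4) * (3 / 4 - s) = s * (1 - s) - 3 / 16" by algebra
  ultimately have "3 / 16 \<le> s * (1 - s)" by simp
  then show ?thesis unfolding bump_def by (intro power_mono) auto
qed

context first_order_ode
begin

text \<open>Moving one adjoint to the other side leaves the inner product of R R^T \<psi>_i with
  \<psi>_j. The eigenvalues thus appear as squared lengths.\<close>

lemma adj_orthogonal:
  assumes \<psi>: "ordered_eigenbasis a b \<psi> ev" and "i \<ge> 1" "j \<ge> 1"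
  shows "L2_inner (adj (\<psi> i)) (adj (\<psi> j)) = (if i = j then ev i else 0)"
proof -
  have eig: "\<psi> i \<in> L2_space" "L2_eq (sol (adj (\<psi> i))) (\<lambda>x. ev i * \<psi> i x)" "\<psi> j \<in> L2_space"
    using \<psi> assms(2,3) L2_eigenfunction_RRT[of "ev i" "\<psi> i"]
    by (auto simp: ordered_eigenbasis_def L2_orthonormal_basis_def)
  have "L2_inner (adj (\<psi> i)) (adj (\<psi> j)) = L2_inner (sol (adj (\<psi> i))) (\<psi> j)"
    by (rule L2_inner_sol[symmetric]) (use eig adj_L2 in auto)
  also have "\<dots> = L2_inner (\<lambda>x. ev i * \<psi> i x) (\<psi> j)"
    by (rule L2_inner_cong_AE) (use eig in \<open>auto intro: sol_L2 adj_L2 L2_cmult L2_eq_refl\<close>)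
  also have "\<dots> = (if i = j then ev i else 0)"
    using \<psi> assms(2,3) by (simp add: L2_inner_cmult_left ordered_eigenbasis_def L2_orthonormal_basis_def)
  finally show ?thesis .
qed

lemma ev_antimono:
  assumes \<psi>: "ordered_eigenbasis a b \<psi> ev" and "1 \<le> k" "k \<le> j"
  shows "ev j \<le> ev k"
  using \<open>k \<le> j\<close>
proof (induction j rule: dec_induct)
  case (step n)
  then have "ev (Suc n) \<le> ev n" using \<psi> \<open>1 \<le> k\<close> by (simp add: ordered_eigenbasis_def)
  then show ?case using step.IH by simp
qed simp

text \<open>Parseval's identity for \<open>sol g\<close>, with the tail estimated through
  \<open>\<langle>R g, \<psi>\<^sub>j\<rangle> = \<langle>g, R\<^sup>T \<psi>\<^sub>j\<rangle>\<close> and Bessel's inequality.\<close>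

lemma L2_inner_sol_le:
  assumes \<psi>: "ordered_eigenbasis a b \<psi> ev" and g: "g \<in> L2_space"
    and k: "k \<ge> 1" and M: "M > 0" "ev k \<le> M"
  shows "L2_inner (sol g) (sol g) \<le> (\<Sum>j=1..<k. (L2_inner (sol g) (\<psi> j))\<^sup>2) + M * L2_inner g g"
proof -
  have basis: "L2_orthonormal_basis \<psi>" using \<psi> by (simp add: ordered_eigenbasis_def)
  have "(\<Sum>j=1..N. (L2_inner (sol g) (\<psi> j))\<^sup>2)
      \<le> (\<Sum>j=1..<k. (L2_inner (sol g) (\<psi> j))\<^sup>2) + M * L2_inner g g" if "N \<ge> k" for N
  proof -
    have "{1..N} = {1..<k} \<union> {k..N}" using that k by auto
    then have "(\<Sum>j=1..N. (L2_inner (sol g) (\<psi> j))\<^sup>2)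
        = (\<Sum>j=1..<k. (L2_inner (sol g) (\<psi> j))\<^sup>2) + (\<Sum>j=k..N. (L2_inner (sol g) (\<psi> j))\<^sup>2)"
      by (simp only:) (rule sum.union_disjoint, auto)
    also have "(\<Sum>j=k..N. (L2_inner (sol g) (\<psi> j))\<^sup>2) = (\<Sum>j=k..N. (L2_inner g (adj (\<psi> j)))\<^sup>2)"
      using basis k by (intro sum.cong) (auto simp: L2_inner_sol[OF g] L2_orthonormal_basis_def)
    \<comment> \<open>The squared lengths \<open>ev j\<close> with j \<ge> k are at most
      \<open>ev k\<close>; M takes its place because Bessel's inequality asks for a positive
      bound.\<close>
    also have "\<dots> \<le> M * L2_inner g g"
    proof (rule L2_Bessel[where \<mu> = ev])
      show "adj (\<psi> j) \<in> L2_space" if "j \<in> {k..N}" for j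
        using basis that k by (intro adj_L2) (auto simp: L2_orthonormal_basis_def)
      show "ev j \<le> M" if "j \<in> {k..N}" for j
        using ev_antimono[OF \<psi> k, of j] that M by simp
    qed (use adj_orthogonal[OF \<psi>] k M g in auto)
    finally show ?thesis by simp
  qed
  then show ?thesis
    by (intro LIMSEQ_le_const2[OF L2_Parseval[OF basis sol_L2[OF g]]]) blast
qed

text \<open>The i-th of m bumps, living on [i / m, (i + 1) / m]; the factor e^(-C) cancels the
  integrating factor.\<close>

definition test_fun :: "nat \<Rightarrow> nat \<Rightarrow> real \<Rightarrow> real" where
  "test_fun m i x = exp (- C x) * bump (real m * x - real i)"

text \<open>Chosen so that e^C / a times it is the derivative of the rescaled bump.\<close>

definition test_src :: "nat \<Rightarrow> nat \<Rightarrow> real \<Rightarrow> real" where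
  "test_src m i x = a x * exp (- C x) * (real m * bump' (real m * x - real i))"

lemma test_src_L2: "test_src m i \<in> L2_space"
  unfolding test_src_def
  by (intro L2_continuous continuous_on_mult a_cont expC_cont continuous_on_const
      continuous_on_compose2[OF bump'_cont[of UNIV]] continuous_intros) auto

lemma sol_test_src:
  assumes x: "x \<in> {0..1}"
  shows "sol (test_src m i) x = test_fun m i x"
proof -
  have d: "((\<lambda>t. bump (real m * t - real i)) has_real_derivative real m * bump' (real m * t - real i)) (at t)" for t
  proof -
    have "((\<lambda>t. real m * t - real i) has_real_derivative real m) (at t)"
      by (auto intro!: derivative_eq_intros)
    from DERIV_chain2[OF bump_deriv this] show ?thesis by (simp add: mult.commute)
  qed
  have hi: "((\<lambda>t. real m * bump' (real m * t - real i)) has_integral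
      bump (real m * x - real i) - bump (real m * 0 - real i)) {0..x}"
    by (rule fundamental_theorem_of_calculus)
       (use x has_field_derivative_at_within[OF d] in
          \<open>auto simp flip: has_real_derivative_iff_has_vector_derivative\<close>)
  have "bump (- real i) = 0" by (rule bump_zero) auto
  then have "integral {0..x} (\<lambda>t. real m * bump' (real m * t - real i)) = bump (real m * x - real i)"
    by (intro trans[OF integral_unique[OF hi]]) simp
  moreover have "integral {0..x} (\<lambda>t. exp (C t) / a t * test_src m i t)
      = integral {0..x} (\<lambda>t. real m * bump' (real m * t - real i))"
  proof (rule integral_cong)
    fix t assume "t \<in> {0..x}"
    then have "t \<in> {0..1}" using x by auto
    from a_nonzero[OF this] show "exp (C t) / a t * test_src m i t = real m * bump' (real m * t - real i)"
      by (simp add: test_src_def exp_minus)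
  qed
  ultimately show ?thesis by (simp only: sol_def test_fun_def)
qed

lemma test_fun_L2: "test_fun m i \<in> L2_space"
  using sol_L2[OF test_src_L2[of m i]] L2_space_cong[of "sol (test_src m i)" "test_fun m i"]
  by (simp add: sol_test_src)

lemma L2_inner_test_fun:
  "i \<noteq> j \<Longrightarrow> L2_inner (test_fun m i) (test_fun m j) = 0"
proof -
  assume "i \<noteq> j"
  have zero: "test_fun m i x * test_fun m j x = 0" for x
  proof (rule ccontr)
    assume "test_fun m i x * test_fun m j x \<noteq> 0"
    then have "real m * x - real i \<in> {0<..<1}" "real m * x - real j \<in> {0<..<1}"
      using bump_zero(1)[of "real m * x - real i"] bump_zero(1)[of "real m * x - real j"]
      by (auto simp: test_fun_def simp del: greaterThanLessThan_iff)
    then show False using \<open>i \<noteq> j\<close> by auto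
  qed
  show ?thesis unfolding L2_inner_def zero by simp
qed

lemma test_fun_zero:
  assumes "m > 0" "x \<notin> {real i / real m..(real i + 1) / real m}"
  shows "test_fun m i x = 0" "test_src m i x = 0"
proof -
  have "real m * x - real i \<notin> {0<..<1}" using assms by (auto simp: field_simps)
  then show "test_fun m i x = 0" "test_src m i x = 0"
    using bump_zero by (simp_all add: test_fun_def test_src_def)
qed

text \<open>About \<open>k\<close> test functions with disjoint supports cannot all be close to the span of
  \<open>\<psi>\<^sub>1, \<dots>, \<psi>\<^sub>k\<^sub>-\<^sub>1\<close>.\<close>

lemma eigenvalue_lower_bound:
  obtains c where "c > 0" "\<And>\<psi> ev k. ordered_eigenbasis a b \<psi> ev \<Longrightarrow> k \<ge> 1 \<Longrightarrow> c / (real k)\<^sup>2 \<le> ev k"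
proof -
  obtain V where Vpos: "V > 0" and V: "\<And>x. x \<in> {0..1} \<Longrightarrow> \<bar>exp (- C x)\<bar> \<le> V"
    using continuous_on_Icc_bound[OF expC_cont(2)] by blast
  obtain W where Wpos: "W > 0" and W: "\<And>x. x \<in> {0..1} \<Longrightarrow> \<bar>exp (C x)\<bar> \<le> W"
    using continuous_on_Icc_bound[OF expC_cont(1)] by blast
  obtain A where Apos: "A > 0" and A: "\<And>x. x \<in> {0..1} \<Longrightarrow> \<bar>a x * exp (- C x)\<bar> \<le> A"
    using continuous_on_Icc_bound[OF continuous_on_mult[OF a_cont expC_cont(2)]] by blast
  note pos = Vpos Wpos Apos
  have Wle: "1 / W \<le> exp (- C x)" if "x \<in> {0..1}" for x
    using W[OF that] pos by (simp add: exp_minus field_simps)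
  \<comment> \<open>p / m and q / m enclose the squared norms of the m test functions: the bump is
    at least (3/16)^2 on half of its support and at most 1/16 everywhere.\<close>
  define p where "p = (3 / 16) ^ 4 / (2 * W\<^sup>2)"
  define q where "q = V\<^sup>2 / 256"
  have pq: "p > 0" "q > 0" using pos by (auto simp: p_def q_def)
  \<comment> \<open>Obtained from 2 p \<le> M A^2 m^2 by inserting m \<le> (2 q / p + 1) k.\<close>
  define c where "c = 2 * p / ((2 * q / p + 1)\<^sup>2 * A\<^sup>2)"
  have "c > 0" unfolding c_def using pq pos by (intro divide_pos_pos mult_pos_pos zero_less_power add_pos_pos) auto
  moreover have "c / (real k)\<^sup>2 \<le> ev k" if \<psi>: "ordered_eigenbasis a b \<psi> ev" and k: "k \<ge> 1" for \<psi> ev k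
  proof -
    have basis: "L2_orthonormal_basis \<psi>" using \<psi> by (simp add: ordered_eigenbasis_def)
    \<comment> \<open>The test functions have total squared norm at least p, of which the first k -
      1 eigenfunctions capture at most (k - 1) q / m; this m keeps that share at most p / 2.\<close>
    define m where "m = nat \<lceil>2 * q * real k / p\<rceil>"
    have "0 < 2 * q * real k / p" using pq k by simp
    then have m: "2 * q * real k / p \<le> real m" "real m \<le> 2 * q * real k / p + 1" "m > 0"
      unfolding m_def by linarith+
    have sub: "{real i / real m..(real i + 1) / real m} \<subseteq> {0..1}" if "i < m" for i
      using that m(3) by (auto simp: field_simps)
    have le: "real i / real m \<le> (real i + 1) / real m" for i
      by (simp add: divide_right_mono)
    have upper: "L2_inner (test_fun m i) (test_fun m i) \<le> q / real m" if "i < m" for i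
    proof -
      have "L2_inner (test_fun m i) (test_fun m i) \<le> (V * (1 / 16))\<^sup>2 * ((real i + 1) / real m - real i / real m)"
      proof (rule L2_inner_self_le[OF test_fun_L2 le sub[OF that]])
        show "test_fun m i x = 0" if "x \<in> {0..1} - {real i / real m..(real i + 1) / real m}" for x
          using test_fun_zero[OF m(3)] that by blast
        fix x assume "x \<in> {real i / real m..(real i + 1) / real m}"
        then have "x \<in> {0..1}" using sub[OF that] by blast
        then show "\<bar>test_fun m i x\<bar> \<le> V * (1 / 16)"
          unfolding test_fun_def abs_mult using V bump_le pos by (intro mult_mono) auto
      qed
      also have "\<dots> = q / real m"
        by (simp add: q_def power_divide add_divide_distrib)
      finally show ?thesis .
    qed
    have src: "L2_inner (test_src m i) (test_src m i) \<le> A\<^sup>2 * real m / 4" if "i < m" for i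
    proof -
      have "L2_inner (test_src m i) (test_src m i) \<le> (A * (real m * (1 / 2)))\<^sup>2 * ((real i + 1) / real m - real i / real m)"
      proof (rule L2_inner_self_le[OF test_src_L2 le sub[OF that]])
        show "test_src m i x = 0" if "x \<in> {0..1} - {real i / real m..(real i + 1) / real m}" for x
          using test_fun_zero[OF m(3)] that by blast
        fix x assume "x \<in> {real i / real m..(real i + 1) / real m}"
        then have "x \<in> {0..1}" using sub[OF that] by blast
        moreover have "\<bar>real m * bump' (real m * x - real i)\<bar> \<le> real m * (1 / 2)"
          unfolding abs_mult using bump'_le by (intro mult_mono) auto
        ultimately show "\<bar>test_src m i x\<bar> \<le> A * (real m * (1 / 2))"
          unfolding test_src_def abs_mult[of "a x * exp (- C x)"] using A pos by (intro mult_mono) auto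
      qed
      also have "\<dots> = A\<^sup>2 * real m / 4"
        using m(3) by (simp add: field_simps power2_eq_square)
      finally show ?thesis .
    qed
    have lower: "p / real m \<le> L2_inner (test_fun m i) (test_fun m i)" if "i < m" for i
    proof -
      have "(1 / W * (3 / 16)\<^sup>2)\<^sup>2 * ((real i + 3 / 4) / real m - (real i + 1 / 4) / real m) \<le> L2_inner (test_fun m i) (test_fun m i)"
      proof (rule L2_inner_self_ge[OF test_fun_L2])
        show "(real i + 1 / 4) / real m \<le> (real i + 3 / 4) / real m" by (simp add: divide_right_mono)
        show S: "{(real i + 1 / 4) / real m..(real i + 3 / 4) / real m} \<subseteq> {0..1}"
          using that m(3) by (auto simp: field_simps)
        show "0 \<le> 1 / W * (3 / 16)\<^sup>2" using pos by simp
        fix x assume x: "x \<in> {(real i + 1 / 4) / real m..(real i + 3 / 4) / real m}"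
        then have x01: "x \<in> {0..1}" using S by blast
        have "real m * x - real i \<in> {1/4..3/4}" using x m(3) by (auto simp: field_simps)
        then have b: "(3 / 16)\<^sup>2 \<le> bump (real m * x - real i)" by (rule bump_ge)
        then have "1 / W * (3 / 16)\<^sup>2 \<le> exp (- C x) * bump (real m * x - real i)"
          using Wle[OF x01] pos by (intro mult_mono) auto
        then show "1 / W * (3 / 16)\<^sup>2 \<le> \<bar>test_fun m i x\<bar>"
          unfolding test_fun_def by linarith
      qed
      also have "(1 / W * (3 / 16)\<^sup>2)\<^sup>2 * ((real i + 3 / 4) / real m - (real i + 1 / 4) / real m) = p / real m"
        by (simp add: p_def power_divide power_mult_distrib flip: diff_divide_distrib)
      finally show ?thesis .
    qed
    \<comment> \<open>An upper bound M replaces \<open>ev k\<close>, whose sign is still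
      open.\<close>
    have main: "c / (real k)\<^sup>2 \<le> M" if M: "M > 0" "ev k \<le> M" for M
    proof -
      have "p = (\<Sum>i<m. p / real m)" using m(3) by simp
      also have "\<dots> \<le> (\<Sum>i<m. L2_inner (test_fun m i) (test_fun m i))"
        by (intro sum_mono lower) simp
      also have "\<dots> \<le> (\<Sum>i<m. (\<Sum>j=1..<k. (L2_inner (test_fun m i) (\<psi> j))\<^sup>2) + M * (A\<^sup>2 * real m / 4))"
      proof (rule sum_mono)
        fix i assume i: "i \<in> {..<m}"
        have eq: "L2_inner (sol (test_src m i)) h = L2_inner (test_fun m i) h"
            "L2_inner h (sol (test_src m i)) = L2_inner h (test_fun m i)" for h
          unfolding L2_inner_def by (auto intro!: Bochner_Integration.integral_cong simp: sol_test_src)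
        have "L2_inner (test_fun m i) (test_fun m i)
            \<le> (\<Sum>j=1..<k. (L2_inner (test_fun m i) (\<psi> j))\<^sup>2) + M * L2_inner (test_src m i) (test_src m i)"
          using L2_inner_sol_le[OF \<psi> test_src_L2[of m i] k M] unfolding eq .
        also have "M * L2_inner (test_src m i) (test_src m i) \<le> M * (A\<^sup>2 * real m / 4)"
          using src i M by (intro mult_left_mono) auto
        finally show "L2_inner (test_fun m i) (test_fun m i)
            \<le> (\<Sum>j=1..<k. (L2_inner (test_fun m i) (\<psi> j))\<^sup>2) + M * (A\<^sup>2 * real m / 4)" by simp
      qed
      also have "\<dots> = (\<Sum>j=1..<k. \<Sum>i<m. (L2_inner (test_fun m i) (\<psi> j))\<^sup>2) + real m * (M * (A\<^sup>2 * real m / 4))"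
        by (simp add: sum.distrib sum.swap[of _ "{..<m}"])
      also have "(\<Sum>j=1..<k. \<Sum>i<m. (L2_inner (test_fun m i) (\<psi> j))\<^sup>2) \<le> (\<Sum>j=1..<k. q / real m)"
      proof (rule sum_mono)
        fix j assume j: "j \<in> {1..<k}"
        \<comment> \<open>The roles are exchanged: here the test functions are the orthogonal system
          and \<psi>_j is the vector being expanded.\<close>
        have "(\<Sum>i<m. (L2_inner (\<psi> j) (test_fun m i))\<^sup>2) \<le> q / real m * L2_inner (\<psi> j) (\<psi> j)"
        proof (rule L2_Bessel[where \<mu> = "\<lambda>i. L2_inner (test_fun m i) (test_fun m i)"])
          show "L2_inner (test_fun m i) (test_fun m j) = (if i = j then L2_inner (test_fun m i) (test_fun m i) else 0)" for i j
            by (simp add: L2_inner_test_fun)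
          show "\<psi> j \<in> L2_space" using basis j by (simp add: L2_orthonormal_basis_def)
        qed (use test_fun_L2 upper pq m(3) in auto)
        then show "(\<Sum>i<m. (L2_inner (test_fun m i) (\<psi> j))\<^sup>2) \<le> q / real m"
          using basis j by (simp add: L2_inner_commute L2_orthonormal_basis_def)
      qed
      also have "(\<Sum>j=1..<k. q / real m) \<le> real k * (q / real m)"
        using pq by (simp add: mult_right_mono divide_right_mono)
      also have "real k * (q / real m) \<le> p / 2"
        using m(1,3) pq by (simp add: field_simps)
      finally have "p / 2 \<le> real m * (M * (A\<^sup>2 * real m / 4))" by simp
      then have "2 * p \<le> M * A\<^sup>2 * (real m)\<^sup>2" by (simp add: power2_eq_square field_simps)
      also have "\<dots> \<le> M * A\<^sup>2 * ((2 * q / p + 1) * real k)\<^sup>2"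
      proof (intro mult_left_mono power_mono)
        have "real m \<le> 2 * q / p * real k + 1" using m(2) by simp
        also have "\<dots> \<le> (2 * q / p + 1) * real k" using k by (simp add: algebra_simps)
        finally show "real m \<le> (2 * q / p + 1) * real k" .
      qed (use M in auto)
      also have "\<dots> = M * (real k)\<^sup>2 * ((2 * q / p + 1)\<^sup>2 * A\<^sup>2)"
        by (simp only: power_mult_distrib ac_simps)
      finally have "2 * p \<le> M * (real k)\<^sup>2 * ((2 * q / p + 1)\<^sup>2 * A\<^sup>2)" .
      moreover have "(2 * q / p + 1)\<^sup>2 * A\<^sup>2 > 0"
        using pq pos by (intro mult_pos_pos zero_less_power add_pos_pos) auto
      ultimately have "c \<le> M * (real k)\<^sup>2" unfolding c_def by (simp add: pos_divide_le_eq)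
      then show ?thesis using k by (simp add: pos_divide_le_eq)
    qed
    show ?thesis
    \<comment> \<open>Otherwise M = max (ev k) (c / k^2 / 2) would be positive and below c / k^2,
      against \<open>main\<close>.\<close>
    proof (rule ccontr)
      assume "\<not> c / (real k)\<^sup>2 \<le> ev k"
      moreover have pos': "c / (real k)\<^sup>2 > 0" using \<open>c > 0\<close> k by simp
      moreover have "c / (real k)\<^sup>2 \<le> max (ev k) (c / (real k)\<^sup>2 / 2)"
        by (rule main) (use pos' in auto)
      ultimately show False by auto
    qed
  qed
  ultimately show thesis by (rule that)
qed

end

section \<open>Regularity of the eigenfunctions\<close>

lemma nondecreasing_of_nonneg_deriv:
  fixes f f' :: "real \<Rightarrow> real"
  assumes d: "\<And>x. x \<in> {0..1} \<Longrightarrow> (f has_real_derivative f' x) (at x within {0..1})"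
    and "\<And>x. x \<in> {0..1} \<Longrightarrow> 0 \<le> f' x" and st: "0 \<le> s" "s \<le> t" "t \<le> 1"
  shows "f s \<le> f t"
proof -
  have "(f has_derivative (*) (f' x)) (at x within {s..t})" if "s \<le> x" "x \<le> t" for x
    using DERIV_subset[OF d[of x], of "{s..t}"] that st by (auto simp: has_field_derivative_def)
  then obtain x where "x \<in> {s..t}" "f t - f s = f' x * (t - s)"
    using mvt_very_simple[OF st(2), of f "\<lambda>x. (*) (f' x)"] by blast
  moreover have "0 \<le> f' x * (t - s)"
    using assms(2)[of x] calculation st by (intro mult_nonneg_nonneg) auto
  ultimately show ?thesis by simp
qed

text \<open>e^(L x) E(x) is nondecreasing and e^(-L x) E(x) is nonincreasing, so values can be
  compared in both directions; this is what permits averaging over t. Two points are at distance at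
  most 1, whence the factor e^L.\<close>

lemma Gronwall:
  fixes E E' :: "real \<Rightarrow> real"
  assumes d: "\<And>x. x \<in> {0..1} \<Longrightarrow> (E has_real_derivative E' x) (at x within {0..1})"
    and bound: "\<And>x. x \<in> {0..1} \<Longrightarrow> \<bar>E' x\<bar> \<le> L * E x" and "L \<ge> 0"
    and nonneg: "\<And>x. 0 \<le> E x"
    and x: "x \<in> {0..1}" and t: "t \<in> {0..1}"
  shows "E x \<le> exp L * E t"
proof (cases "t \<le> x")
  case True
  have "- (exp (- L * t) * E t) \<le> - (exp (- L * x) * E x)"
  proof (rule nondecreasing_of_nonneg_deriv[where f = "\<lambda>x. - (exp (- L * x) * E x)" and f' = "\<lambda>x. - (exp (- L * x) * (E' x - L * E x))"])
    fix s :: real assume s: "s \<in> {0..1}"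
    show "((\<lambda>x. - (exp (- L * x) * E x)) has_real_derivative - (exp (- L * s) * (E' s - L * E s))) (at s within {0..1})"
      by (rule derivative_eq_intros d[OF s] refl)+ (simp add: algebra_simps)
    have "E' s - L * E s \<le> 0" using bound[OF s] by linarith
    then show "0 \<le> - (exp (- L * s) * (E' s - L * E s))" by (simp add: mult_nonneg_nonpos)
  qed (use x t True in auto)
  then have "exp (L * x) * (exp (- L * x) * E x) \<le> exp (L * x) * (exp (- L * t) * E t)"
    by (intro mult_left_mono) auto
  then have "E x \<le> exp (L * (x - t)) * E t"
    by (simp add: mult.assoc[symmetric] exp_add[symmetric] right_diff_distrib)
  also have "\<dots> \<le> exp L * E t"
    using x t True \<open>L \<ge> 0\<close> nonneg mult_left_mono[of "x - t" 1 L] by (intro mult_right_mono) auto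
  finally show ?thesis .
next
  case False
  have "exp (L * x) * E x \<le> exp (L * t) * E t"
  proof (rule nondecreasing_of_nonneg_deriv[where f = "\<lambda>x. exp (L * x) * E x" and f' = "\<lambda>x. exp (L * x) * (E' x + L * E x)"])
    fix s :: real assume s: "s \<in> {0..1}"
    show "((\<lambda>x. exp (L * x) * E x) has_real_derivative exp (L * s) * (E' s + L * E s)) (at s within {0..1})"
      by (rule derivative_eq_intros d[OF s] refl)+ (simp add: algebra_simps)
    have "0 \<le> E' s + L * E s" using bound[OF s] by linarith
    then show "0 \<le> exp (L * s) * (E' s + L * E s)" by simp
  qed (use x t False in auto)
  then have "exp (- L * x) * (exp (L * x) * E x) \<le> exp (- L * x) * (exp (L * t) * E t)"
    by (intro mult_left_mono) auto
  then have "E x \<le> exp (L * (t - x)) * E t"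
    by (simp add: mult.assoc[symmetric] exp_add[symmetric] right_diff_distrib)
  also have "\<dots> \<le> exp L * E t"
    using x t False \<open>L \<ge> 0\<close> nonneg mult_left_mono[of "t - x" 1 L] by (intro mult_right_mono) auto
  finally show ?thesis .
qed

text \<open>The derivative of a enters because the energy contains the weight (e^C / a)^2.\<close>

locale first_order_ode_C1 = first_order_ode +
  fixes a' :: "real \<Rightarrow> real"
  assumes a_deriv: "\<And>x. x \<in> {0..1} \<Longrightarrow> (a has_real_derivative a' x) (at x within {0..1})"
    and a'_cont: "continuous_on {0..1} a'"
begin

definition w :: "real \<Rightarrow> real" where
  "w x = exp (C x) / a x"

lemma w_cont: "continuous_on {0..1} w"
  unfolding w_def by (rule expC_cont)

lemma w_deriv:
  assumes "x \<in> {0..1}"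
  shows "(w has_real_derivative w x * (b x / a x - a' x / a x)) (at x within {0..1})"
  unfolding w_def
  by (rule derivative_eq_intros expC_deriv a_deriv assms refl a_nonzero)+
     (use a_nonzero[OF assms] in \<open>simp add: field_simps power2_eq_square\<close>)

text \<open>A bound for the logarithmic derivatives of the two energy weights e^(-2 C) and
  \<open>w\<close>^2. Being a constant of the locale, it can occur in statements.\<close>

definition growth :: real where
  "growth = (SOME L. L > 0 \<and> (\<forall>x\<in>{0..1}. 2 * \<bar>b x / a x\<bar> \<le> L \<and> 2 * \<bar>b x / a x - a' x / a x\<bar> \<le> L))"

lemma growth: "growth > 0" "x \<in> {0..1} \<Longrightarrow> 2 * \<bar>b x / a x\<bar> \<le> growth"
    "x \<in> {0..1} \<Longrightarrow> 2 * \<bar>b x / a x - a' x / a x\<bar> \<le> growth"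
proof -
  have "continuous_on {0..1} (\<lambda>x. b x / a x - a' x / a x)"
    using a_nonzero by (intro continuous_on_diff ba_cont continuous_on_divide a'_cont a_cont) auto
  then obtain B' where B': "B' > 0" "\<And>x. x \<in> {0..1} \<Longrightarrow> \<bar>b x / a x - a' x / a x\<bar> \<le> B'"
    using continuous_on_Icc_bound by blast
  obtain B where B: "B > 0" "\<And>x. x \<in> {0..1} \<Longrightarrow> \<bar>b x / a x\<bar> \<le> B"
    using continuous_on_Icc_bound[OF ba_cont] by blast
  have "\<exists>L. L > 0 \<and> (\<forall>x\<in>{0..1}. 2 * \<bar>b x / a x\<bar> \<le> L \<and> 2 * \<bar>b x / a x - a' x / a x\<bar> \<le> L)"
    using B B' by (intro exI[of _ "2 * B + 2 * B'"]) fastforce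
  from someI_ex[OF this, folded growth_def]
  show "growth > 0" "x \<in> {0..1} \<Longrightarrow> 2 * \<bar>b x / a x\<bar> \<le> growth"
    "x \<in> {0..1} \<Longrightarrow> 2 * \<bar>b x / a x - a' x / a x\<bar> \<le> growth" by auto
qed

text \<open>With \<open>H(x) = \<integral>\<^sub>x\<^sup>1 e\<^sup>-\<^sup>C \<psi>\<close> and \<open>s = H / \<surd>\<mu>\<close>, the energy \<open>\<phi>\<^sup>2 + w\<^sup>2 s\<^sup>2\<close> of an eigenfunction
  has a logarithmic derivative that is bounded independently of \<open>\<mu>\<close>, since the terms with \<open>1 / \<surd>\<mu>\<close>
  cancel. Both parts of the energy have integral \<open>1\<close>.\<close>

lemma eigenfunction_energy:
  assumes \<mu>: "\<mu> > 0" and \<psi>: "\<psi> \<in> L2_space" "L2_inner \<psi> \<psi> = 1"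
    and eig: "L2_eq (sol (adj \<psi>)) (\<lambda>x. \<mu> * \<psi> x)"
  obtains \<phi> s where "L2_eq \<phi> \<psi>" "\<phi> 0 = 0" "continuous_on {0..1} \<phi>" "continuous_on {0..1} s"
    "\<And>x. x \<in> {0..1} \<Longrightarrow>
      ((\<lambda>x. exp (C x) * \<phi> x) has_real_derivative (w x)\<^sup>2 * s x / sqrt \<mu>) (at x within {0..1})"
    "\<And>x. x \<in> {0..1} \<Longrightarrow>
      (\<phi> has_real_derivative w x * s x / (a x * sqrt \<mu>) - b x / a x * \<phi> x) (at x within {0..1})"
    "\<And>x. x \<in> {0..1} \<Longrightarrow> (\<phi> x)\<^sup>2 + (w x * s x)\<^sup>2 \<le> 2 * exp growth"
proof -
  \<comment> \<open>Values of \<open>sol\<close> are continuous, so dividing the eigenvalue equation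
    by \<mu> produces the continuous representative of \<psi>.\<close>
  define \<phi> where "\<phi> x = sol (adj \<psi>) x / \<mu>" for x
  define H where "H x = integral {x..1} (\<lambda>t. exp (- C t) * \<phi> t)" for x
  \<comment> \<open>The scaling splits 1 / \<mu> evenly between the equations for y and s, as the
    cancellation in the energy requires.\<close>
  define s where "s x = H x / sqrt \<mu>" for x
  define y where "y x = exp (C x) * \<phi> x" for x
  have sq: "sqrt \<mu> > 0" "sqrt \<mu> * sqrt \<mu> = \<mu>" using \<mu> by auto
  have \<phi>_cont: "continuous_on {0..1} \<phi>"
    unfolding \<phi>_def using \<mu> by (intro continuous_on_divide sol_cont adj_L2 \<psi> continuous_on_const) auto
  have \<phi>\<psi>: "L2_eq \<phi> \<psi>"
    using eig \<mu> unfolding L2_eq_def \<phi>_def by (auto elim: eventually_mono)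
  have \<phi>0: "\<phi> 0 = 0" by (simp add: \<phi>_def sol_def)
  have H_deriv: "(H has_real_derivative - (exp (- C x) * \<phi> x)) (at x within {0..1})" if "x \<in> {0..1}" for x
    unfolding H_def
    by (rule integral_has_real_derivative'[OF continuous_on_mult[OF expC_cont(2) \<phi>_cont] that])
  have s_deriv: "(s has_real_derivative - (exp (- C x) * \<phi> x) / sqrt \<mu>) (at x within {0..1})" if "x \<in> {0..1}" for x
    unfolding s_def by (rule DERIV_cdivide[OF H_deriv[OF that]])
  have s_cont: "continuous_on {0..1} s"
    using s_deriv by (meson DERIV_continuous continuous_on_eq_continuous_within)
  have H_eq: "adj \<psi> t = w t * H t" if "t \<in> {0..1}" for t
  proof -
    have "L2_eq (\<lambda>x. exp (- C x) * \<psi> x) (\<lambda>x. exp (- C x) * \<phi> x)"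
      using \<phi>\<psi> unfolding L2_eq_def by (auto elim: eventually_mono)
    then show ?thesis
      unfolding adj_def w_def H_def using L2_eq_integral[of _ _ t 1] that by simp
  qed
  have y_eq: "y x = integral {0..x} (\<lambda>t. (w t)\<^sup>2 * s t) / sqrt \<mu>" if x: "x \<in> {0..1}" for x
  proof -
    have "integral {0..x} (\<lambda>t. exp (C t) / a t * adj \<psi> t) = integral {0..x} (\<lambda>t. (w t)\<^sup>2 * s t * sqrt \<mu>)"
    proof (rule integral_cong)
      fix t assume "t \<in> {0..x}"
      then have "t \<in> {0..1}" using x by auto
      from H_eq[OF this] show "exp (C t) / a t * adj \<psi> t = (w t)\<^sup>2 * s t * sqrt \<mu>"
        using sq(1) unfolding w_def[symmetric] by (simp add: s_def power2_eq_square)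
    qed
    also have "\<dots> = integral {0..x} (\<lambda>t. (w t)\<^sup>2 * s t) * sqrt \<mu>"
      by (rule integral_mult_left)
    finally have "y x = integral {0..x} (\<lambda>t. (w t)\<^sup>2 * s t) * sqrt \<mu> / \<mu>"
      by (simp add: y_def \<phi>_def sol_def exp_minus)
    also have "\<dots> = integral {0..x} (\<lambda>t. (w t)\<^sup>2 * s t) / sqrt \<mu>"
    proof -
      have "sqrt \<mu> / \<mu> = 1 / sqrt \<mu>" using \<mu> by (simp add: real_div_sqrt field_simps)
      then show ?thesis by (simp only: times_divide_eq_right[symmetric]) simp
    qed
    finally show ?thesis .
  qed
  have y_deriv: "(y has_real_derivative (w x)\<^sup>2 * s x / sqrt \<mu>) (at x within {0..1})" if x: "x \<in> {0..1}" for x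
  proof (rule has_real_derivative_cong_on[OF _ x y_eq])
    show "((\<lambda>x. integral {0..x} (\<lambda>t. (w t)\<^sup>2 * s t) / sqrt \<mu>) has_real_derivative (w x)\<^sup>2 * s x / sqrt \<mu>) (at x within {0..1})"
      by (intro DERIV_cdivide integral_has_real_derivative continuous_on_mult continuous_on_power w_cont s_cont x)
  qed
  have \<phi>_deriv: "(\<phi> has_real_derivative w x * s x / (a x * sqrt \<mu>) - b x / a x * \<phi> x) (at x within {0..1})"
    if x: "x \<in> {0..1}" for x
  proof (rule has_real_derivative_cong_on[OF _ x])
    have "((\<lambda>x. exp (- C x) * y x) has_real_derivative
        exp (- C x) * - (b x / a x) * y x + (w x)\<^sup>2 * s x / sqrt \<mu> * exp (- C x)) (at x within {0..1})"
      by (rule DERIV_mult[OF expC_deriv(2)[OF x] y_deriv[OF x]])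
    moreover have "exp (- C x) * - (b x / a x) * y x + (w x)\<^sup>2 * s x / sqrt \<mu> * exp (- C x)
        = w x * s x / (a x * sqrt \<mu>) - b x / a x * \<phi> x"
      using a_nonzero[OF x] sq by (simp add: y_def w_def exp_minus field_simps power2_eq_square)
    ultimately show "((\<lambda>x. exp (- C x) * y x) has_real_derivative
        w x * s x / (a x * sqrt \<mu>) - b x / a x * \<phi> x) (at x within {0..1})" by simp
    show "\<phi> x = exp (- C x) * y x" for x by (simp add: y_def exp_minus)
  qed
  have int1: "integral {0..1} (\<lambda>x. (\<phi> x)\<^sup>2) = 1"
  proof -
    have "L2_inner \<phi> \<phi> = 1"
      using L2_inner_cong_AE[OF L2_continuous[OF \<phi>_cont] \<psi>(1) L2_continuous[OF \<phi>_cont] \<psi>(1) \<phi>\<psi> \<phi>\<psi>] \<psi>(2) by simp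
    then show ?thesis
      unfolding L2_inner_eq_integral[OF L2_continuous[OF \<phi>_cont] L2_continuous[OF \<phi>_cont]] power2_eq_square .
  qed
  have i\<phi>: "(\<lambda>x. (\<phi> x)\<^sup>2) integrable_on {0..1}"
    by (intro integrable_continuous_interval continuous_on_power \<phi>_cont)
  have ws: "(\<lambda>x. (w x * s x)\<^sup>2) integrable_on {0..1}"
    by (intro integrable_continuous_interval continuous_on_power continuous_on_mult w_cont s_cont)
  \<comment> \<open>(s y)' is the difference of the two parts of the energy divided by sqrt \<mu>,
    and s y vanishes at both ends: y at 0 and s at 1.\<close>
  have int2: "integral {0..1} (\<lambda>x. (w x * s x)\<^sup>2) = 1"
  proof -
    have "((\<lambda>x. ((w x * s x)\<^sup>2 - (\<phi> x)\<^sup>2) / sqrt \<mu>) has_integral s 1 * y 1 - s 0 * y 0) {0..1}"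
    proof (rule fundamental_theorem_of_calculus)
      fix x :: real assume x: "x \<in> {0..1}"
      have "- (exp (- C x) * \<phi> x) / sqrt \<mu> * y x + (w x)\<^sup>2 * s x / sqrt \<mu> * s x
          = ((w x * s x)\<^sup>2 - (\<phi> x)\<^sup>2) / sqrt \<mu>"
        using sq by (simp add: y_def exp_minus field_simps power2_eq_square)
      with DERIV_mult[OF s_deriv[OF x] y_deriv[OF x]]
      show "((\<lambda>x. s x * y x) has_vector_derivative ((w x * s x)\<^sup>2 - (\<phi> x)\<^sup>2) / sqrt \<mu>) (at x within {0..1})"
        by (simp add: has_real_derivative_iff_has_vector_derivative)
    qed simp
    moreover have "s 1 * y 1 - s 0 * y 0 = 0" by (simp add: s_def H_def y_def \<phi>0)
    ultimately have "integral {0..1} (\<lambda>x. ((w x * s x)\<^sup>2 - (\<phi> x)\<^sup>2) / sqrt \<mu>) = 0"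
      by (simp only: integral_unique)
    then have "integral {0..1} (\<lambda>x. (w x * s x)\<^sup>2 - (\<phi> x)\<^sup>2) = 0"
      using sq by simp
    then show ?thesis
      using Henstock_Kurzweil_Integration.integral_diff[OF ws i\<phi>] int1 by simp
  qed
  define E where "E x = (\<phi> x)\<^sup>2 + (w x * s x)\<^sup>2" for x
  define E' where "E' x = 2 * (- (b x / a x)) * (\<phi> x)\<^sup>2 + 2 * (b x / a x - a' x / a x) * (w x * s x)\<^sup>2" for x
  have E_deriv: "(E has_real_derivative E' x) (at x within {0..1})" if x: "x \<in> {0..1}" for x
  proof -
    have "(E has_real_derivative
        2 * (w x * s x / (a x * sqrt \<mu>) - b x / a x * \<phi> x) * \<phi> x
        + 2 * (w x * (b x / a x - a' x / a x) * s x + - (exp (- C x) * \<phi> x) / sqrt \<mu> * w x) * (w x * s x))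
        (at x within {0..1})"
      unfolding E_def
      by (rule derivative_eq_intros \<phi>_deriv[OF x] w_deriv[OF x] s_deriv[OF x] refl)+ (simp add: algebra_simps)
    \<comment> \<open>By this identity both cross terms are 2 \<phi> w s / (a sqrt \<mu>), with
      opposite signs.\<close>
    moreover have "exp (- C x) * w x = 1 / a x"
      by (simp add: w_def exp_minus)
    then have "exp (- C x) * \<phi> x / sqrt \<mu> * w x = \<phi> x / (a x * sqrt \<mu>)"
      by (metis (no_types, opaque_lifting) mult.commute mult.left_commute mult.right_neutral times_divide_eq_left times_divide_times_eq)
    then have "2 * (w x * s x / (a x * sqrt \<mu>) - b x / a x * \<phi> x) * \<phi> x
        + 2 * (w x * (b x / a x - a' x / a x) * s x + - (exp (- C x) * \<phi> x) / sqrt \<mu> * w x) * (w x * s x) = E' x"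
      unfolding E'_def by (simp add: power2_eq_square algebra_simps)
    ultimately show ?thesis by simp
  qed
  have E'_le: "\<bar>E' x\<bar> \<le> growth * E x" if x: "x \<in> {0..1}" for x
  proof -
    have "\<bar>E' x\<bar> \<le> 2 * \<bar>b x / a x\<bar> * (\<phi> x)\<^sup>2 + 2 * \<bar>b x / a x - a' x / a x\<bar> * (w x * s x)\<^sup>2"
      unfolding E'_def
      by (rule order_trans[OF abs_triangle_ineq])
         (simp only: abs_mult abs_minus_cancel abs_numeral abs_power2 order_refl)
    also have "\<dots> \<le> growth * (\<phi> x)\<^sup>2 + growth * (w x * s x)\<^sup>2"
      using growth x by (intro add_mono mult_right_mono) auto
    finally show ?thesis by (simp add: E_def distrib_left)
  qed
  have E_le: "E x \<le> 2 * exp growth" if x: "x \<in> {0..1}" for x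
  proof -
    \<comment> \<open>E at x is compared with E at every t; averaging over t brings in the total
      energy 1 + 1.\<close>
    have "E x = integral {0..1} (\<lambda>t::real. E x)" by simp
    also have "\<dots> \<le> integral {0..1} (\<lambda>t. exp growth * E t)"
    proof (rule integral_le)
      show "(\<lambda>t. exp growth * E t) integrable_on {0..1}"
        unfolding E_def by (intro integrable_on_mult_right integrable_add i\<phi> ws)
      show "E x \<le> exp growth * E t" if "t \<in> {0..1}" for t
        using growth(1) by (intro Gronwall[OF E_deriv E'_le _ _ x that]) (auto simp: E_def)
    qed auto
    also have "\<dots> = exp growth * (integral {0..1} (\<lambda>x. (\<phi> x)\<^sup>2) + integral {0..1} (\<lambda>x. (w x * s x)\<^sup>2))"
      unfolding E_def by (subst Henstock_Kurzweil_Integration.integral_add[OF i\<phi> ws, symmetric]) (rule integral_mult_right)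
    finally show ?thesis by (simp add: int1 int2)
  qed
  show thesis
    using \<phi>\<psi> \<phi>0 \<phi>_cont s_cont y_deriv[unfolded y_def[abs_def]] \<phi>_deriv E_le[unfolded E_def] by (rule that)
qed

text \<open>Multiplication by e^C removes the term with b / a from the derivative, so the last
  estimate carries the factor 1 / sqrt \<mu> alone. The upper bound for the eigenvalues is read off
  from that estimate, the bounds on the eigenfunctions from the other two.\<close>

lemma eigenfunction_bounds:
  obtains K where "K > 0"
    "\<And>\<mu> \<psi>. \<lbrakk>\<mu> > 0; \<psi> \<in> L2_space; L2_inner \<psi> \<psi> = 1; L2_eq (sol (adj \<psi>)) (\<lambda>x. \<mu> * \<psi> x)\<rbrakk> \<Longrightarrow>
      \<exists>\<phi> \<phi>'. L2_eq \<phi> \<psi> \<and> \<phi> 0 = 0 \<and> continuous_on {0..1} \<phi>' \<and>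
        (\<forall>x\<in>{0..1}. (\<phi> has_real_derivative \<phi>' x) (at x within {0..1}) \<and>
          \<bar>\<phi> x\<bar> \<le> K \<and> \<bar>\<phi>' x\<bar> \<le> K * (1 + 1 / sqrt \<mu>)) \<and>
        (\<forall>x\<in>{0..1}. \<forall>t\<in>{0..1}. \<bar>exp (C x) * \<phi> x - exp (C t) * \<phi> t\<bar> \<le> K / sqrt \<mu> * \<bar>x - t\<bar>)"
proof -
  define G where "G = sqrt (2 * exp growth)"
  have G: "G > 0" "G\<^sup>2 = 2 * exp growth" by (simp_all add: G_def)
  obtain B where B: "B > 0" "\<And>x. x \<in> {0..1} \<Longrightarrow> \<bar>b x / a x\<bar> \<le> B"
    using continuous_on_Icc_bound[OF ba_cont] by blast
  obtain W where W: "W > 0" "\<And>x. x \<in> {0..1} \<Longrightarrow> \<bar>w x\<bar> \<le> W"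
    using continuous_on_Icc_bound[OF w_cont] by blast
  have "continuous_on {0..1} (\<lambda>x. 1 / a x)"
    using a_nonzero by (intro continuous_on_divide a_cont continuous_on_const) auto
  then obtain A where A: "A > 0" "\<And>x. x \<in> {0..1} \<Longrightarrow> \<bar>1 / a x\<bar> \<le> A"
    using continuous_on_Icc_bound by blast
  define K where "K = G + G * B + G * A + W * G"
  have K: "G \<le> K" "G * B \<le> K" "G * A \<le> K" "W * G \<le> K" "K > 0"
    using G B A W by (auto simp: K_def intro!: add_pos_pos)
  show thesis
  proof (rule that[OF \<open>K > 0\<close>])
    fix \<mu> \<psi>
    assume \<mu>: "\<mu> > 0" and \<psi>: "\<psi> \<in> L2_space" "L2_inner \<psi> \<psi> = 1" "L2_eq (sol (adj \<psi>)) (\<lambda>x. \<mu> * \<psi> x)"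
    obtain \<phi> s where \<phi>: "L2_eq \<phi> \<psi>" "\<phi> 0 = 0" and \<phi>_cont: "continuous_on {0..1} \<phi>" and s_cont: "continuous_on {0..1} s"
      and y: "\<And>x. x \<in> {0..1} \<Longrightarrow>
        ((\<lambda>x. exp (C x) * \<phi> x) has_real_derivative (w x)\<^sup>2 * s x / sqrt \<mu>) (at x within {0..1})"
      and d: "\<And>x. x \<in> {0..1} \<Longrightarrow>
        (\<phi> has_real_derivative w x * s x / (a x * sqrt \<mu>) - b x / a x * \<phi> x) (at x within {0..1})"
      and E: "\<And>x. x \<in> {0..1} \<Longrightarrow> (\<phi> x)\<^sup>2 + (w x * s x)\<^sup>2 \<le> 2 * exp growth"
      by (rule eigenfunction_energy[OF \<mu> \<psi>]) (rule that)
    have sq: "sqrt \<mu> > 0" using \<mu> by simp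
    have le: "\<bar>\<phi> x\<bar> \<le> G" "\<bar>w x * s x\<bar> \<le> G" if "x \<in> {0..1}" for x
    proof -
      have "(\<phi> x)\<^sup>2 \<le> G\<^sup>2" "(w x * s x)\<^sup>2 \<le> G\<^sup>2"
        using E[OF that] zero_le_power2[of "\<phi> x"] zero_le_power2[of "w x * s x"] unfolding G(2) by linarith+
      then show "\<bar>\<phi> x\<bar> \<le> G" "\<bar>w x * s x\<bar> \<le> G"
        using G(1) abs_le_square_iff[of _ G] by auto
    qed
    define \<phi>' where "\<phi>' x = w x * s x / (a x * sqrt \<mu>) - b x / a x * \<phi> x" for x
    have "continuous_on {0..1} \<phi>'"
      unfolding \<phi>'_def using a_nonzero sq
      by (intro continuous_on_diff continuous_on_mult continuous_on_divide w_cont s_cont \<phi>_cont ba_cont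
          a_cont b_cont continuous_on_const) auto
    moreover have "\<bar>\<phi>' x\<bar> \<le> K * (1 + 1 / sqrt \<mu>)" if x: "x \<in> {0..1}" for x
    proof -
      have "\<phi>' x = w x * s x * (1 / a x) * (1 / sqrt \<mu>) - \<phi> x * (b x / a x)"
        by (simp add: \<phi>'_def)
      then have "\<bar>\<phi>' x\<bar> \<le> \<bar>w x * s x * (1 / a x) * (1 / sqrt \<mu>)\<bar> + \<bar>\<phi> x * (b x / a x)\<bar>"
        by (metis abs_triangle_ineq4)
      also have "\<dots> = \<bar>w x * s x\<bar> * \<bar>1 / a x\<bar> * (1 / sqrt \<mu>) + \<bar>\<phi> x\<bar> * \<bar>b x / a x\<bar>"
        using sq by (simp add: abs_mult)
      also have "\<dots> \<le> G * A * (1 / sqrt \<mu>) + G * B"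
        using le[OF x] A B x sq G by (intro add_mono mult_mono) auto
      also have "\<dots> \<le> K * (1 / sqrt \<mu>) + K"
        using K sq by (intro add_mono mult_right_mono) auto
      finally show ?thesis by (simp add: distrib_left)
    qed
    moreover have "\<bar>\<phi> x\<bar> \<le> K" if "x \<in> {0..1}" for x
      using le(1)[OF that] K(1) by linarith
    moreover have "\<bar>exp (C x) * \<phi> x - exp (C t) * \<phi> t\<bar> \<le> K / sqrt \<mu> * \<bar>x - t\<bar>"
      if xt: "x \<in> {0..1}" "t \<in> {0..1}" for x t
    proof -
      have "\<bar>(w z)\<^sup>2 * s z / sqrt \<mu>\<bar> \<le> K / sqrt \<mu>" if z: "z \<in> {0..1}" for z
      proof -
        have "\<bar>(w z)\<^sup>2 * s z\<bar> = \<bar>w z\<bar> * \<bar>w z * s z\<bar>" by (simp add: power2_eq_square abs_mult)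
        also have "\<dots> \<le> W * G" using W z le(2)[OF z] by (intro mult_mono) auto
        also have "\<dots> \<le> K" by (rule K)
        finally show ?thesis using sq by (simp add: divide_right_mono)
      qed
      then have "norm (exp (C x) * \<phi> x - exp (C t) * \<phi> t) \<le> K / sqrt \<mu> * norm (x - t)"
        by (intro field_differentiable_bound[OF convex_real_interval(5) y]) (use xt in auto)
      then show ?thesis by simp
    qed
    ultimately show "\<exists>\<phi> \<phi>'. L2_eq \<phi> \<psi> \<and> \<phi> 0 = 0 \<and> continuous_on {0..1} \<phi>' \<and>
        (\<forall>x\<in>{0..1}. (\<phi> has_real_derivative \<phi>' x) (at x within {0..1}) \<and>
          \<bar>\<phi> x\<bar> \<le> K \<and> \<bar>\<phi>' x\<bar> \<le> K * (1 + 1 / sqrt \<mu>)) \<and>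
        (\<forall>x\<in>{0..1}. \<forall>t\<in>{0..1}. \<bar>exp (C x) * \<phi> x - exp (C t) * \<phi> t\<bar> \<le> K / sqrt \<mu> * \<bar>x - t\<bar>)"
      using \<phi> d unfolding \<phi>'_def[symmetric] by blast
  qed
qed

end

section \<open>Upper bounds for the eigenvalues\<close>

lemma integral_partition:
  fixes f :: "real \<Rightarrow> real"
  assumes f: "f integrable_on {0..1}" and m: "m > 0"
  shows "integral {0..1} f = (\<Sum>i<m. integral {real i / real m..(real i + 1) / real m} f)"
proof -
  have "integral {0..real n / real m} f = (\<Sum>i<n. integral {real i / real m..(real i + 1) / real m} f)"
    if "n \<le> m" for n
    using that
  proof (induction n)
    case (Suc n)
    have "integral {0..real n / real m} f + integral {real n / real m..real (Suc n) / real m} f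
        = integral {0..real (Suc n) / real m} f"
    proof (rule Henstock_Kurzweil_Integration.integral_combine)
      show "f integrable_on {0..real (Suc n) / real m}"
        by (rule integrable_subinterval_real[OF f]) (use Suc.prems m in \<open>auto simp: field_simps\<close>)
    qed (auto intro!: divide_right_mono)
    with Suc show ?case by (simp add: add.commute)
  qed simp
  from this[of m] show ?thesis using m by simp
qed

lemma integral_near_constant:
  fixes h :: "real \<Rightarrow> real"
  assumes h: "h integrable_on {l..r}" and "l \<le> r" and le: "\<And>x. x \<in> {l..r} \<Longrightarrow> \<bar>h x - c\<bar> \<le> \<epsilon>"
  shows "\<bar>integral {l..r} h - c * (r - l)\<bar> \<le> \<epsilon> * (r - l)"
proof -
  have "integral {l..r} h \<le> integral {l..r} (\<lambda>x. c + \<epsilon>)"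
    by (rule integral_le[OF h]) (use le in \<open>auto simp: abs_le_iff algebra_simps\<close>)
  moreover have "integral {l..r} (\<lambda>x. c - \<epsilon>) \<le> integral {l..r} h"
    by (rule integral_le[OF _ h]) (use le in \<open>auto simp: abs_le_iff algebra_simps\<close>)
  ultimately show ?thesis
    using \<open>l \<le> r\<close> by (simp add: abs_le_iff algebra_simps)
qed

lemma L2_restrict:
  assumes f: "f \<in> L2_space"
  shows "(\<lambda>x. if x \<in> {l..r} then f x else 0) \<in> L2_space"
proof -
  have m: "(\<lambda>x. if x \<in> {l..r} then f x else 0) \<in> borel_measurable unit_lebesgue"
  proof (rule measurable_If_set[OF L2_measurable[OF f] measurable_const])
    have "{l..r} \<inter> {0..1} \<in> sets (lebesgue_on {0..1})"
      by (auto simp: sets_restrict_space)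
    then show "{l..r} \<inter> space unit_lebesgue \<in> sets unit_lebesgue" by simp
  qed simp
  have "integrable unit_lebesgue (\<lambda>x. (if x \<in> {l..r} then f x else 0)\<^sup>2)"
  proof (rule Bochner_Integration.integrable_bound)
    show "integrable unit_lebesgue (\<lambda>x. (f x)\<^sup>2)" using f by (simp add: L2_space_def)
    show "(\<lambda>x. (if x \<in> {l..r} then f x else 0)\<^sup>2) \<in> borel_measurable unit_lebesgue"
      using m by (rule borel_measurable_power)
  qed auto
  with m show ?thesis by (simp add: L2_space_def)
qed

context first_order_ode_C1
begin

text \<open>Positivity is a by-product of the lower bound; it makes 1 / sqrt (ev k)
  available.\<close>

lemma eigenvalue_pos:
  assumes "ordered_eigenbasis a b \<psi> ev" "k \<ge> 1"
  shows "ev k > 0"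
proof -
  obtain c where "c > 0" "c / (real k)\<^sup>2 \<le> ev k"
    using eigenvalue_lower_bound assms by metis
  moreover have "c / (real k)\<^sup>2 > 0" using \<open>c > 0\<close> assms(2) by simp
  ultimately show ?thesis by linarith
qed

lemma ordered_eigenbasisD:
  assumes "ordered_eigenbasis a b \<psi> ev" "k \<ge> 1"
  shows "\<psi> k \<in> L2_space" "L2_inner (\<psi> k) (\<psi> k) = 1" "L2_eq (sol (adj (\<psi> k))) (\<lambda>x. ev k * \<psi> k x)"
  using assms L2_eigenfunction_RRT[of "ev k" "\<psi> k"]
  by (auto simp: ordered_eigenbasis_def L2_orthonormal_basis_def)

text \<open>If \<open>ev k\<close> were too large, then \<open>\<psi>\<^sub>1, \<dots>, \<psi>\<^sub>k\<close> would nearly be functions of their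
  means over the \<open>m\<close> intervals of a partition with \<open>m < k\<close>, contradicting orthonormality.\<close>

lemma eigenvalue_upper_bound:
  obtains c where "c > 0" "\<And>\<psi> ev k. ordered_eigenbasis a b \<psi> ev \<Longrightarrow> k \<ge> 1 \<Longrightarrow> ev k \<le> c / (real k)\<^sup>2"
proof -
  obtain K where K: "K > 0" and reg:
    "\<And>\<mu> \<psi>. \<lbrakk>\<mu> > 0; \<psi> \<in> L2_space; L2_inner \<psi> \<psi> = 1; L2_eq (sol (adj \<psi>)) (\<lambda>x. \<mu> * \<psi> x)\<rbrakk> \<Longrightarrow>
      \<exists>\<phi> \<phi>'. L2_eq \<phi> \<psi> \<and> \<phi> 0 = 0 \<and> continuous_on {0..1} \<phi>' \<and>
        (\<forall>x\<in>{0..1}. (\<phi> has_real_derivative \<phi>' x) (at x within {0..1}) \<and>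
          \<bar>\<phi> x\<bar> \<le> K \<and> \<bar>\<phi>' x\<bar> \<le> K * (1 + 1 / sqrt \<mu>)) \<and>
        (\<forall>x\<in>{0..1}. \<forall>t\<in>{0..1}. \<bar>exp (C x) * \<phi> x - exp (C t) * \<phi> t\<bar> \<le> K / sqrt \<mu> * \<bar>x - t\<bar>)"
    by (rule eigenfunction_bounds) (rule that)
  obtain V where V: "V > 0" "\<And>x. x \<in> {0..1} \<Longrightarrow> \<bar>exp (- C x)\<bar> \<le> V"
    using continuous_on_Icc_bound[OF expC_cont(2)] by blast
  obtain W where W: "W > 0" "\<And>x. x \<in> {0..1} \<Longrightarrow> \<bar>exp (C x)\<bar> \<le> W"
    using continuous_on_Icc_bound[OF expC_cont(1)] by blast
  define T where "T = max 1 (V\<^sup>2 * W\<^sup>2)"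
  have T: "T \<ge> 1" "V\<^sup>2 * W\<^sup>2 \<le> T" by (auto simp: T_def)
  \<comment> \<open>The square of the final estimate k sqrt (ev k) \<le> 16 T V K.\<close>
  define c where "c = (16 * T * V * K)\<^sup>2"
  have "c > 0" using T V K by (simp add: c_def)
  moreover have "ev k \<le> c / (real k)\<^sup>2" if \<psi>: "ordered_eigenbasis a b \<psi> ev" and k: "k \<ge> 1" for \<psi> ev k
  proof -
    note pos = eigenvalue_pos[OF \<psi>] and eig = ordered_eigenbasisD[OF \<psi>]
    \<comment> \<open>A common Lipschitz constant of e^C \<phi>_j for all j \<le> k, since
      \<open>ev k\<close> is the smallest of these eigenvalues.\<close>
    define D where "D = K / sqrt (ev k)"
    have D: "D > 0" using K pos[OF k] by (simp add: D_def)
    have "\<exists>\<phi>. L2_eq \<phi> (\<psi> j) \<and> \<phi> 0 = 0 \<and> continuous_on {0..1} \<phi> \<and>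
        (\<forall>x\<in>{0..1}. \<forall>t\<in>{0..1}. \<bar>exp (C x) * \<phi> x - exp (C t) * \<phi> t\<bar> \<le> D * \<bar>x - t\<bar>)"
      if j: "j \<in> {1..k}" for j
    proof -
      have j1: "j \<ge> 1" using j by simp
      obtain \<phi> \<phi>' where \<phi>: "L2_eq \<phi> (\<psi> j)" "\<phi> 0 = 0"
        "\<forall>x\<in>{0..1}. (\<phi> has_real_derivative \<phi>' x) (at x within {0..1}) \<and>
          \<bar>\<phi> x\<bar> \<le> K \<and> \<bar>\<phi>' x\<bar> \<le> K * (1 + 1 / sqrt (ev j))"
        "\<forall>x\<in>{0..1}. \<forall>t\<in>{0..1}. \<bar>exp (C x) * \<phi> x - exp (C t) * \<phi> t\<bar> \<le> K / sqrt (ev j) * \<bar>x - t\<bar>"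
        using reg[OF pos[OF j1] eig[OF j1]] by blast
      have "ev k \<le> ev j" using ev_antimono[OF \<psi> j1, of k] j by simp
      then have "K / sqrt (ev j) \<le> D"
        unfolding D_def using K pos[OF k] pos[OF j1] by (intro divide_left_mono) auto
      then have "K / sqrt (ev j) * \<bar>x - t\<bar> \<le> D * \<bar>x - t\<bar>" for x t
        by (intro mult_right_mono) auto
      then have "\<forall>x\<in>{0..1}. \<forall>t\<in>{0..1}. \<bar>exp (C x) * \<phi> x - exp (C t) * \<phi> t\<bar> \<le> D * \<bar>x - t\<bar>"
        using \<phi>(4) order_trans by blast
      moreover have "continuous_on {0..1} \<phi>"
        using \<phi>(3) by (meson DERIV_continuous continuous_on_eq_continuous_within)
      ultimately show ?thesis using \<phi>(1,2) by blast
    qed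
    then obtain \<phi> where \<phi>: "\<And>j. j \<in> {1..k} \<Longrightarrow> L2_eq (\<phi> j) (\<psi> j)" "\<And>j. j \<in> {1..k} \<Longrightarrow> \<phi> j 0 = 0"
        "\<And>j. j \<in> {1..k} \<Longrightarrow> continuous_on {0..1} (\<phi> j)"
      and lip: "\<And>j x t. j \<in> {1..k} \<Longrightarrow> x \<in> {0..1} \<Longrightarrow> t \<in> {0..1} \<Longrightarrow>
        \<bar>exp (C x) * \<phi> j x - exp (C t) * \<phi> j t\<bar> \<le> D * \<bar>x - t\<bar>"
      by metis
    have \<phi>L2: "\<phi> j \<in> L2_space" if "j \<in> {1..k}" for j
      using \<phi>(3)[OF that] by (rule L2_continuous)
    have \<phi>1: "L2_inner (\<phi> j) (\<phi> j) = 1" if j: "j \<in> {1..k}" for j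
    proof -
      have "j \<ge> 1" using j by simp
      from L2_inner_cong_AE[OF \<phi>L2[OF j] eig(1)[OF this] \<phi>L2[OF j] eig(1)[OF this] \<phi>(1)[OF j] \<phi>(1)[OF j]]
      show ?thesis using eig(2)[OF \<open>j \<ge> 1\<close>] by simp
    qed
    have \<phi>y: "\<bar>\<phi> j x\<bar> \<le> V * \<bar>exp (C x) * \<phi> j x\<bar>" if "x \<in> {0..1}" for j x
    proof -
      have "\<phi> j x = exp (- C x) * (exp (C x) * \<phi> j x)" by (simp add: exp_minus)
      then have "\<bar>\<phi> j x\<bar> = \<bar>exp (- C x)\<bar> * \<bar>exp (C x) * \<phi> j x\<bar>" by (metis abs_mult)
      also have "\<dots> \<le> V * \<bar>exp (C x) * \<phi> j x\<bar>"
        using V(2)[OF that] by (intro mult_right_mono) auto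
      finally show ?thesis .
    qed
    \<comment> \<open>A function of norm 1 that vanishes at 0 cannot be too flat. This settles the
      small k, for which the floor below could leave no interval.\<close>
    have VD: "1 \<le> V * D"
    proof -
      have kk: "k \<in> {1..k}" using k by simp
      have "L2_inner (\<phi> k) (\<phi> k) \<le> (V * D)\<^sup>2 * (1 - 0)"
      proof (rule L2_inner_self_le[OF \<phi>L2[OF kk]])
        fix x :: real assume x: "x \<in> {0..1}"
        have "\<bar>\<phi> k x\<bar> \<le> V * \<bar>exp (C x) * \<phi> k x\<bar>" by (rule \<phi>y[OF x])
        also have "\<bar>exp (C x) * \<phi> k x\<bar> \<le> D * \<bar>x - 0\<bar>"
          using lip[OF kk x, of 0] \<phi>(2)[OF kk] by simp
        also have "D * \<bar>x - 0\<bar> \<le> D * 1" using x D by (intro mult_left_mono) auto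
        finally show "\<bar>\<phi> k x\<bar> \<le> V * D" using V by simp
      qed auto
      then have "1\<^sup>2 \<le> (V * D)\<^sup>2" using \<phi>1[OF kk] by simp
      then show ?thesis by (rule power2_le_imp_le) (use V D in simp)
    qed
    \<comment> \<open>The norms of k orthonormal functions are split into the means over m
      intervals, which contribute at most a multiple of m whatever k is, and the oscillation within
      the intervals.\<close>
    have main: "real k \<le> 2 * (V\<^sup>2 * W\<^sup>2) * real m + 2 * real k * (V * D)\<^sup>2 / (real m)\<^sup>2" if m: "m > 0" for m
    proof -
      define l where "l i = real i / real m" for i
      define r where "r i = (real i + 1) / real m" for i
      have lr: "l i \<le> r i" "r i - l i = 1 / real m" for i
        by (auto simp: l_def r_def divide_right_mono add_divide_distrib)
      have sub: "{l i..r i} \<subseteq> {0..1}" if "i < m" for i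
        using that m by (auto simp: l_def r_def field_simps)
      \<comment> \<open>Dual to averaging: the inner product with \<phi>_j is the mean of e^C
        \<phi>_j over the i-th interval.\<close>
      define q where "q i x = (if x \<in> {l i..r i} then real m * exp (C x) else 0)" for i x
      have q: "q i \<in> L2_space" for i
        unfolding q_def by (intro L2_restrict L2_cmult L2_continuous expC_cont)
      define M where "M i j = L2_inner (q i) (\<psi> j)" for i j
      have M_eq: "M i j = real m * integral {l i..r i} (\<lambda>x. exp (C x) * \<phi> j x)"
        if "i < m" and j: "j \<in> {1..k}" for i j
      proof -
        have "M i j = L2_inner (q i) (\<phi> j)"
          unfolding M_def using q \<phi>L2[OF j] \<phi>(1)[OF j] eig(1)[of j] j
          by (intro L2_inner_cong_AE L2_eq_refl) (auto intro: L2_eq_sym)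
        also have "\<dots> = integral {l i..r i} (\<lambda>x. q i x * \<phi> j x)"
          unfolding L2_inner_eq_integral[OF q \<phi>L2[OF j]]
          by (rule integral_zero_outside[OF sub[OF \<open>i < m\<close>]]) (auto simp: q_def)
        also have "\<dots> = integral {l i..r i} (\<lambda>x. real m * (exp (C x) * \<phi> j x))"
          by (rule integral_cong) (simp add: q_def)
        also have "\<dots> = real m * integral {l i..r i} (\<lambda>x. exp (C x) * \<phi> j x)"
          by (rule integral_mult_right)
        finally show ?thesis .
      qed
      \<comment> \<open>The number k drops out here, because the \<psi>_j are orthonormal and
        \<open>q i\<close> is one fixed vector.\<close>
      have Bessel: "(\<Sum>j=1..k. (M i j)\<^sup>2) \<le> W\<^sup>2 * real m" if "i < m" for i
      proof -
        have "(\<Sum>j=1..k. (M i j)\<^sup>2) \<le> 1 * L2_inner (q i) (q i)"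
          unfolding M_def
        proof (rule L2_Bessel[where \<mu> = "\<lambda>_. 1"])
          show "L2_inner (\<psi> i) (\<psi> j) = (if i = j then 1 else 0)" if "i \<in> {1..k}" "j \<in> {1..k}" for i j
            using \<psi> that by (simp add: ordered_eigenbasis_def L2_orthonormal_basis_def)
        qed (use q eig(1) in auto)
        also have "L2_inner (q i) (q i) \<le> (real m * W)\<^sup>2 * (r i - l i)"
        proof (rule L2_inner_self_le[OF q lr(1) sub[OF that]])
          fix x assume "x \<in> {l i..r i}"
          moreover from this have "\<bar>exp (C x)\<bar> \<le> W" using sub[OF that] by (intro W) blast
          ultimately show "\<bar>q i x\<bar> \<le> real m * W" by (simp add: q_def mult_left_mono)
        qed (auto simp: q_def)
        also have "\<dots> = W\<^sup>2 * real m"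
          unfolding lr using m by (simp add: power2_eq_square)
        finally show ?thesis by simp
      qed
      have near: "\<bar>exp (C x) * \<phi> j x - M i j\<bar> \<le> D / real m"
        if i: "i < m" and j: "j \<in> {1..k}" and x: "x \<in> {l i..r i}" for i j x
      proof -
        have x01: "x \<in> {0..1}" using sub[OF i] x by blast
        have "\<bar>integral {l i..r i} (\<lambda>x. exp (C x) * \<phi> j x) - exp (C x) * \<phi> j x * (r i - l i)\<bar> \<le> D / real m * (r i - l i)"
        proof (rule integral_near_constant[OF _ lr(1)])
          show "(\<lambda>x. exp (C x) * \<phi> j x) integrable_on {l i..r i}"
            by (rule L2_integrable_on_subinterval(1)[OF L2_continuous_mult[OF expC_cont(1) \<phi>L2[OF j]] sub[OF i]])
          fix t assume t: "t \<in> {l i..r i}"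
          then have "t \<in> {0..1}" using sub[OF i] by blast
          from lip[OF j this x01] have "\<bar>exp (C t) * \<phi> j t - exp (C x) * \<phi> j x\<bar> \<le> D * \<bar>t - x\<bar>" .
          also have "\<bar>t - x\<bar> \<le> r i - l i" using t x by auto
          finally show "\<bar>exp (C t) * \<phi> j t - exp (C x) * \<phi> j x\<bar> \<le> D / real m"
            unfolding lr using D by (simp add: mult_left_mono)
        qed
        moreover have "\<bar>exp (C x) * \<phi> j x - M i j\<bar>
            = real m * \<bar>integral {l i..r i} (\<lambda>x. exp (C x) * \<phi> j x) - exp (C x) * \<phi> j x * (r i - l i)\<bar>"
        proof -
          have "M i j - exp (C x) * \<phi> j x
              = real m * (integral {l i..r i} (\<lambda>x. exp (C x) * \<phi> j x) - exp (C x) * \<phi> j x * (r i - l i))"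
            unfolding M_eq[OF i j] lr using m by (simp add: right_diff_distrib)
          then show ?thesis by (subst abs_minus_commute) (simp only: abs_mult abs_of_nat)
        qed
        ultimately show ?thesis unfolding lr using m by (simp add: field_simps)
      qed
      have piece: "integral {l i..r i} (\<lambda>x. (\<phi> j x)\<^sup>2) \<le> 2 * V\<^sup>2 / real m * (M i j)\<^sup>2 + 2 * (V * D)\<^sup>2 / (real m) ^ 3"
        if i: "i < m" and j: "j \<in> {1..k}" for i j
      proof -
        have "integral {l i..r i} (\<lambda>x. (\<phi> j x)\<^sup>2) \<le> integral {l i..r i} (\<lambda>x. V\<^sup>2 * (2 * (M i j)\<^sup>2 + 2 * (D / real m)\<^sup>2))"
        proof (rule integral_le)
          show "(\<lambda>x. (\<phi> j x)\<^sup>2) integrable_on {l i..r i}"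
            by (rule L2_integrable_on_subinterval(2)[OF \<phi>L2[OF j] sub[OF i]])
          fix x assume x: "x \<in> {l i..r i}"
          then have x01: "x \<in> {0..1}" using sub[OF i] by blast
          define Y where "Y = exp (C x) * \<phi> j x"
          have "\<bar>Y - M i j\<bar> \<le> D / real m" unfolding Y_def by (rule near[OF i j x])
          then have "(Y - M i j)\<^sup>2 \<le> (D / real m)\<^sup>2"
            using power_mono[of "\<bar>Y - M i j\<bar>" "D / real m" 2] by simp
          moreover have "Y\<^sup>2 \<le> 2 * (M i j)\<^sup>2 + 2 * (Y - M i j)\<^sup>2"
          proof -
            have "2 * (M i j)\<^sup>2 + 2 * (Y - M i j)\<^sup>2 - Y\<^sup>2 = (Y - 2 * M i j)\<^sup>2" by algebra
            then show ?thesis by (smt (verit) zero_le_power2)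
          qed
          ultimately have Y: "Y\<^sup>2 \<le> 2 * (M i j)\<^sup>2 + 2 * (D / real m)\<^sup>2" by linarith
          have "\<bar>\<phi> j x\<bar>\<^sup>2 \<le> (V * \<bar>Y\<bar>)\<^sup>2"
            unfolding Y_def by (rule power_mono[OF \<phi>y[OF x01]]) simp
          also have "\<dots> = V\<^sup>2 * Y\<^sup>2" by (simp add: power_mult_distrib)
          also have "\<dots> \<le> V\<^sup>2 * (2 * (M i j)\<^sup>2 + 2 * (D / real m)\<^sup>2)"
            using Y by (intro mult_left_mono) auto
          finally show "(\<phi> j x)\<^sup>2 \<le> V\<^sup>2 * (2 * (M i j)\<^sup>2 + 2 * (D / real m)\<^sup>2)" by simp
        qed (rule integrable_const_ivl)
        also have "\<dots> = V\<^sup>2 * (2 * (M i j)\<^sup>2 + 2 * (D / real m)\<^sup>2) * (r i - l i)"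
          using lr(1)[of i] by simp
        also have "\<dots> = 2 * V\<^sup>2 / real m * (M i j)\<^sup>2 + 2 * (V * D)\<^sup>2 / (real m) ^ 3"
          unfolding lr using m by (simp add: field_simps power2_eq_square power3_eq_cube)
        finally show ?thesis .
      qed
      have "real k = (\<Sum>j=1..k. L2_inner (\<phi> j) (\<phi> j))" using \<phi>1 by simp
      also have "\<dots> = (\<Sum>j=1..k. \<Sum>i<m. integral {l i..r i} (\<lambda>x. (\<phi> j x)\<^sup>2))"
      proof (rule sum.cong[OF refl])
        fix j assume j: "j \<in> {1..k}"
        show "L2_inner (\<phi> j) (\<phi> j) = (\<Sum>i<m. integral {l i..r i} (\<lambda>x. (\<phi> j x)\<^sup>2))"
          unfolding L2_inner_eq_integral[OF \<phi>L2[OF j] \<phi>L2[OF j]] l_def r_def power2_eq_square[symmetric]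
          by (rule integral_partition[OF L2_space_integrable_on(2)[OF \<phi>L2[OF j]] m])
      qed
      also have "\<dots> \<le> (\<Sum>j=1..k. \<Sum>i<m. 2 * V\<^sup>2 / real m * (M i j)\<^sup>2 + 2 * (V * D)\<^sup>2 / (real m) ^ 3)"
        by (intro sum_mono piece) auto
      also have "\<dots> = 2 * V\<^sup>2 / real m * (\<Sum>i<m. \<Sum>j=1..k. (M i j)\<^sup>2) + real k * (real m * (2 * (V * D)\<^sup>2 / (real m) ^ 3))"
        by (simp add: sum.distrib sum_distrib_left sum.swap[of _ "{..<m}"])
      also have "\<dots> \<le> 2 * V\<^sup>2 / real m * (\<Sum>i<m. W\<^sup>2 * real m) + real k * (real m * (2 * (V * D)\<^sup>2 / (real m) ^ 3))"
        by (intro add_right_mono mult_left_mono sum_mono Bessel) auto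
      also have "\<dots> = 2 * (V\<^sup>2 * W\<^sup>2) * real m + 2 * real k * (V * D)\<^sup>2 / (real m)\<^sup>2"
        using m by (simp add: field_simps power2_eq_square power3_eq_cube)
      finally show ?thesis .
    qed
    \<comment> \<open>Taking m as the floor of k / (4 T) makes the first term of \<open>main\<close>
      at most k / 2. The second is then at least k / 2, which means m \<le> 2 V D, and k / (4 T)
      \<le> m + 1 \<le> 2 m.\<close>
    have "real k \<le> 16 * T * (V * D)"
    proof (cases "real k < 4 * T")
      case True
      have "4 * T * 1 \<le> 16 * T * (V * D)" using T VD by (intro mult_mono) auto
      with True show ?thesis by linarith
    next
      case False
      define m where "m = nat \<lfloor>real k / (4 * T)\<rfloor>"
      have k4: "1 \<le> real k / (4 * T)" using False T by simp
      have mle: "real m \<le> real k / (4 * T)" and mge: "real k / (4 * T) \<le> real m + 1" and m1: "1 \<le> m"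
        using k4 unfolding m_def by linarith+
      have "2 * (V\<^sup>2 * W\<^sup>2) * real m \<le> 2 * T * (real k / (4 * T))"
        using T mle by (intro mult_mono) auto
      also have "\<dots> = real k / 2" using T by simp
      finally have "real k / 2 \<le> 2 * real k * (V * D)\<^sup>2 / (real m)\<^sup>2"
        using main[of m] m1 by linarith
      then have "(real m)\<^sup>2 \<le> (2 * (V * D))\<^sup>2"
        using k m1 by (simp add: field_simps)
      then have m2: "real m \<le> 2 * (V * D)" by (rule power2_le_imp_le) (use VD in simp)
      have "real k / (4 * T) \<le> 4 * (V * D)" using mge m2 m1 by linarith
      then show ?thesis using T by (simp add: field_simps)
    qed
    then have "real k * sqrt (ev k) \<le> 16 * T * V * K"
      using pos[OF k] by (simp add: D_def field_simps)
    then have "(real k * sqrt (ev k))\<^sup>2 \<le> c"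
      unfolding c_def using pos[OF k] by (intro power_mono) auto
    then have "(real k)\<^sup>2 * ev k \<le> c" using pos[OF k] by (simp add: power_mult_distrib)
    then show ?thesis using k by (simp add: field_simps)
  qed
  ultimately show thesis by (rule that)
qed

end

section \<open>The matrix of discrete inner products\<close>

text \<open>Each of the n intervals has an error of at most L / n^2, and the factor n in front of
  the integral turns the sum L / n into L, independently of n.\<close>

lemma Riemann_sum_error:
  fixes h :: "real \<Rightarrow> real"
  assumes h: "h integrable_on {0..1}" and n: "n > 0"
    and lip: "\<And>x t. x \<in> {0..1} \<Longrightarrow> t \<in> {0..1} \<Longrightarrow> \<bar>h x - h t\<bar> \<le> L * \<bar>x - t\<bar>" and "L \<ge> 0"
  shows "\<bar>(\<Sum>j=1..n. h (real j / real n)) - real n * integral {0..1} h\<bar> \<le> L"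
proof -
  have piece: "\<bar>integral {real i / real n..(real i + 1) / real n} h - h ((real i + 1) / real n) * (1 / real n)\<bar>
      \<le> L / real n * (1 / real n)" if i: "i < n" for i
  proof -
    define l where "l = real i / real n"
    define r where "r = (real i + 1) / real n"
    have lr: "l \<le> r" "r - l = 1 / real n"
      by (auto simp: l_def r_def divide_right_mono add_divide_distrib)
    have sub: "{l..r} \<subseteq> {0..1}"
      using i n by (auto simp: l_def r_def field_simps)
    have "\<bar>integral {l..r} h - h r * (r - l)\<bar> \<le> L / real n * (r - l)"
    proof (rule integral_near_constant[OF integrable_subinterval_real[OF h sub] lr(1)])
      fix x assume x: "x \<in> {l..r}"
      have "x \<in> {0..1}" "r \<in> {0..1}" using sub x lr(1) by auto
      then have "\<bar>h x - h r\<bar> \<le> L * \<bar>x - r\<bar>" by (rule lip)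
      also have "\<bar>x - r\<bar> \<le> 1 / real n" using x lr by auto
      finally show "\<bar>h x - h r\<bar> \<le> L / real n" using \<open>L \<ge> 0\<close> by (simp add: mult_left_mono)
    qed
    then show ?thesis unfolding lr(2) unfolding l_def r_def .
  qed
  have "(\<Sum>j=1..n. h (real j / real n)) = (\<Sum>i<n. h ((real i + 1) / real n))"
    by (rule sum.reindex_bij_witness[of _ Suc "\<lambda>j. j - 1"]) (auto simp: of_nat_diff)
  then have "(\<Sum>j=1..n. h (real j / real n)) - real n * integral {0..1} h
      = real n * (\<Sum>i<n. h ((real i + 1) / real n) * (1 / real n) - integral {real i / real n..(real i + 1) / real n} h)"
    unfolding integral_partition[OF h n] sum_subtractf right_diff_distrib using n
    by (simp add: sum_divide_distrib[symmetric])
  also have "\<bar>\<dots>\<bar> \<le> real n * (\<Sum>i<n. L / real n * (1 / real n))"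
    unfolding abs_mult abs_of_nat
    by (intro mult_left_mono order_trans[OF sum_abs] sum_mono) (use piece in \<open>auto simp: abs_minus_commute\<close>)
  also have "\<dots> = L" using n by simp
  finally show ?thesis .
qed

lemma quad_form_gram_matrix:
  "quad_form p (\<lambda>k l. gram_matrix \<phi> n k l - (if k = l then real n else 0)) u
    = (\<Sum>j=1..n. (\<Sum>k=1..p. u k * \<phi> k (real j / real n))\<^sup>2) - real n * (\<Sum>k=1..p. (u k)\<^sup>2)"
proof -
  have "(\<Sum>k=1..p. \<Sum>l=1..p. u k * gram_matrix \<phi> n k l * u l)
      = (\<Sum>k=1..p. \<Sum>l=1..p. \<Sum>j=1..n. (u k * \<phi> k (real j / real n)) * (u l * \<phi> l (real j / real n)))"
    by (simp add: gram_matrix_def sum_distrib_left sum_distrib_right mult_ac)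
  also have "\<dots> = (\<Sum>k=1..p. \<Sum>j=1..n. \<Sum>l=1..p. (u k * \<phi> k (real j / real n)) * (u l * \<phi> l (real j / real n)))"
    by (intro sum.cong refl sum.swap)
  also have "\<dots> = (\<Sum>j=1..n. \<Sum>k=1..p. \<Sum>l=1..p. (u k * \<phi> k (real j / real n)) * (u l * \<phi> l (real j / real n)))"
    by (rule sum.swap)
  also have "\<dots> = (\<Sum>j=1..n. (\<Sum>k=1..p. u k * \<phi> k (real j / real n))\<^sup>2)"
    by (simp add: power2_eq_square sum_product)
  finally have 1: "(\<Sum>k=1..p. \<Sum>l=1..p. u k * gram_matrix \<phi> n k l * u l)
      = (\<Sum>j=1..n. (\<Sum>k=1..p. u k * \<phi> k (real j / real n))\<^sup>2)" .
  have "(\<Sum>k=1..p. \<Sum>l=1..p. u k * (if k = l then real n else 0) * u l) = (\<Sum>k=1..p. real n * (u k)\<^sup>2)"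
  proof (rule sum.cong[OF refl])
    fix k assume k: "k \<in> {1..p}"
    have "(\<Sum>l=1..p. u k * (if k = l then real n else 0) * u l) = (\<Sum>l=1..p. if k = l then real n * (u k)\<^sup>2 else 0)"
      by (intro sum.cong) (auto simp: power2_eq_square)
    then show "(\<Sum>l=1..p. u k * (if k = l then real n else 0) * u l) = real n * (u k)\<^sup>2"
      using k by simp
  qed
  then have 2: "(\<Sum>k=1..p. \<Sum>l=1..p. u k * (if k = l then real n else 0) * u l) = real n * (\<Sum>k=1..p. (u k)\<^sup>2)"
    by (simp add: sum_distrib_left)
  show ?thesis
    unfolding quad_form_def 1[symmetric] 2[symmetric]
    by (simp add: sum_subtractf[symmetric] right_diff_distrib left_diff_distrib)
qed

text \<open>Cauchy-Schwarz for k |u_k| = k^((2 - lam) / 2) times k^(lam / 2) |u_k|. The hypothesis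
  lam > 3 makes the first factor square summable. The series starts at k = 0, where
  \<open>powr\<close> has the value 0.\<close>

lemma weighted_sum_square_le:
  assumes lam: "lam > 3"
  shows "(\<Sum>k=1..p. real k * \<bar>u k\<bar>)\<^sup>2 \<le> (\<Sum>k. real k powr (2 - lam)) * (\<Sum>k=1..p. real k powr lam * (u k)\<^sup>2)"
proof -
  have sm: "summable (\<lambda>k. real k powr (2 - lam))" using lam by (simp add: summable_real_powr_iff)
  have "(\<Sum>k=1..p. real k * \<bar>u k\<bar>)\<^sup>2 = (\<Sum>k=1..p. real k powr ((2 - lam) / 2) * (real k powr (lam / 2) * \<bar>u k\<bar>))\<^sup>2"
  proof -
    have "real k * \<bar>u k\<bar> = real k powr ((2 - lam) / 2) * (real k powr (lam / 2) * \<bar>u k\<bar>)" if "k \<in> {1..p}" for k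
    proof -
      have "real k powr ((2 - lam) / 2) * real k powr (lam / 2) = real k powr 1"
        by (simp add: powr_add[symmetric] diff_divide_distrib)
      then show ?thesis using that by (simp add: mult.assoc[symmetric])
    qed
    then show ?thesis by (intro arg_cong[where f = "\<lambda>s. s\<^sup>2"] sum.cong refl)
  qed
  also have "\<dots> \<le> (\<Sum>k=1..p. (real k powr ((2 - lam) / 2))\<^sup>2) * (\<Sum>k=1..p. (real k powr (lam / 2) * \<bar>u k\<bar>)\<^sup>2)"
    by (rule Cauchy_Schwarz_ineq_sum)
  also have "\<dots> = (\<Sum>k=1..p. real k powr (2 - lam)) * (\<Sum>k=1..p. real k powr lam * (u k)\<^sup>2)"
  proof -
    have "(real k powr (s / 2))\<^sup>2 = real k powr s" for k s
      by (simp add: power2_eq_square powr_add[symmetric])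
    then show ?thesis by (simp only: power_mult_distrib power2_abs)
  qed
  also have "\<dots> \<le> (\<Sum>k. real k powr (2 - lam)) * (\<Sum>k=1..p. real k powr lam * (u k)\<^sup>2)"
    by (intro mult_right_mono sum_le_suminf[OF sm] sum_nonneg) auto
  finally show ?thesis .
qed

lemma gram_matrix_bound:
  fixes \<phi> \<phi>' :: "nat \<Rightarrow> real \<Rightarrow> real"
  assumes d: "\<And>k x. k \<ge> 1 \<Longrightarrow> x \<in> {0..1} \<Longrightarrow> (\<phi> k has_real_derivative \<phi>' k x) (at x within {0..1})"
    and K0: "\<And>k x. k \<ge> 1 \<Longrightarrow> x \<in> {0..1} \<Longrightarrow> \<bar>\<phi> k x\<bar> \<le> K0"
    and K1: "\<And>k x. k \<ge> 1 \<Longrightarrow> x \<in> {0..1} \<Longrightarrow> \<bar>\<phi>' k x\<bar> \<le> K1 * real k"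
    and K: "K0 \<ge> 0" "K1 \<ge> 0"
    and orth: "\<And>k l. k \<ge> 1 \<Longrightarrow> l \<ge> 1 \<Longrightarrow> L2_inner (\<phi> k) (\<phi> l) = (if k = l then 1 else 0)"
    and n: "n \<ge> 1" and lam: "lam > 3"
  shows "\<bar>quad_form p (\<lambda>k l. gram_matrix \<phi> n k l - (if k = l then real n else 0)) u\<bar>
    \<le> 2 * K0 * K1 * (\<Sum>k. real k powr (2 - lam)) * (\<Sum>k=1..p. real k powr lam * (u k)\<^sup>2)"
proof -
  define S where "S = (\<Sum>k=1..p. real k * \<bar>u k\<bar>)"
  have "S \<ge> 0" unfolding S_def by (intro sum_nonneg) auto
  define g where "g x = (\<Sum>k=1..p. u k * \<phi> k x)" for x
  have \<phi>_cont: "continuous_on {0..1} (\<phi> k)" if "k \<ge> 1" for k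
    using d[OF that] by (meson DERIV_continuous continuous_on_eq_continuous_within)
  have g_cont: "continuous_on {0..1} g"
    unfolding g_def by (intro continuous_on_sum continuous_on_mult continuous_on_const \<phi>_cont) auto
  \<comment> \<open>The weight k \<ge> 1 is inserted so that the same S controls both the size and
    the slope of g.\<close>
  have g_le: "\<bar>g x\<bar> \<le> K0 * S" if x: "x \<in> {0..1}" for x
  proof -
    have "\<bar>g x\<bar> \<le> (\<Sum>k=1..p. \<bar>u k * \<phi> k x\<bar>)" unfolding g_def by (rule sum_abs)
    also have "\<dots> \<le> (\<Sum>k=1..p. K0 * (real k * \<bar>u k\<bar>))"
    proof (rule sum_mono)
      fix k assume k: "k \<in> {1..p}"
      have "\<bar>u k * \<phi> k x\<bar> = \<bar>u k\<bar> * \<bar>\<phi> k x\<bar>" by (simp add: abs_mult)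
      also have "\<dots> \<le> (real k * \<bar>u k\<bar>) * K0"
        using k K K0[OF _ x, of k] mult_right_mono[of 1 "real k" "\<bar>u k\<bar>"] by (intro mult_mono) auto
      finally show "\<bar>u k * \<phi> k x\<bar> \<le> K0 * (real k * \<bar>u k\<bar>)" by (simp add: mult_ac)
    qed
    also have "\<dots> = K0 * S" by (simp add: S_def sum_distrib_left)
    finally show ?thesis .
  qed
  have g_lip: "\<bar>g x - g t\<bar> \<le> K1 * S * \<bar>x - t\<bar>" if xt: "x \<in> {0..1}" "t \<in> {0..1}" for x t
  proof -
    have \<phi>_lip: "\<bar>\<phi> k x - \<phi> k t\<bar> \<le> K1 * real k * \<bar>x - t\<bar>" if "k \<ge> 1" for k
    proof -
      have "norm (\<phi> k x - \<phi> k t) \<le> K1 * real k * norm (x - t)"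
        by (rule field_differentiable_bound[OF convex_real_interval(5) d[OF that]]) (use K1[OF that] xt in auto)
      then show ?thesis by simp
    qed
    have "g x - g t = (\<Sum>k=1..p. u k * (\<phi> k x - \<phi> k t))"
      by (simp add: g_def sum_subtractf right_diff_distrib)
    then have "\<bar>g x - g t\<bar> \<le> (\<Sum>k=1..p. \<bar>u k * (\<phi> k x - \<phi> k t)\<bar>)" by (metis sum_abs)
    also have "\<dots> \<le> (\<Sum>k=1..p. \<bar>u k\<bar> * (K1 * real k * \<bar>x - t\<bar>))"
      unfolding abs_mult by (intro sum_mono mult_left_mono \<phi>_lip) auto
    also have "\<dots> = K1 * S * \<bar>x - t\<bar>"
      by (simp add: S_def sum_distrib_left sum_distrib_right mult_ac)
    finally show ?thesis .
  qed
  have lip: "\<bar>(g x)\<^sup>2 - (g t)\<^sup>2\<bar> \<le> 2 * K0 * K1 * S\<^sup>2 * \<bar>x - t\<bar>" if xt: "x \<in> {0..1}" "t \<in> {0..1}" for x t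
  proof -
    have "\<bar>(g x)\<^sup>2 - (g t)\<^sup>2\<bar> = \<bar>g x + g t\<bar> * \<bar>g x - g t\<bar>"
      by (simp add: abs_mult[symmetric] power2_eq_square algebra_simps)
    also have "\<dots> \<le> (2 * (K0 * S)) * (K1 * S * \<bar>x - t\<bar>)"
      using g_le[OF xt(1)] g_le[OF xt(2)] g_lip[OF xt] by (intro mult_mono) auto
    finally show ?thesis by (simp add: power2_eq_square mult_ac)
  qed
  \<comment> \<open>Orthonormality identifies n u^T u with n times the integral of g^2, the limit
    form of the sum over the nodes.\<close>
  have norm_g: "integral {0..1} (\<lambda>x. (g x)\<^sup>2) = (\<Sum>k=1..p. (u k)\<^sup>2)"
  proof -
    have v: "\<phi> k \<in> L2_space" if "k \<in> {1..p}" for k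
      using that by (intro L2_continuous \<phi>_cont) simp
    have "L2_inner (\<lambda>x. 0 - g x) (\<lambda>x. 0 - g x)
        = L2_inner (\<lambda>x. 0) (\<lambda>x. 0) - 2 * (\<Sum>k=1..p. u k * L2_inner (\<lambda>x. 0) (\<phi> k)) + (\<Sum>k=1..p. (u k)\<^sup>2 * 1)"
      unfolding g_def by (rule L2_inner_diff_orthogonal) (use v orth in \<open>auto intro: L2_continuous\<close>)
    also have "\<dots> = (\<Sum>k=1..p. (u k)\<^sup>2)" by (simp add: L2_inner_def)
    also have "L2_inner (\<lambda>x. 0 - g x) (\<lambda>x. 0 - g x) = L2_inner g g" by (simp add: L2_inner_def)
    also have "\<dots> = integral {0..1} (\<lambda>x. (g x)\<^sup>2)"
      unfolding L2_inner_eq_integral[OF L2_continuous[OF g_cont] L2_continuous[OF g_cont]] power2_eq_square ..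
    finally show ?thesis by simp
  qed
  have "\<bar>quad_form p (\<lambda>k l. gram_matrix \<phi> n k l - (if k = l then real n else 0)) u\<bar>
      = \<bar>(\<Sum>j=1..n. (g (real j / real n))\<^sup>2) - real n * integral {0..1} (\<lambda>x. (g x)\<^sup>2)\<bar>"
    unfolding quad_form_gram_matrix norm_g by (simp only: g_def)
  also have "\<dots> \<le> 2 * K0 * K1 * S\<^sup>2"
    by (rule Riemann_sum_error[OF _ _ lip])
       (use n K in \<open>auto intro!: integrable_continuous_interval continuous_on_power g_cont\<close>)
  also have "\<dots> \<le> 2 * K0 * K1 * ((\<Sum>k. real k powr (2 - lam)) * (\<Sum>k=1..p. real k powr lam * (u k)\<^sup>2))"
    unfolding S_def using K by (intro mult_left_mono weighted_sum_square_le lam) auto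
  finally show ?thesis by (simp add: mult.assoc)
qed

lemma sup_norm_le: "(\<And>x. x \<in> {0..1} \<Longrightarrow> \<bar>f x\<bar> \<le> B) \<Longrightarrow> sup_norm f \<le> ereal B"
  unfolding sup_norm_def by (rule SUP_least) simp

lemma deriv01_eq:
  "x \<in> {0..1} \<Longrightarrow> (f has_real_derivative d) (at x within {0..1}) \<Longrightarrow> deriv01 f x = d"
  unfolding deriv01_def has_real_derivative_iff_has_vector_derivative
  by (rule vector_derivative_within_closed_interval) auto

text \<open>The lower bound c / k^2 for the k-th eigenvalue turns 1 + 1 / sqrt (ev k) into at most
  (1 + 1 / sqrt c) k.\<close>

lemma (in first_order_ode_C1) eigenbasis_representatives:
  obtains K0 K1 where "K0 > 0" "K1 > 0"
    "\<And>\<psi> ev. ordered_eigenbasis a b \<psi> ev \<Longrightarrow> \<exists>\<phi> \<phi>'. \<forall>k\<ge>1. L2_eq (\<phi> k) (\<psi> k) \<and>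
      continuous_on {0..1} (\<phi>' k) \<and>
      (\<forall>x\<in>{0..1}. (\<phi> k has_real_derivative \<phi>' k x) (at x within {0..1}) \<and>
        \<bar>\<phi> k x\<bar> \<le> K0 \<and> \<bar>\<phi>' k x\<bar> \<le> K1 * real k)"
proof -
  obtain K where K: "K > 0" and reg:
    "\<And>\<mu> \<psi>. \<lbrakk>\<mu> > 0; \<psi> \<in> L2_space; L2_inner \<psi> \<psi> = 1; L2_eq (sol (adj \<psi>)) (\<lambda>x. \<mu> * \<psi> x)\<rbrakk> \<Longrightarrow>
      \<exists>\<phi> \<phi>'. L2_eq \<phi> \<psi> \<and> \<phi> 0 = 0 \<and> continuous_on {0..1} \<phi>' \<and>
        (\<forall>x\<in>{0..1}. (\<phi> has_real_derivative \<phi>' x) (at x within {0..1}) \<and>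
          \<bar>\<phi> x\<bar> \<le> K \<and> \<bar>\<phi>' x\<bar> \<le> K * (1 + 1 / sqrt \<mu>)) \<and>
        (\<forall>x\<in>{0..1}. \<forall>t\<in>{0..1}. \<bar>exp (C x) * \<phi> x - exp (C t) * \<phi> t\<bar> \<le> K / sqrt \<mu> * \<bar>x - t\<bar>)"
    by (rule eigenfunction_bounds) (rule that)
  obtain c where c: "c > 0" "\<And>\<psi> ev k. ordered_eigenbasis a b \<psi> ev \<Longrightarrow> k \<ge> 1 \<Longrightarrow> c / (real k)\<^sup>2 \<le> ev k"
    by (rule eigenvalue_lower_bound) (rule that)
  define K1 where "K1 = K * (1 + 1 / sqrt c)"
  have "K1 > 0" using K c(1) by (simp add: K1_def add_pos_pos)
  show thesis
  proof (rule that[OF K \<open>K1 > 0\<close>])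
    fix \<psi> ev assume \<psi>: "ordered_eigenbasis a b \<psi> ev"
    have "\<exists>\<phi> \<phi>'. L2_eq \<phi> (\<psi> k) \<and> continuous_on {0..1} \<phi>' \<and>
        (\<forall>x\<in>{0..1}. (\<phi> has_real_derivative \<phi>' x) (at x within {0..1}) \<and>
          \<bar>\<phi> x\<bar> \<le> K \<and> \<bar>\<phi>' x\<bar> \<le> K1 * real k)" if k: "k \<ge> 1" for k
    proof -
      obtain \<phi> \<phi>' where \<phi>: "L2_eq \<phi> (\<psi> k)" "continuous_on {0..1} \<phi>'"
        "\<forall>x\<in>{0..1}. (\<phi> has_real_derivative \<phi>' x) (at x within {0..1}) \<and>
          \<bar>\<phi> x\<bar> \<le> K \<and> \<bar>\<phi>' x\<bar> \<le> K * (1 + 1 / sqrt (ev k))"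
        using reg[OF eigenvalue_pos[OF \<psi> k] ordered_eigenbasisD[OF \<psi> k]] by blast
      have "sqrt c / real k \<le> sqrt (ev k)"
        using real_sqrt_le_mono[OF c(2)[OF \<psi> k]] by (simp add: real_sqrt_divide)
      then have "1 / sqrt (ev k) \<le> 1 / (sqrt c / real k)"
        using c(1) k by (intro divide_left_mono mult_pos_pos) (auto simp: eigenvalue_pos[OF \<psi> k])
      then have "1 + 1 / sqrt (ev k) \<le> (1 + 1 / sqrt c) * real k"
        using k by (simp add: distrib_right)
      then have "K * (1 + 1 / sqrt (ev k)) \<le> K1 * real k"
        using K unfolding K1_def mult.assoc by (intro mult_left_mono) auto
      then show ?thesis using \<phi> order_trans by blast
    qed
    then show "\<exists>\<phi> \<phi>'. \<forall>k\<ge>1. L2_eq (\<phi> k) (\<psi> k) \<and> continuous_on {0..1} (\<phi>' k) \<and>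
      (\<forall>x\<in>{0..1}. (\<phi> k has_real_derivative \<phi>' k x) (at x within {0..1}) \<and>
        \<bar>\<phi> k x\<bar> \<le> K \<and> \<bar>\<phi>' k x\<bar> \<le> K1 * real k)"
      by metis
  qed
qed

text \<open>The four constants precede \<open>\<psi>\<close> and \<open>ev\<close>, which expresses
  that they depend on a and b only. The matrix uses point values, so one family
  \<open>\<phi>\<close> of representatives serves the norms and the matrix alike.\<close>

theorem proposition3p4:
  fixes a b :: "real \<Rightarrow> real"
  assumes a_C2: "Ck_on 2 {0..1} a"
    and b_C1: "Ck_on 1 {0..1} b"
    and a_pos: "\<exists>a0>0. \<forall>x\<in>{0..1}. a x > a0"
  shows
    "(\<forall>C. (\<forall>x\<in>{0..1}. (C has_real_derivative b x / a x) (at x within {0..1})) \<longrightarrow>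
        (\<forall>f\<in>L2_space. \<forall>g.
          ode_solution a b f g \<longleftrightarrow>
          (\<forall>x\<in>{0..1}. g x = exp (- C x) * (LINT t|lebesgue_on {0..x}. exp (C t) / a t * f t))))
     \<and> L2_compact_operator (R_op a b)
     \<and> (\<exists>c1 c2 \<Psi>0 \<Psi>1 :: real. 0 < c1 \<and> c1 < c2 \<and>
         (\<forall>\<psi> ev. ordered_eigenbasis a b \<psi> ev \<longrightarrow>
           (\<forall>k\<ge>1. c1 * real k powr (-2) \<le> ev k \<and> ev k \<le> c2 * real k powr (-2)) \<and>
           (\<exists>\<phi>. (\<forall>k\<ge>1. smooth_representative (\<psi> k) (\<phi> k)) \<and>
             (\<forall>k\<ge>1. sup_norm (\<phi> k) \<le> ereal \<Psi>0 \<and> sup_norm (deriv01 (\<phi> k)) \<le> ereal (\<Psi>1 * real k)) \<and>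
             (SUP k\<in>{1..}. sup_norm (\<phi> k)) < \<infinity> \<and>
             (\<forall>lam>3. \<exists>K. \<forall>n\<ge>1. \<forall>p\<ge>1. \<forall>u.
               \<bar>quad_form p (\<lambda>k l. gram_matrix \<phi> n k l - (if k = l then real n else 0)) u\<bar>
                 \<le> K * (\<Sum>k=1..p. real k powr lam * (u k)\<^sup>2)))))"
proof (intro conjI)
  have pos: "a x > 0" if "x \<in> {0..1}" for x
    using a_pos that by force
  obtain a' where a': "\<And>x. x \<in> {0..1} \<Longrightarrow> (a has_real_derivative a' x) (at x within {0..1})"
      "continuous_on {0..1} a'"
  proof -
    from a_C2 obtain a' a'' where "\<forall>x\<in>{0..1}. (a has_real_derivative a' x) (at x within {0..1})"
      "\<forall>x\<in>{0..1}. (a' has_real_derivative a'' x) (at x within {0..1})"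
      by (auto simp: numeral_2_eq_2)
    then show thesis
      by (intro that[of a']) (auto intro: DERIV_continuous simp: continuous_on_eq_continuous_within)
  qed
  have a_cont: "continuous_on {0..1} a"
    using a'(1) by (meson DERIV_continuous continuous_on_eq_continuous_within)
  have b_cont: "continuous_on {0..1} b"
    using b_C1 by (auto simp: continuous_on_eq_continuous_within intro: DERIV_continuous)
  show "\<forall>C. (\<forall>x\<in>{0..1}. (C has_real_derivative b x / a x) (at x within {0..1})) \<longrightarrow>
        (\<forall>f\<in>L2_space. \<forall>g.
          ode_solution a b f g \<longleftrightarrow>
          (\<forall>x\<in>{0..1}. g x = exp (- C x) * (LINT t|lebesgue_on {0..x}. exp (C t) / a t * f t)))"
  proof (intro allI impI ballI)
    fix C f g
    assume C: "\<forall>x\<in>{0..1}. (C has_real_derivative b x / a x) (at x within {0..1})" and f: "f \<in> L2_space"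
    interpret first_order_ode a b C
      by unfold_locales (use a_cont b_cont pos C in auto)
    show "ode_solution a b f g \<longleftrightarrow>
        (\<forall>x\<in>{0..1}. g x = exp (- C x) * (LINT t|lebesgue_on {0..x}. exp (C t) / a t * f t))"
    proof
      assume "ode_solution a b f g"
      then show "\<forall>x\<in>{0..1}. g x = exp (- C x) * (LINT t|lebesgue_on {0..x}. exp (C t) / a t * f t)"
        by (intro ballI trans[OF ode_solution_imp_sol[OF f] sol_eq[OF f, symmetric]])
    next
      assume g: "\<forall>x\<in>{0..1}. g x = exp (- C x) * (LINT t|lebesgue_on {0..x}. exp (C t) / a t * f t)"
      show "ode_solution a b f g"
        by (rule ode_solution_sol[OF f], rule trans[OF bspec[OF g]], assumption, rule sol_eq[OF f])
    qed
  qed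
  \<comment> \<open>A specific antiderivative determined by a and b, so that the constants extracted
    from the locale depend on nothing else.\<close>
  define C where "C x = integral {0..x} (\<lambda>t. b t / a t)" for x
  have ba: "continuous_on {0..1} (\<lambda>t. b t / a t)"
    using pos by (intro continuous_on_divide a_cont b_cont) force
  interpret first_order_ode_C1 a b C a'
    by unfold_locales
       (use a_cont b_cont pos a' integral_has_real_derivative[OF ba] in \<open>auto simp: C_def[abs_def]\<close>)
  show "L2_compact_operator (R_op a b)" by (rule L2_compact_operator_R_op)
  obtain c1 where c1: "c1 > 0" "\<And>\<psi> ev k. ordered_eigenbasis a b \<psi> ev \<Longrightarrow> k \<ge> 1 \<Longrightarrow> c1 / (real k)\<^sup>2 \<le> ev k"
    by (rule eigenvalue_lower_bound) (rule that)
  obtain c2 where c2: "c2 > 0" "\<And>\<psi> ev k. ordered_eigenbasis a b \<psi> ev \<Longrightarrow> k \<ge> 1 \<Longrightarrow> ev k \<le> c2 / (real k)\<^sup>2"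
    by (rule eigenvalue_upper_bound) (rule that)
  obtain K0 K1 where K: "K0 > 0" "K1 > 0" and rep:
    "\<And>\<psi> ev. ordered_eigenbasis a b \<psi> ev \<Longrightarrow> \<exists>\<phi> \<phi>'. \<forall>k\<ge>1. L2_eq (\<phi> k) (\<psi> k) \<and>
      continuous_on {0..1} (\<phi>' k) \<and>
      (\<forall>x\<in>{0..1}. (\<phi> k has_real_derivative \<phi>' k x) (at x within {0..1}) \<and>
        \<bar>\<phi> k x\<bar> \<le> K0 \<and> \<bar>\<phi>' k x\<bar> \<le> K1 * real k)"
    by (rule eigenbasis_representatives) (rule that)
  have powr: "c * real k powr (-2) = c / (real k)\<^sup>2" for c k
    by (simp add: powr_minus powr_numeral divide_inverse)
  show "\<exists>c1 c2 \<Psi>0 \<Psi>1 :: real. 0 < c1 \<and> c1 < c2 \<and>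
         (\<forall>\<psi> ev. ordered_eigenbasis a b \<psi> ev \<longrightarrow>
           (\<forall>k\<ge>1. c1 * real k powr (-2) \<le> ev k \<and> ev k \<le> c2 * real k powr (-2)) \<and>
           (\<exists>\<phi>. (\<forall>k\<ge>1. smooth_representative (\<psi> k) (\<phi> k)) \<and>
             (\<forall>k\<ge>1. sup_norm (\<phi> k) \<le> ereal \<Psi>0 \<and> sup_norm (deriv01 (\<phi> k)) \<le> ereal (\<Psi>1 * real k)) \<and>
             (SUP k\<in>{1..}. sup_norm (\<phi> k)) < \<infinity> \<and>
             (\<forall>lam>3. \<exists>K. \<forall>n\<ge>1. \<forall>p\<ge>1. \<forall>u.
               \<bar>quad_form p (\<lambda>k l. gram_matrix \<phi> n k l - (if k = l then real n else 0)) u\<bar>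
                 \<le> K * (\<Sum>k=1..p. real k powr lam * (u k)\<^sup>2))))"
  \<comment> \<open>The sum c1 + c2 is used because the claim asks for a strictly larger upper
    constant.\<close>
  proof (rule exI[of _ c1], rule exI[of _ "c1 + c2"], rule exI[of _ K0], rule exI[of _ K1],
      intro conjI allI impI)
    show "0 < c1" "c1 < c1 + c2" using c1 c2 by auto
    fix \<psi> ev assume \<psi>: "ordered_eigenbasis a b \<psi> ev"
    show "c1 * real k powr (-2) \<le> ev k" if "k \<ge> 1" for k
      unfolding powr using c1(2)[OF \<psi> that] .
    show "ev k \<le> (c1 + c2) * real k powr (-2)" if "k \<ge> 1" for k
    proof -
      have "c2 / (real k)\<^sup>2 \<le> (c1 + c2) / (real k)\<^sup>2" using c1(1) by (intro divide_right_mono) auto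
      then show ?thesis unfolding powr using c2(2)[OF \<psi> that] by linarith
    qed
    obtain \<phi> \<phi>' where *: "\<forall>k\<ge>1. L2_eq (\<phi> k) (\<psi> k) \<and> continuous_on {0..1} (\<phi>' k) \<and>
      (\<forall>x\<in>{0..1}. (\<phi> k has_real_derivative \<phi>' k x) (at x within {0..1}) \<and>
        \<bar>\<phi> k x\<bar> \<le> K0 \<and> \<bar>\<phi>' k x\<bar> \<le> K1 * real k)"
      using rep[OF \<psi>] by (elim exE) (rule that)
    have \<phi>: "L2_eq (\<phi> k) (\<psi> k)" "continuous_on {0..1} (\<phi>' k)" if "k \<ge> 1" for k
      using * that by auto
    have d: "(\<phi> k has_real_derivative \<phi>' k x) (at x within {0..1})"
      and K0: "\<bar>\<phi> k x\<bar> \<le> K0" and K1: "\<bar>\<phi>' k x\<bar> \<le> K1 * real k"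
      if "k \<ge> 1" "x \<in> {0..1}" for k x
      using * that by auto
    have sup: "sup_norm (\<phi> k) \<le> ereal K0" if "k \<ge> 1" for k
      by (rule sup_norm_le[OF K0[OF that]])
    have \<phi>L2: "\<phi> k \<in> L2_space" if "k \<ge> 1" for k
      using d[OF that] by (intro L2_continuous) (meson DERIV_continuous continuous_on_eq_continuous_within)
    have orth: "L2_inner (\<phi> k) (\<phi> l) = (if k = l then 1 else 0)" if "k \<ge> 1" "l \<ge> 1" for k l
    proof -
      have "L2_inner (\<phi> k) (\<phi> l) = L2_inner (\<psi> k) (\<psi> l)"
        by (rule L2_inner_cong_AE) (use that \<phi>L2 ordered_eigenbasisD(1)[OF \<psi>] \<phi>(1) in auto)
      then show ?thesis
        using \<psi> that by (simp add: ordered_eigenbasis_def L2_orthonormal_basis_def)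
    qed
    show "\<exists>\<phi>. (\<forall>k\<ge>1. smooth_representative (\<psi> k) (\<phi> k)) \<and>
             (\<forall>k\<ge>1. sup_norm (\<phi> k) \<le> ereal K0 \<and> sup_norm (deriv01 (\<phi> k)) \<le> ereal (K1 * real k)) \<and>
             (SUP k\<in>{1..}. sup_norm (\<phi> k)) < \<infinity> \<and>
             (\<forall>lam>3. \<exists>K. \<forall>n\<ge>1. \<forall>p\<ge>1. \<forall>u.
               \<bar>quad_form p (\<lambda>k l. gram_matrix \<phi> n k l - (if k = l then real n else 0)) u\<bar>
                 \<le> K * (\<Sum>k=1..p. real k powr lam * (u k)\<^sup>2))"
    proof (rule exI[of _ \<phi>], intro conjI allI impI)
      show "smooth_representative (\<psi> k) (\<phi> k)" if "k \<ge> 1" for k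
        unfolding smooth_representative_def One_nat_def Ck_on.simps
        using \<phi>[OF that] d[OF that] by blast
      show "sup_norm (\<phi> k) \<le> ereal K0" if "k \<ge> 1" for k by (rule sup[OF that])
      show "sup_norm (deriv01 (\<phi> k)) \<le> ereal (K1 * real k)" if "k \<ge> 1" for k
        by (rule sup_norm_le) (simp add: deriv01_eq[OF _ d[OF that]] K1[OF that])
      have "(SUP k\<in>{1..}. sup_norm (\<phi> k)) \<le> ereal K0"
        by (rule SUP_least) (simp add: sup)
      then show "(SUP k\<in>{1..}. sup_norm (\<phi> k)) < \<infinity>"
        by (rule le_less_trans) simp
      fix lam :: real assume lam: "lam > 3"
      show "\<exists>K. \<forall>n\<ge>1. \<forall>p\<ge>1. \<forall>u.
          \<bar>quad_form p (\<lambda>k l. gram_matrix \<phi> n k l - (if k = l then real n else 0)) u\<bar>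
            \<le> K * (\<Sum>k=1..p. real k powr lam * (u k)\<^sup>2)"
        \<comment> \<open>Unification finds 2 K0 K1 times the sum of k^(2 - lam), in which neither n
          nor p occurs.\<close>
        by (intro exI allI impI, rule gram_matrix_bound[OF d K0 K1 _ _ orth _ lam]) (use K in auto)
    qed
  qed
qed

end
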